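(* Let $f\colon(\mathbb{R}^2,0)\to(\mathbb{R}^3,0)$ be a frontal with principal curvatures $\kappa_1,\kappa_2$ nowhere zero. If $f$ has at $0$ a pure-frontal singular point other than a $5/2$-cuspidal edge and $\kappa_t\neq0$ at $0$, then $0$ is a singular point of both focal surfaces $C_1$ and $C_2$.
   Context: All maps are $C^\infty$. A map germ $f\colon(\mathbb{R}^2,0)\to(\mathbb{R}^3,0)$ is a frontal if there is a smooth $\nu\colon(\mathbb{R}^2,0)\to\mathbb{S}^2$ (a unit normal vector field) with $\langle df_q(X),\nu(q)\rangle=0$ for all $q$ and $X\in T_q\mathbb{R}^2$. Put $\lambda=\det(f_u,f_v,\nu)$ and $S(f)=\{q: \operatorname{rank}df_q<2\}=\lambda^{-1}(0)$. A singular point is non-degenerate if $d\lambda\ne0$ there; then near it $S(f)$ is a regular curve $\gamma$ (the singular curve) and there is a nowhere vanishing vector field $\eta$ (null vector field) with $df(\eta)=0$ along $\gamma$. It is of the first kind if $\gamma'$ and $\eta$ are linearly independent there. A singular point of the first kind is a pure-frontal singular point if $\psi(t)=\det((f\circ\gamma)'(t),\nu(\gamma(t)),d\nu_{\gamma(t)}(\eta))$ vanishes identically along $\gamma$. $f$ has a $5/2$-cuspidal edge at $0$ if its germ is $\mathcal{A}$-equivalent (equal up to diffeomorphism germs of source and target) to $(u,v)\mapsto(u,v^2,v^5)$ at the origin. Adapted coordinates: around a pure-frontal singular point there are coordinates $(u,v)$ with $S(f)=\{v=0\}$, $\partial_v$ a null vector field, and $\{f_u,f_{vv},\nu\}$ orthonormal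 along the $u$-axis; fix such coordinates. Then $f_v=vh$, $\nu_v=v\nu_1$ with $h,\nu_1$ smooth. Put $\tilde E=\langle f_u,f_u\rangle$, $\tilde F=\langle f_u,h\rangle$, $\tilde G=\langle h,h\rangle$, $\tilde L=-\langle f_u,\nu_u\rangle$, $\tilde M=-\langle h,\nu_u\rangle$, $\tilde N_1=-\langle h,\nu_1\rangle$. The Gaussian and mean curvatures of $f$ extend smoothly as $K=\frac{\tilde L\tilde N_1-\tilde M^2}{\tilde E\tilde G-\tilde F^2}$, $H=\frac{\tilde E\tilde N_1-2\tilde F\tilde M+\tilde G\tilde L}{2(\tilde E\tilde G-\tilde F^2)}$, and the principal curvatures are $\kappa_1=H+\sqrt{H^2-K}$, $\kappa_2=H-\sqrt{H^2-K}$ (distinct and smooth near $0$ if $\kappa_t(0)\ne0$). The cuspidal torsion is $\kappa_t(u)=\tilde M(u,0)$. The focal surface associated to $\kappa_j$ is $C_j=f+\rho_j\nu$ with $\rho_j=1/\kappa_j$ (a map from a neighbourhood of $0$ in $\mathbb{R}^2$ to $\mathbb{R}^3$). A singular point of $C_j$ is a point where $\operatorname{rank}dC_j<2$. *)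

theory Defs
  imports "HOL-Analysis.Analysis"
begin

section \<open>Smooth germs at the origin\<close>

text \<open>Germs at the origin are represented by total functions whose values matter only near \<open>0\<close>.\<close>

text \<open>The sets \<open>S\<close> below are open; a map is of class \<open>C\<^sup>k\<^sup>+\<^sup>1\<close> if it is differentiable with all
  directional derivatives of class \<open>C\<^sup>k\<close>.\<close>

primrec C_k_on :: "nat \<Rightarrow> ('a::euclidean_space \<Rightarrow> 'b::euclidean_space) \<Rightarrow> 'a set \<Rightarrow> bool" where
  "C_k_on 0 f S \<longleftrightarrow> continuous_on S f"
| "C_k_on (Suc k) f S \<longleftrightarrow>
     (\<forall>x\<in>S. f differentiable (at x)) \<and> (\<forall>X. C_k_on k (\<lambda>x. frechet_derivative f (at x) X) S)"

definition smooth_on :: "('a::euclidean_space \<Rightarrow> 'b::euclidean_space) \<Rightarrow> 'a set \<Rightarrow> bool" where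
  "smooth_on f S \<longleftrightarrow> (\<forall>k. C_k_on k f S)"

definition smooth_germ :: "('a::euclidean_space \<Rightarrow> 'b::euclidean_space) \<Rightarrow> bool" where
  "smooth_germ f \<longleftrightarrow> (\<exists>U. open U \<and> 0 \<in> U \<and> smooth_on f U)"

definition diffeo_germ :: "('a::euclidean_space \<Rightarrow> 'a) \<Rightarrow> bool" where
  "diffeo_germ \<phi> \<longleftrightarrow> \<phi> 0 = 0 \<and> smooth_germ \<phi> \<and>
     (\<exists>\<psi>. \<psi> 0 = 0 \<and> smooth_germ \<psi> \<and>
        (\<forall>\<^sub>F x in nhds 0. \<psi> (\<phi> x) = x) \<and> (\<forall>\<^sub>F x in nhds 0. \<phi> (\<psi> x) = x))"

definition A_equivalent ::
    "('a::euclidean_space \<Rightarrow> 'b::euclidean_space) \<Rightarrow> ('a \<Rightarrow> 'b) \<Rightarrow> bool" where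
  "A_equivalent f g \<longleftrightarrow>
     (\<exists>\<phi> \<Phi>. diffeo_germ \<phi> \<and> diffeo_germ \<Phi> \<and> (\<forall>\<^sub>F x in nhds 0. f (\<phi> x) = \<Phi> (g x)))"


section \<open>Frontals and their singular points\<close>

definition pd :: "2 \<Rightarrow> (real^2 \<Rightarrow> 'b::real_normed_vector) \<Rightarrow> real^2 \<Rightarrow> 'b" where
  "pd i f q = frechet_derivative f (at q) (axis i 1)"

definition unit_normal_field :: "(real^2 \<Rightarrow> real^3) \<Rightarrow> (real^2 \<Rightarrow> real^3) \<Rightarrow> bool" where
  "unit_normal_field f \<nu> \<longleftrightarrow> smooth_germ \<nu> \<and>
     (\<forall>\<^sub>F q in nhds 0. norm (\<nu> q) = 1 \<and> (\<forall>X. frechet_derivative f (at q) X \<bullet> \<nu> q = 0))"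

definition frontal :: "(real^2 \<Rightarrow> real^3) \<Rightarrow> bool" where
  "frontal f \<longleftrightarrow> f 0 = 0 \<and> smooth_germ f \<and> (\<exists>\<nu>. unit_normal_field f \<nu>)"

definition singular_point :: "(real^2 \<Rightarrow> real^3) \<Rightarrow> real^2 \<Rightarrow> bool" where
  "singular_point f q \<longleftrightarrow> f differentiable (at q) \<and> rank (jacobian f (at q)) < 2"

definition signed_area_density :: "(real^2 \<Rightarrow> real^3) \<Rightarrow> (real^2 \<Rightarrow> real^3) \<Rightarrow> real^2 \<Rightarrow> real" where
  "signed_area_density f \<nu> q = det (vector [pd 1 f q, pd 2 f q, \<nu> q] :: real^3^3)"

definition nondegenerate_singular :: "(real^2 \<Rightarrow> real^3) \<Rightarrow> (real^2 \<Rightarrow> real^3) \<Rightarrow> bool" where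
  "nondegenerate_singular f \<nu> \<longleftrightarrow> singular_point f 0 \<and>
     (\<exists>X. frechet_derivative (signed_area_density f \<nu>) (at 0) X \<noteq> 0)"

definition singular_curve :: "(real^2 \<Rightarrow> real^3) \<Rightarrow> (real \<Rightarrow> real^2) \<Rightarrow> bool" where
  "singular_curve f \<gamma> \<longleftrightarrow> \<gamma> 0 = 0 \<and>
     (\<exists>\<epsilon>>0. smooth_on \<gamma> {-\<epsilon><..<\<epsilon>} \<and>
        (\<forall>t\<in>{-\<epsilon><..<\<epsilon>}. vector_derivative \<gamma> (at t) \<noteq> 0) \<and>
        (\<exists>W. open W \<and> 0 \<in> W \<and> {q \<in> W. singular_point f q} = \<gamma> ` {-\<epsilon><..<\<epsilon>}))"

definition null_vector_field ::
    "(real^2 \<Rightarrow> real^3) \<Rightarrow> (real \<Rightarrow> real^2) \<Rightarrow> (real^2 \<Rightarrow> real^2) \<Rightarrow> bool" where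
  "null_vector_field f \<gamma> \<eta> \<longleftrightarrow> smooth_germ \<eta> \<and> (\<forall>\<^sub>F q in nhds 0. \<eta> q \<noteq> 0) \<and>
     (\<forall>\<^sub>F t in nhds 0. frechet_derivative f (at (\<gamma> t)) (\<eta> (\<gamma> t)) = 0)"

definition first_kind_at_0 :: "(real \<Rightarrow> real^2) \<Rightarrow> (real^2 \<Rightarrow> real^2) \<Rightarrow> bool" where
  "first_kind_at_0 \<gamma> \<eta> \<longleftrightarrow>
     (\<forall>a b. a *\<^sub>R vector_derivative \<gamma> (at 0) + b *\<^sub>R \<eta> 0 = 0 \<longrightarrow> a = 0 \<and> b = 0)"

definition psi_function :: "(real^2 \<Rightarrow> real^3) \<Rightarrow> (real^2 \<Rightarrow> real^3) \<Rightarrow>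
    (real \<Rightarrow> real^2) \<Rightarrow> (real^2 \<Rightarrow> real^2) \<Rightarrow> real \<Rightarrow> real" where
  "psi_function f \<nu> \<gamma> \<eta> t =
     det (vector [vector_derivative (f \<circ> \<gamma>) (at t), \<nu> (\<gamma> t),
                  frechet_derivative \<nu> (at (\<gamma> t)) (\<eta> (\<gamma> t))] :: real^3^3)"

text \<open>At a non-degenerate singular point the singular curve is unique up to reparametrization, and the
  null vector field along it is unique up to a non-vanishing factor, so the choice of \<open>\<gamma>\<close> and
  \<open>\<eta>\<close> does not matter.\<close>

definition pure_frontal_singular :: "(real^2 \<Rightarrow> real^3) \<Rightarrow> (real^2 \<Rightarrow> real^3) \<Rightarrow> bool" where
  "pure_frontal_singular f \<nu> \<longleftrightarrow> nondegenerate_singular f \<nu> \<and>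
     (\<exists>\<gamma> \<eta>. singular_curve f \<gamma> \<and> null_vector_field f \<gamma> \<eta> \<and> first_kind_at_0 \<gamma> \<eta> \<and>
        (\<forall>\<^sub>F t in nhds 0. psi_function f \<nu> \<gamma> \<eta> t = 0))"

definition cuspidal_edge_5_2 :: "(real^2 \<Rightarrow> real^3) \<Rightarrow> bool" where
  "cuspidal_edge_5_2 f \<longleftrightarrow> A_equivalent f (\<lambda>q. vector [q$1, (q$2)^2, (q$2)^5])"


section \<open>Adapted coordinates and curvatures\<close>

text \<open>The diffeomorphism germ \<open>\<phi>\<close> sends the coordinates \<open>(u, v)\<close> to the corresponding point of the
  source of \<open>f\<close>; \<open>f\<close> and \<open>\<nu>\<close> read in these coordinates are \<open>f \<circ> \<phi>\<close> and \<open>\<nu> \<circ> \<phi>\<close>.\<close>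

definition adapted_coordinates ::
    "(real^2 \<Rightarrow> real^3) \<Rightarrow> (real^2 \<Rightarrow> real^3) \<Rightarrow> (real^2 \<Rightarrow> real^2) \<Rightarrow> bool" where
  "adapted_coordinates f \<nu> \<phi> \<longleftrightarrow> diffeo_germ \<phi> \<and>
     (let g = f \<circ> \<phi>; n = \<nu> \<circ> \<phi> in
      \<forall>\<^sub>F q in nhds 0. (singular_point g q \<longleftrightarrow> q$2 = 0) \<and>
        (q$2 = 0 \<longrightarrow>
           pd 2 g q = 0 \<and>
           norm (pd 1 g q) = 1 \<and> norm (pd 2 (pd 2 g) q) = 1 \<and> norm (n q) = 1 \<and>
           pd 1 g q \<bullet> pd 2 (pd 2 g) q = 0 \<and> pd 1 g q \<bullet> n q = 0 \<and> pd 2 (pd 2 g) q \<bullet> n q = 0))"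

text \<open>If \<open>g\<^sub>v = 0\<close> on \<open>{v = 0}\<close>, then \<open>v_quotient g\<close> is the unique continuous (indeed smooth, by
  Hadamard's lemma) solution \<open>h\<close> of \<open>g\<^sub>v = v h\<close>; on \<open>{v = 0}\<close> it equals \<open>g\<^sub>v\<^sub>v\<close>. It yields \<open>h\<close> from
  the frontal and \<open>\<nu>\<^sub>1\<close> from its unit normal field. From here on, \<open>g\<close> and \<open>n\<close> stand for a frontal
  and its unit normal field read in adapted coordinates.\<close>

definition v_quotient :: "(real^2 \<Rightarrow> real^3) \<Rightarrow> real^2 \<Rightarrow> real^3" where
  "v_quotient g q = (if q$2 = 0 then pd 2 (pd 2 g) q else (1 / q$2) *\<^sub>R pd 2 g q)"

definition E_t :: "(real^2 \<Rightarrow> real^3) \<Rightarrow> real^2 \<Rightarrow> real" where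
  "E_t g q = pd 1 g q \<bullet> pd 1 g q"

definition F_t :: "(real^2 \<Rightarrow> real^3) \<Rightarrow> real^2 \<Rightarrow> real" where
  "F_t g q = pd 1 g q \<bullet> v_quotient g q"

definition G_t :: "(real^2 \<Rightarrow> real^3) \<Rightarrow> real^2 \<Rightarrow> real" where
  "G_t g q = v_quotient g q \<bullet> v_quotient g q"

definition L_t :: "(real^2 \<Rightarrow> real^3) \<Rightarrow> (real^2 \<Rightarrow> real^3) \<Rightarrow> real^2 \<Rightarrow> real" where
  "L_t g n q = - (pd 1 g q \<bullet> pd 1 n q)"

definition M_t :: "(real^2 \<Rightarrow> real^3) \<Rightarrow> (real^2 \<Rightarrow> real^3) \<Rightarrow> real^2 \<Rightarrow> real" where
  "M_t g n q = - (v_quotient g q \<bullet> pd 1 n q)"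

definition N1_t :: "(real^2 \<Rightarrow> real^3) \<Rightarrow> (real^2 \<Rightarrow> real^3) \<Rightarrow> real^2 \<Rightarrow> real" where
  "N1_t g n q = - (v_quotient g q \<bullet> v_quotient n q)"

definition gauss_curvature :: "(real^2 \<Rightarrow> real^3) \<Rightarrow> (real^2 \<Rightarrow> real^3) \<Rightarrow> real^2 \<Rightarrow> real" where
  "gauss_curvature g n q =
     (L_t g n q * N1_t g n q - (M_t g n q)^2) / (E_t g q * G_t g q - (F_t g q)^2)"

definition mean_curvature :: "(real^2 \<Rightarrow> real^3) \<Rightarrow> (real^2 \<Rightarrow> real^3) \<Rightarrow> real^2 \<Rightarrow> real" where
  "mean_curvature g n q =
     (E_t g q * N1_t g n q - 2 * F_t g q * M_t g n q + G_t g q * L_t g n q) /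
     (2 * (E_t g q * G_t g q - (F_t g q)^2))"

definition principal_curvature_1 ::
    "(real^2 \<Rightarrow> real^3) \<Rightarrow> (real^2 \<Rightarrow> real^3) \<Rightarrow> real^2 \<Rightarrow> real" where
  "principal_curvature_1 g n q =
     mean_curvature g n q + sqrt ((mean_curvature g n q)^2 - gauss_curvature g n q)"

definition principal_curvature_2 ::
    "(real^2 \<Rightarrow> real^3) \<Rightarrow> (real^2 \<Rightarrow> real^3) \<Rightarrow> real^2 \<Rightarrow> real" where
  "principal_curvature_2 g n q =
     mean_curvature g n q - sqrt ((mean_curvature g n q)^2 - gauss_curvature g n q)"

definition cuspidal_torsion :: "(real^2 \<Rightarrow> real^3) \<Rightarrow> (real^2 \<Rightarrow> real^3) \<Rightarrow> real \<Rightarrow> real" where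
  "cuspidal_torsion g n u = M_t g n (vector [u, 0])"

definition focal_surface ::
    "(real^2 \<Rightarrow> real) \<Rightarrow> (real^2 \<Rightarrow> real^3) \<Rightarrow> (real^2 \<Rightarrow> real^3) \<Rightarrow> real^2 \<Rightarrow> real^3" where
  "focal_surface \<kappa> g n q = g q + (1 / \<kappa> q) *\<^sub>R n q"

end

theory Submission
  imports Defs
begin

text \<open>
  Write \<open>g\<close> and \<open>n\<close> for the frontal and its unit normal in adapted coordinates, \<open>g\<^sub>v = v h\<close> and
  \<open>n\<^sub>v = v n\<^sub>1\<close>; that \<open>n\<^sub>v\<close> vanishes on the axis is what pure-frontality says
  (\<open>pd_2_normal_zero_on_axis\<close>). For a focal surface \<open>C = g + n / \<kappa>\<close> this gives \<open>C\<^sub>v = (1/\<kappa>)\<^sub>v n\<close> at the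
  origin, so the origin is singular as soon as \<open>\<kappa>\<^sub>v = 0\<close> there.

  Everything is governed by the number \<open>T = h\<^sub>v \<bullet> n\<^sub>1 - h \<bullet> (n\<^sub>1)\<^sub>v\<close> at the origin. A
  computation with the coefficients of the fundamental forms shows \<open>2 H\<^sub>v = T\<close> and \<open>K\<^sub>v = L T\<close>.
  Since \<open>H\<^sup>2 - K\<close> is positive where the cuspidal torsion is non-zero, \<open>T = 0\<close> implies that
  both principal curvatures are differentiable with vanishing \<open>v\<close>-derivative, and both focal
  surfaces are singular (\<open>focal_surfaces_singular\<close>). It remains to see that \<open>T \<noteq> 0\<close> forces a
  5/2-cuspidal edge (\<open>A_equivalent_cuspidal_edge_5_2\<close>).

  For that, coordinates of source and target are chosen in which the frontal is
  \<open>(u, v\<^sup>2, k(u, v))\<close>. The even part of \<open>k\<close> is a smooth function of \<open>(u, v\<^sup>2)\<close> by Whitney's theorem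
  on even functions (\<open>whitney_even\<close>) and can be subtracted in the target. In the odd part the
  terms of order one and three vanish because \<open>g\<^sub>v\<close> and \<open>n\<^sub>v\<close> vanish on the axis, so that it equals
  \<open>v\<^sup>5 c(u, v\<^sup>2)\<close> (\<open>fifth_order_decomposition\<close>). If \<open>c\<close> is non-zero at the origin, dividing the last
  target coordinate by \<open>c\<close> gives the normal form. If \<open>c\<close> were zero there, a
  submersion \<open>Z\<close> of the target would satisfy \<open>Z \<circ> g = v\<^sup>5 C\<close> with \<open>C = 0\<close> at the origin; then \<open>n\<close> may be replaced in \<open>T\<close> by the gradient of \<open>Z\<close> along
  \<open>g\<close>, and \<open>T\<close> becomes the commutator \<open>h\<^sub>v \<bullet> Hess(h) - h \<bullet> Hess(h\<^sub>v)\<close>, which is zero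
  (\<open>invariant_zero_of_high_contact\<close>).

  Whitney's theorem needs a smooth extension of \<open>F(x, \<surd>y)\<close> to negative \<open>y\<close>. It is built by
  Seeley's reflection \<open>A(x, y) = (\<Sum>k. c\<^sub>k A(x, - 4\<^sup>k y))\<close> with coefficients whose moments
  \<open>(\<Sum>k. c\<^sub>k (- 4\<^sup>k)\<^sup>j)\<close> are all one.
\<close>

section \<open>Smooth maps and smooth germs\<close>

lemma C_k_on_cong:
  assumes "open S" "\<And>x. x \<in> S \<Longrightarrow> f x = g x"
  shows "C_k_on k f S \<longleftrightarrow> C_k_on k g S"
  using assms(2)
proof (induction k arbitrary: f g)
  case 0
  then show ?case by (simp cong: continuous_on_cong)
next
  case (Suc k)
  have "f differentiable (at x) \<longleftrightarrow> g differentiable (at x)" if "x \<in> S" for x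
    unfolding differentiable_def
    using has_derivative_transform_within_open[OF _ assms(1) that] Suc.prems by metis
  moreover have "frechet_derivative f (at x) = frechet_derivative g (at x)" if "x \<in> S" for x
    unfolding frechet_derivative_def
    using has_derivative_transform_within_open[OF _ assms(1) that] Suc.prems by metis
  ultimately show ?case
    using Suc.IH[of "\<lambda>x. frechet_derivative f (at x) X" "\<lambda>x. frechet_derivative g (at x) X" for X]
    by simp
qed

lemma C_k_on_subset: "C_k_on k f T \<Longrightarrow> S \<subseteq> T \<Longrightarrow> C_k_on k f S"
proof (induction k arbitrary: f)
  case 0
  then show ?case by (auto intro: continuous_on_subset)
next
  case (Suc k)
  then show ?case by auto
qed

lemma C_k_on_SucI:
  assumes "open S" "\<And>x. x \<in> S \<Longrightarrow> (f has_derivative f' x) (at x)"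
    and "\<And>X. C_k_on k (\<lambda>x. f' x X) S"
  shows "C_k_on (Suc k) f S"
proof -
  have "frechet_derivative f (at x) X = f' x X" if "x \<in> S" for x X
    using frechet_derivative_at[OF assms(2)[OF that]] by simp
  then have "C_k_on k (\<lambda>x. frechet_derivative f (at x) X) S" for X
    by (subst C_k_on_cong[OF assms(1), of _ "\<lambda>x. f' x X"]) (auto intro: assms(3))
  then show ?thesis using assms(2) by (auto simp: differentiable_def)
qed

lemma C_k_on_SucD: "C_k_on (Suc k) f S \<Longrightarrow> C_k_on k f S"
proof (induction k arbitrary: f)
  case 0
  then show ?case
    by (auto intro!: continuous_at_imp_continuous_on differentiable_imp_continuous_within)
next
  case (Suc k)
  then show ?case by (metis C_k_on.simps(2))
qed

lemma C_k_on_continuous: "C_k_on k f S \<Longrightarrow> continuous_on S f"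
proof (induction k)
  case (Suc k)
  then show ?case using C_k_on_SucD by blast
qed simp

lemma C_k_on_const: "C_k_on k (\<lambda>x. c) S"
  by (induction k arbitrary: c) auto

lemma C_k_on_bounded_linear:
  assumes "bounded_linear f" "open S" shows "C_k_on k f S"
proof (cases k)
  case 0
  then show ?thesis using assms by (simp add: linear_continuous_on)
next
  case (Suc m)
  show ?thesis unfolding Suc
    by (rule C_k_on_SucI[OF assms(2) bounded_linear_imp_has_derivative[OF assms(1)] C_k_on_const])
qed

lemma C_k_on_add:
  assumes "open S" "C_k_on k f S" "C_k_on k g S"
  shows "C_k_on k (\<lambda>x. f x + g x) S"
  using assms(2,3)
proof (induction k arbitrary: f g)
  case 0
  then show ?case by (simp add: continuous_on_add)
next
  case (Suc k)
  show ?case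
  proof (rule C_k_on_SucI[OF assms(1)])
    show "((\<lambda>x. f x + g x) has_derivative
        (\<lambda>X. frechet_derivative f (at x) X + frechet_derivative g (at x) X)) (at x)" if "x \<in> S" for x
      using Suc.prems that
      by (intro has_derivative_add) (auto simp: frechet_derivative_works[symmetric])
  qed (use Suc in auto)
qed

lemma C_k_on_bilinear:
  assumes B: "bounded_bilinear B" and S: "open S" and "C_k_on k f S" "C_k_on k g S"
  shows "C_k_on k (\<lambda>x. B (f x) (g x)) S"
  using assms(3,4)
proof (induction k arbitrary: f g)
  case 0
  then show ?case by (auto intro: bounded_bilinear.continuous_on[OF B])
next
  case (Suc k)
  show ?case
  proof (rule C_k_on_SucI[OF S])
    show "((\<lambda>x. B (f x) (g x)) has_derivative
        (\<lambda>X. B (f x) (frechet_derivative g (at x) X) + B (frechet_derivative f (at x) X) (g x))) (at x)"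
      if "x \<in> S" for x
      using Suc.prems that
      by (intro bounded_bilinear.FDERIV[OF B]) (auto simp: frechet_derivative_works[symmetric])
    show "C_k_on k (\<lambda>x. B (f x) (frechet_derivative g (at x) X)
        + B (frechet_derivative f (at x) X) (g x)) S" for X
      using Suc.prems C_k_on_SucD[OF Suc.prems(1)] C_k_on_SucD[OF Suc.prems(2)]
      by (intro C_k_on_add[OF S] Suc.IH) auto
  qed
qed

lemma C_k_on_sum:
  assumes "open S" "\<And>i. i \<in> I \<Longrightarrow> C_k_on k (f i) S"
  shows "C_k_on k (\<lambda>x. \<Sum>i\<in>I. f i x) S"
  using assms(2)
  by (induction I rule: infinite_finite_induct) (auto intro: C_k_on_const C_k_on_add[OF assms(1)])

text \<open>In a basis the chain rule expresses the derivative of a composition by products of derivatives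
  of \<open>g\<close> with partial derivatives of \<open>f\<close> composed with \<open>g\<close>. The latter have one order less, hence
  the induction over all \<open>f\<close>.\<close>

lemma C_k_on_compose:
  assumes S: "open S" and "C_k_on k f T" "C_k_on k g S" "g ` S \<subseteq> T"
  shows "C_k_on k (\<lambda>x. f (g x)) S"
  using assms(2,3)
proof (induction k arbitrary: f)
  case 0
  then show ?case using assms(4) by (auto intro: continuous_on_compose2)
next
  case (Suc k)
  let ?D = "\<lambda>x X. \<Sum>b\<in>Basis. (frechet_derivative g (at x) X \<bullet> b) *\<^sub>R frechet_derivative f (at (g x)) b"
  have g: "C_k_on k g S" by (rule C_k_on_SucD[OF Suc.prems(2)])
  show ?case
  proof (rule C_k_on_SucI[OF S])
    fix x assume x: "x \<in> S"
    then have gx: "g x \<in> T" using assms(4) by auto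
    have df: "(f has_derivative frechet_derivative f (at (g x))) (at (g x))"
      using Suc.prems gx by (auto simp: frechet_derivative_works[symmetric])
    have dg: "(g has_derivative frechet_derivative g (at x)) (at x)"
      using Suc.prems x by (auto simp: frechet_derivative_works[symmetric])
    interpret L: bounded_linear "frechet_derivative f (at (g x))"
      using df by (rule has_derivative_bounded_linear)
    have "frechet_derivative f (at (g x)) Y = (\<Sum>b\<in>Basis. (Y \<bullet> b) *\<^sub>R frechet_derivative f (at (g x)) b)" for Y
      by (subst euclidean_representation[of Y, symmetric]) (simp add: L.sum L.scaleR)
    then have "(\<lambda>X. frechet_derivative f (at (g x)) (frechet_derivative g (at x) X)) = ?D x"
      by blast
    with has_derivative_compose[OF dg df] show "((\<lambda>x. f (g x)) has_derivative ?D x) (at x)"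
      by (rule back_subst)
  next
    fix X
    have "C_k_on k (\<lambda>x. frechet_derivative f (at (g x)) b) S" for b
      using Suc.prems g by (intro Suc.IH) auto
    moreover have "C_k_on k (\<lambda>x. frechet_derivative g (at x) X \<bullet> b) S" for b
      using Suc.prems
      by (intro C_k_on_bilinear[OF bounded_bilinear_inner S] C_k_on_const) auto
    ultimately show "C_k_on k (\<lambda>x. ?D x X) S"
      by (intro C_k_on_sum[OF S] C_k_on_bilinear[OF bounded_bilinear_scaleR S])
  qed
qed

text \<open>All exponents are treated at once because differentiation lowers the exponent. Reciprocals and
  square roots of smooth functions are obtained from here.\<close>

lemma C_k_on_powr: "C_k_on k (\<lambda>x::real. x powr a) {0<..}"
proof (induction k arbitrary: a)
  case 0
  then show ?case by (auto intro!: continuous_intros)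
next
  case (Suc k)
  show ?case
  proof (rule C_k_on_SucI)
    show "((\<lambda>x. x powr a) has_derivative (\<lambda>X. X * (a * x powr (a - 1)))) (at x)"
      if "x \<in> {0<..}" for x
      using has_real_derivative_powr[of x a] that
      by (simp add: has_field_derivative_def mult.commute[of _ "a * _"])
    show "C_k_on k (\<lambda>x. X * (a * x powr (a - 1))) {0<..}" for X
      by (intro C_k_on_bilinear[OF bounded_bilinear_mult] C_k_on_const Suc) auto
  qed auto
qed

lemma smooth_on_cong:
  "open S \<Longrightarrow> (\<And>x. x \<in> S \<Longrightarrow> f x = g x) \<Longrightarrow> smooth_on f S \<longleftrightarrow> smooth_on g S"
  unfolding smooth_on_def using C_k_on_cong by blast

lemma smooth_on_eq:
  "open S \<Longrightarrow> smooth_on f S \<Longrightarrow> (\<And>x. x \<in> S \<Longrightarrow> f x = g x) \<Longrightarrow> smooth_on g S"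
  using smooth_on_cong by metis

lemma smooth_on_subset: "smooth_on f T \<Longrightarrow> S \<subseteq> T \<Longrightarrow> smooth_on f S"
  unfolding smooth_on_def using C_k_on_subset by blast

lemma smooth_on_const: "smooth_on (\<lambda>x. c) S"
  unfolding smooth_on_def using C_k_on_const by blast

lemma smooth_on_bounded_linear: "bounded_linear f \<Longrightarrow> open S \<Longrightarrow> smooth_on f S"
  unfolding smooth_on_def using C_k_on_bounded_linear by blast

lemma smooth_on_add:
  "open S \<Longrightarrow> smooth_on f S \<Longrightarrow> smooth_on g S \<Longrightarrow> smooth_on (\<lambda>x. f x + g x) S"
  unfolding smooth_on_def using C_k_on_add by blast

lemma smooth_on_bilinear:
  "bounded_bilinear B \<Longrightarrow> open S \<Longrightarrow> smooth_on f S \<Longrightarrow> smooth_on g S \<Longrightarrow> smooth_on (\<lambda>x. B (f x) (g x)) S"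
  unfolding smooth_on_def using C_k_on_bilinear by blast

lemmas smooth_on_mult = smooth_on_bilinear[OF bounded_bilinear_mult]
lemmas smooth_on_scaleR = smooth_on_bilinear[OF bounded_bilinear_scaleR]

lemma smooth_on_sum:
  "open S \<Longrightarrow> (\<And>i. i \<in> I \<Longrightarrow> smooth_on (f i) S) \<Longrightarrow> smooth_on (\<lambda>x. \<Sum>i\<in>I. f i x) S"
  unfolding smooth_on_def using C_k_on_sum by metis

lemma smooth_on_compose:
  "open S \<Longrightarrow> smooth_on f T \<Longrightarrow> smooth_on g S \<Longrightarrow> g ` S \<subseteq> T \<Longrightarrow> smooth_on (\<lambda>x. f (g x)) S"
  unfolding smooth_on_def using C_k_on_compose by blast

lemma smooth_on_powr: "smooth_on (\<lambda>x::real. x powr a) {0<..}"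
  unfolding smooth_on_def using C_k_on_powr by blast

lemma smooth_on_frechet:
  "smooth_on f S \<Longrightarrow> smooth_on (\<lambda>x. frechet_derivative f (at x) X) S"
  unfolding smooth_on_def by (metis C_k_on.simps(2))

lemma smooth_on_has_derivative:
  "smooth_on f S \<Longrightarrow> x \<in> S \<Longrightarrow> (f has_derivative frechet_derivative f (at x)) (at x)"
  unfolding smooth_on_def by (metis C_k_on.simps(2) frechet_derivative_works)

lemma smooth_on_continuous: "smooth_on f S \<Longrightarrow> continuous_on S f"
  unfolding smooth_on_def using C_k_on_continuous by blast

lemma smooth_on_minus: "open S \<Longrightarrow> smooth_on f S \<Longrightarrow> smooth_on (\<lambda>x. - f x) S"
  using smooth_on_scaleR[of S "\<lambda>_. -1" f] smooth_on_const by auto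

lemma smooth_on_diff:
  "open S \<Longrightarrow> smooth_on f S \<Longrightarrow> smooth_on g S \<Longrightarrow> smooth_on (\<lambda>x. f x - g x) S"
  using smooth_on_add[of S f "\<lambda>x. - g x"] smooth_on_minus by auto

lemma smooth_on_power:
  fixes f :: "'a::euclidean_space \<Rightarrow> real"
  shows "open S \<Longrightarrow> smooth_on f S \<Longrightarrow> smooth_on (\<lambda>x. f x ^ m) S"
  by (induction m) (auto intro: smooth_on_const smooth_on_mult)

lemma smooth_on_linear_compose:
  assumes "bounded_linear L" "open S" "smooth_on f S"
  shows "smooth_on (\<lambda>x. L (f x)) S"
  by (rule smooth_on_compose[OF assms(2) smooth_on_bounded_linear[OF assms(1) open_UNIV] assms(3)]) simp

lemma bounded_linear_axis: "bounded_linear (\<lambda>x::'b::euclidean_space. axis i x :: 'b^'n)"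
  by (rule linear_conv_bounded_linear[THEN iffD1])
     (auto intro!: linearI simp: vec_eq_iff axis_def)

lemma vec_eq_sum_axis: "x = (\<Sum>i\<in>UNIV. axis i (x $ i))"
  by (simp add: vec_eq_iff axis_def if_distrib cong: if_cong)

lemma smooth_on_vec:
  fixes f :: "'a::euclidean_space \<Rightarrow> 'b::euclidean_space^'n"
  assumes "open S" "\<And>i. smooth_on (\<lambda>x. f x $ i) S"
  shows "smooth_on f S"
proof -
  have "smooth_on (\<lambda>x. \<Sum>i\<in>UNIV. axis i (f x $ i)) S"
    by (rule smooth_on_sum[OF assms(1) smooth_on_linear_compose[OF bounded_linear_axis assms]])
  then show ?thesis using vec_eq_sum_axis[of "f _", symmetric] by simp
qed

lemma smooth_on_inverse:
  fixes f :: "'a::euclidean_space \<Rightarrow> real"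
  assumes "open S" "smooth_on f S" "\<And>x. x \<in> S \<Longrightarrow> f x \<noteq> 0"
  shows "smooth_on (\<lambda>x. inverse (f x)) S"
proof -
  \<comment> \<open>squaring makes the base positive also where \<open>f\<close> is negative\<close>
  have "smooth_on (\<lambda>x. f x * ((f x)\<^sup>2) powr (-1)) S"
    using assms
    by (intro smooth_on_mult smooth_on_compose[OF _ smooth_on_powr] smooth_on_power) auto
  then show ?thesis
  proof (rule smooth_on_eq[OF assms(1)])
    show "f x * ((f x)\<^sup>2) powr (-1) = inverse (f x)" if "x \<in> S" for x
      using assms(3)[OF that] by (simp add: powr_minus power2_eq_square)
  qed
qed

lemma smooth_on_prod:
  fixes f :: "'i \<Rightarrow> 'a::euclidean_space \<Rightarrow> real"
  shows "open S \<Longrightarrow> (\<And>i. i \<in> I \<Longrightarrow> smooth_on (f i) S) \<Longrightarrow> smooth_on (\<lambda>x. \<Prod>i\<in>I. f i x) S"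
  by (induction I rule: infinite_finite_induct) (auto intro: smooth_on_const smooth_on_mult)

lemma smooth_germI: "open U \<Longrightarrow> 0 \<in> U \<Longrightarrow> smooth_on f U \<Longrightarrow> smooth_germ f"
  unfolding smooth_germ_def by blast

lemma smooth_germ_const: "smooth_germ (\<lambda>x. c)"
  by (rule smooth_germI[of UNIV]) (auto intro: smooth_on_const)

lemma smooth_germ_bounded_linear: "bounded_linear f \<Longrightarrow> smooth_germ f"
  by (rule smooth_germI[of UNIV]) (auto intro: smooth_on_bounded_linear)

lemma smooth_germ_bilinear:
  assumes B: "bounded_bilinear B" and "smooth_germ f" "smooth_germ g"
  shows "smooth_germ (\<lambda>x. B (f x) (g x))"
proof -
  obtain U V where "open U" "0 \<in> U" "smooth_on f U" "open V" "0 \<in> V" "smooth_on g V"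
    using assms by (auto simp: smooth_germ_def)
  then show ?thesis
    by (intro smooth_germI[of "U \<inter> V"] smooth_on_bilinear[OF B]) (auto intro: smooth_on_subset)
qed

lemma smooth_germ_add:
  assumes "smooth_germ f" "smooth_germ g" shows "smooth_germ (\<lambda>x. f x + g x)"
proof -
  obtain U V where "open U" "0 \<in> U" "smooth_on f U" "open V" "0 \<in> V" "smooth_on g V"
    using assms by (auto simp: smooth_germ_def)
  then show ?thesis
    by (intro smooth_germI[of "U \<inter> V"] smooth_on_add) (auto intro: smooth_on_subset)
qed

lemmas smooth_germ_mult = smooth_germ_bilinear[OF bounded_bilinear_mult]
lemmas smooth_germ_scaleR = smooth_germ_bilinear[OF bounded_bilinear_scaleR]
lemmas smooth_germ_inner = smooth_germ_bilinear[OF bounded_bilinear_inner]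

lemma smooth_germ_minus: "smooth_germ f \<Longrightarrow> smooth_germ (\<lambda>x. - f x)"
  using smooth_germ_scaleR[of "\<lambda>_. -1" f] smooth_germ_const by auto

lemma smooth_germ_diff: "smooth_germ f \<Longrightarrow> smooth_germ g \<Longrightarrow> smooth_germ (\<lambda>x. f x - g x)"
  using smooth_germ_add[of f "\<lambda>x. - g x"] smooth_germ_minus by auto

lemma smooth_germ_power:
  fixes f :: "'a::euclidean_space \<Rightarrow> real"
  shows "smooth_germ f \<Longrightarrow> smooth_germ (\<lambda>x. f x ^ m)"
  by (induction m) (auto intro: smooth_germ_const smooth_germ_mult)

lemma smooth_germ_sum:
  "(\<And>i. i \<in> I \<Longrightarrow> smooth_germ (f i)) \<Longrightarrow> smooth_germ (\<lambda>x. \<Sum>i\<in>I. f i x)"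
  by (induction I rule: infinite_finite_induct) (auto intro: smooth_germ_const smooth_germ_add)

lemma smooth_germ_vec:
  fixes f :: "'a::euclidean_space \<Rightarrow> real^'n"
  assumes "\<And>i. smooth_germ (\<lambda>x. f x $ i)"
  shows "smooth_germ f"
proof -
  have "f = (\<lambda>x. \<Sum>i\<in>UNIV. (f x $ i) *\<^sub>R axis i 1)"
    by (rule ext) (simp add: vec_eq_iff axis_def if_distrib cong: if_cong)
  then show ?thesis
    by (rule ssubst)
       (use assms in \<open>intro smooth_germ_sum smooth_germ_scaleR smooth_germ_const\<close>)
qed

lemma smooth_germ_nth: "smooth_germ (\<lambda>q::real^'n. q $ i)"
  by (intro smooth_germ_bounded_linear bounded_linear_vec_nth)

lemma smooth_germ_vector2:
  assumes "smooth_germ a" "smooth_germ b"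
  shows "smooth_germ (\<lambda>x. vector [a x, b x] :: real^2)"
proof (rule smooth_germ_vec)
  show "smooth_germ (\<lambda>x. (vector [a x, b x] :: real^2) $ i)" for i
    using assms exhaust_2[of i] by auto
qed

lemma smooth_germ_compose_on:
  assumes "open V" "smooth_on f V" "g 0 \<in> V" "smooth_germ g"
  shows "smooth_germ (\<lambda>x. f (g x))"
proof -
  obtain U where U: "open U" "0 \<in> U" "smooth_on g U" using assms by (auto simp: smooth_germ_def)
  have "open (U \<inter> g -` V)"
    using smooth_on_continuous[OF U(3)] U(1) assms(1) by (simp add: continuous_open_preimage)
  moreover have "smooth_on (\<lambda>x. f (g x)) (U \<inter> g -` V)"
    by (rule smooth_on_compose[OF calculation assms(2) smooth_on_subset[OF U(3)]]) auto
  ultimately show ?thesis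
    using U assms by (intro smooth_germI[of "U \<inter> g -` V"]) auto
qed

lemma smooth_germ_compose:
  assumes "smooth_germ f" "g 0 = 0" "smooth_germ g"
  shows "smooth_germ (\<lambda>x. f (g x))"
  using assms smooth_germ_compose_on unfolding smooth_germ_def[of f] by metis

lemma smooth_germ_cong:
  assumes "smooth_germ f" "\<forall>\<^sub>F x in nhds 0. f x = g x"
  shows "smooth_germ g"
proof -
  obtain U V where "open U" "0 \<in> U" "smooth_on f U" "open V" "0 \<in> V" "\<And>x. x \<in> V \<Longrightarrow> f x = g x"
    using assms by (auto simp: smooth_germ_def eventually_nhds)
  moreover from this have "smooth_on g (U \<inter> V)"
    using smooth_on_eq[of "U \<inter> V" f g] smooth_on_subset[of f U "U \<inter> V"] by auto
  ultimately show ?thesis by (intro smooth_germI[of "U \<inter> V"]) auto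
qed

lemma smooth_germ_frechet:
  "smooth_germ f \<Longrightarrow> smooth_germ (\<lambda>x. frechet_derivative f (at x) X)"
  unfolding smooth_germ_def using smooth_on_frechet by blast

lemma smooth_germ_pd: "smooth_germ f \<Longrightarrow> smooth_germ (pd i f)"
  unfolding pd_def[abs_def] by (rule smooth_germ_frechet)

lemmas smooth_germ_intros =
  smooth_germ_const smooth_germ_nth smooth_germ_add smooth_germ_minus smooth_germ_diff smooth_germ_mult
  smooth_germ_scaleR smooth_germ_inner smooth_germ_power smooth_germ_sum smooth_germ_vector2
  smooth_germ_pd smooth_germ_frechet

lemma smooth_germ_has_derivative:
  "smooth_germ f \<Longrightarrow> \<forall>\<^sub>F x in nhds 0. (f has_derivative frechet_derivative f (at x)) (at x)"
  unfolding smooth_germ_def eventually_nhds using smooth_on_has_derivative by blast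

lemma smooth_germ_isCont: "smooth_germ f \<Longrightarrow> isCont f 0"
  using smooth_germ_has_derivative eventually_nhds_x_imp_x has_derivative_continuous by blast

lemma smooth_germ_tendsto: "smooth_germ f \<Longrightarrow> (f \<longlongrightarrow> f 0) (nhds 0)"
  using smooth_germ_isCont[of f] by (simp add: isCont_def tendsto_at_iff_tendsto_nhds)

lemma smooth_germ_inverse:
  fixes f :: "'a::euclidean_space \<Rightarrow> real"
  assumes "smooth_germ f" "f 0 \<noteq> 0"
  shows "smooth_germ (\<lambda>x. inverse (f x))"
proof -
  have "smooth_on (\<lambda>x::real. inverse x) (- {0})"
    by (intro smooth_on_inverse) (auto intro: smooth_on_bounded_linear bounded_linear_ident)
  from smooth_germ_compose_on[OF _ this _ assms(1)] show ?thesis using assms(2) by auto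
qed

lemma smooth_germ_powr:
  fixes f :: "'a::euclidean_space \<Rightarrow> real"
  assumes "smooth_germ f" "f 0 > 0"
  shows "smooth_germ (\<lambda>x. f x powr a)"
  using smooth_germ_compose_on[OF _ smooth_on_powr _ assms(1)] assms(2) by auto

section \<open>Division by a coordinate, symmetry of the Hessian, inverse functions\<close>

text \<open>Differentiation under the integral sign, iterated. The integrand is defined on a neighbourhood
  \<open>W\<close> of \<open>S \<times> {0..1}\<close> that is not assumed to be a product, so that line integrals inside a
  star-shaped domain are covered without shrinking the domain.\<close>

lemma C_k_on_integral:
  fixes f :: "'a::euclidean_space \<times> real \<Rightarrow> 'b::euclidean_space"
  assumes S: "open S" and W: "open W" "S \<times> {0..1} \<subseteq> W" and "C_k_on k f W"
  shows "C_k_on k (\<lambda>x. integral {0..1} (\<lambda>t. f (x, t))) S"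
  using assms(4)
proof (induction k arbitrary: f)
  case 0
  then have "continuous_on (S \<times> cbox 0 1) (\<lambda>(x, t). f (x, t))"
    using W by (auto intro: continuous_on_subset)
  from integral_continuous_on_param[OF this] show ?case by simp
next
  case (Suc k)
  let ?D = "\<lambda>x t. Blinfun (\<lambda>X. frechet_derivative f (at (x, t)) (X, 0))"
  have df: "(f has_derivative frechet_derivative f (at p)) (at p)" if "p \<in> W" for p
    using Suc.prems that by (auto simp: frechet_derivative_works[symmetric])
  have bl: "bounded_linear (\<lambda>X. frechet_derivative f (at p) (X, 0))" if "p \<in> W" for p
    using bounded_linear_compose[OF has_derivative_bounded_linear[OF df[OF that]]
        bounded_linear_Pair[OF bounded_linear_ident bounded_linear_zero]] .
  have app: "blinfun_apply (?D x t) X = frechet_derivative f (at (x, t)) (X, 0)" if "(x, t) \<in> W" for x t X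
    using bl[OF that] by (simp add: bounded_linear_Blinfun_apply)
  have cont: "continuous_on W (\<lambda>p. frechet_derivative f (at p) Y)" for Y
    using Suc.prems unfolding C_k_on.simps(2) by (intro C_k_on_continuous[of k]) blast
  show ?case
  proof (rule C_k_on_SucI[OF S])
    fix x assume x: "x \<in> S"
    obtain r where r: "r > 0" "ball x r \<subseteq> S" using S x openE by blast
    have inW: "(y, t) \<in> W" if "y \<in> ball x r" "t \<in> {0..1}" for y t
      using that r(2) W(2) by (meson SigmaI subsetD)
    have contD: "continuous_on (ball x r \<times> cbox 0 1) (\<lambda>(y, t). ?D y t)"
    proof (rule continuous_on_blinfun_componentwise)
      fix i :: 'a
      have "continuous_on (ball x r \<times> cbox 0 1) (\<lambda>p. frechet_derivative f (at p) (i, 0))"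
        by (rule continuous_on_subset[OF cont]) (use inW in auto)
      then show "continuous_on (ball x r \<times> cbox 0 1) (\<lambda>p. blinfun_apply (case p of (y, t) \<Rightarrow> ?D y t) i)"
        by (rule continuous_on_eq) (use inW app in auto)
    qed
    have "((\<lambda>x. integral (cbox 0 1) (\<lambda>t. f (x, t))) has_derivative integral (cbox 0 1) (?D x))
            (at x within ball x r)"
    proof (rule leibniz_rule[OF _ _ contD])
      fix y t assume yt: "y \<in> ball x r" "t \<in> cbox (0::real) 1"
      then have W': "(y, t) \<in> W" using inW by auto
      have "((\<lambda>y. f (y, t)) has_derivative (\<lambda>X. frechet_derivative f (at (y, t)) (X, 0))) (at y)"
        by (rule has_derivative_compose[of "\<lambda>y. (y, t)" "\<lambda>X. (X, 0)" y UNIV f, OF _ df[OF W']])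
           (auto intro!: derivative_eq_intros)
      then show "((\<lambda>y. f (y, t)) has_derivative blinfun_apply (?D y t)) (at y within ball x r)"
        using app[OF W'] has_derivative_at_withinI by (metis (no_types, lifting) ext)
    next
      fix y assume y: "y \<in> ball x r"
      have "continuous_on {0..1} (\<lambda>t. f (y, t))"
        by (rule continuous_on_compose2[OF C_k_on_continuous[OF Suc.prems]])
           (auto intro!: continuous_intros inW[OF y])
      then show "(\<lambda>t. f (y, t)) integrable_on cbox 0 1"
        using integrable_continuous_interval by auto
    qed (use r in auto)
    then have *: "((\<lambda>x. integral {0..1} (\<lambda>t. f (x, t))) has_derivative integral {0..1} (?D x)) (at x)"
      using at_within_open[of x "ball x r"] r(1) by (simp only: cbox_interval open_ball centre_in_ball)
    have "continuous_on {0..1} (?D x)"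
    proof -
      have "continuous_on {0..1} (\<lambda>t. (x, t))" by (intro continuous_intros)
      from continuous_on_compose2[OF contD this] show ?thesis using r(1) by fastforce
    qed
    then have int: "?D x integrable_on {0..1}" by (rule integrable_continuous_interval)
    have "blinfun_apply (integral {0..1} (?D x)) X
        = integral {0..1} (\<lambda>t. frechet_derivative f (at (x, t)) (X, 0))" for X
    proof -
      have "blinfun_apply (integral {0..1} (?D x)) X = integral {0..1} (\<lambda>t. blinfun_apply (?D x t) X)"
        using integral_linear[OF int bounded_bilinear.bounded_linear_left[OF bounded_bilinear_blinfun_apply], of X] by (simp add: o_def)
      also have "\<dots> = integral {0..1} (\<lambda>t. frechet_derivative f (at (x, t)) (X, 0))"
        by (rule integral_cong) (use app inW r in auto)
      finally show ?thesis .
    qed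
    then show "((\<lambda>x. integral {0..1} (\<lambda>t. f (x, t))) has_derivative
        (\<lambda>X. integral {0..1} (\<lambda>t. frechet_derivative f (at (x, t)) (X, 0)))) (at x)"
      by (intro has_derivative_eq_rhs[OF *]) (rule ext)
  qed (use Suc in auto)
qed

lemma smooth_on_integral:
  fixes f :: "'a::euclidean_space \<times> real \<Rightarrow> 'b::euclidean_space"
  assumes "open S" "open W" "S \<times> {0..1} \<subseteq> W" "smooth_on f W"
  shows "smooth_on (\<lambda>x. integral {0..1} (\<lambda>t. f (x, t))) S"
  using assms C_k_on_integral unfolding smooth_on_def by blast

lemma vector_2_eta: "vector [q $ 1, q $ 2] = (q :: 'a::zero^2)"
  by (simp add: vec_eq_iff forall_2)

lemma vector_zero2 [simp]: "vector [0, 0] = (0 :: real^2)"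
  by (simp add: vec_eq_iff forall_2)

text \<open>The quotient is \<open>G(u, v) = (\<integral> F\<^sub>v(u, t v) dt)\<close> over \<open>0 \<le> t \<le> 1\<close>, defined on all of \<open>U\<close>. Keeping the
  domain matters for \<open>C_k_on_reflection_extension\<close>, where the division is repeated once for every
  order of differentiability.\<close>

lemma hadamard_division:
  fixes F :: "real^2 \<Rightarrow> 'b::euclidean_space"
  assumes U: "open U" and F: "smooth_on F U"
    and star: "\<And>q t. q \<in> U \<Longrightarrow> t \<in> {0..1} \<Longrightarrow> vector [q $ 1, t * q $ 2] \<in> U"
    and zero: "\<And>q. q \<in> U \<Longrightarrow> q $ 2 = 0 \<Longrightarrow> F q = 0"
  obtains G where "smooth_on G U" "\<And>q. q \<in> U \<Longrightarrow> F q = (q $ 2) *\<^sub>R G q"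
proof
  let ?m = "\<lambda>p::(real^2) \<times> real. vector [fst p $ 1, snd p * fst p $ 2] :: real^2"
  let ?W = "?m -` U"
  let ?G = "\<lambda>q. integral {0..1} (\<lambda>t. (\<lambda>p. pd 2 F (?m p)) (q, t))"
  have m: "smooth_on ?m UNIV"
  proof (rule smooth_on_vec)
    have f: "smooth_on (\<lambda>p::(real^2) \<times> real. fst p $ i) UNIV" for i
      by (intro smooth_on_bounded_linear bounded_linear_compose[OF bounded_linear_vec_nth] bounded_linear_fst) auto
    have s: "smooth_on (\<lambda>p::(real^2) \<times> real. snd p) UNIV"
      by (intro smooth_on_bounded_linear bounded_linear_snd) auto
    show "smooth_on (\<lambda>p. ?m p $ i) UNIV" for i
      using exhaust_2[of i] f smooth_on_mult[OF _ s f] by auto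
  qed auto
  have W: "open ?W" using smooth_on_continuous[OF m] U by (simp add: open_vimage)
  have D: "smooth_on (pd 2 F) U" unfolding pd_def[abs_def] by (rule smooth_on_frechet[OF F])
  have "smooth_on (\<lambda>p. pd 2 F (?m p)) ?W"
    by (rule smooth_on_compose[OF W D smooth_on_subset[OF m]]) auto
  moreover have "U \<times> {0..1} \<subseteq> ?W" by (auto simp: star)
  ultimately show "smooth_on ?G U" using smooth_on_integral[OF U W] by blast
  fix q assume q: "q \<in> U"
  have der: "((\<lambda>t. F (?m (q, t))) has_vector_derivative (q $ 2) *\<^sub>R pd 2 F (?m (q, t))) (at t within {0..1})"
    if t: "t \<in> {0..1}" for t
  proof -
    have "?m (q, t) \<in> U" using star[OF q t] by simp
    note dF = smooth_on_has_derivative[OF F this]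
    interpret L: bounded_linear "frechet_derivative F (at (?m (q, t)))"
      using dF by (rule has_derivative_bounded_linear)
    have eq: "?m (q, t) = axis 1 (q $ 1) + t *\<^sub>R axis 2 (q $ 2)" for t
      by (simp add: vec_eq_iff forall_2 axis_def)
    have "((\<lambda>t. ?m (q, t)) has_derivative (\<lambda>s. s *\<^sub>R axis 2 (q $ 2))) (at t within {0..1})"
      unfolding eq by (auto intro!: derivative_eq_intros)
    from has_derivative_compose[OF this dF]
    have "((\<lambda>t. F (?m (q, t))) has_derivative
        (\<lambda>s. frechet_derivative F (at (?m (q, t))) (s *\<^sub>R axis 2 (q $ 2)))) (at t within {0..1})" .
    moreover have "axis 2 (q $ 2) = (q $ 2) *\<^sub>R (axis 2 1 :: real^2)"
      by (simp add: vec_eq_iff axis_def)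
    ultimately show ?thesis
      by (simp add: has_vector_derivative_def pd_def L.scaleR[simplified])
  qed
  have H: "((\<lambda>t. (q $ 2) *\<^sub>R pd 2 F (?m (q, t))) has_integral F (?m (q, 1)) - F (?m (q, 0))) {0..1}"
    by (rule fundamental_theorem_of_calculus[OF _ der]) auto
  moreover have "F (?m (q, 0)) = 0" using zero[of "?m (q, 0)"] star[OF q, of 0] by auto
  moreover have "?m (q, 1) = q" by (simp add: vector_2_eta)
  ultimately have "integral {0..1} (\<lambda>t. (q $ 2) *\<^sub>R pd 2 F (?m (q, t))) = F q"
    using integral_unique[OF H] by simp
  then show "F q = (q $ 2) *\<^sub>R ?G q" by simp
qed

text \<open>By the fundamental theorem of calculus \<open>f(x + s X + t Y) - f(x + s X)\<close> is the integral of the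
  \<open>Y\<close>-derivative over \<open>[0, t]\<close>. Differentiating under the integral with respect to \<open>s\<close> and then with
  respect to \<open>t\<close> exchanges the two derivatives.\<close>

lemma symmetric_second_derivative:
  fixes f :: "'a::euclidean_space \<Rightarrow> 'b::euclidean_space"
  assumes S: "open S" "x \<in> S" and f: "smooth_on f S"
  shows "frechet_derivative (\<lambda>p. frechet_derivative f (at p) X) (at x) Y
       = frechet_derivative (\<lambda>p. frechet_derivative f (at p) Y) (at x) X"
proof -
  let ?A = "\<lambda>p. frechet_derivative f (at p) X" and ?B = "\<lambda>p. frechet_derivative f (at p) Y"
  let ?C = "\<lambda>p. frechet_derivative ?B (at p) X"
  have A: "smooth_on ?A S" and B: "smooth_on ?B S" using smooth_on_frechet[OF f] by auto
  have C: "smooth_on ?C S" using smooth_on_frechet[OF B] .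
  let ?l = "\<lambda>z::real \<times> real. x + fst z *\<^sub>R X + snd z *\<^sub>R Y"
  have "open (?l -` S)" by (rule open_vimage[OF S(1)]) (intro continuous_intros)
  moreover have "(0, 0) \<in> ?l -` S" using S by simp
  ultimately obtain T1 T2 where T: "open T1" "open T2" "(0,0) \<in> T1 \<times> T2" "T1 \<times> T2 \<subseteq> ?l -` S"
    by (rule open_prod_elim)
  then obtain e1 e2 where e12: "e1 > 0" "cball 0 e1 \<subseteq> T1" "e2 > 0" "cball 0 e2 \<subseteq> T2"
    by (metis mem_Sigma_iff open_contains_cball)
  define e where "e = min e1 e2"
  have e: "e > 0" "\<And>s t. \<bar>s\<bar> \<le> e \<Longrightarrow> \<bar>t\<bar> \<le> e \<Longrightarrow> x + s *\<^sub>R X + t *\<^sub>R Y \<in> S"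
    using e12 T(4) unfolding e_def by (auto simp: subset_iff)
  have chain: "((\<lambda>s. h (y + s *\<^sub>R Z)) has_vector_derivative frechet_derivative h (at (y + s *\<^sub>R Z)) Z) (at s within V)"
    if h: "smooth_on h S" "y + s *\<^sub>R Z \<in> S" for h :: "'a \<Rightarrow> 'b" and y Z s V
  proof -
    note dh = smooth_on_has_derivative[OF h]
    interpret L: bounded_linear "frechet_derivative h (at (y + s *\<^sub>R Z))"
      using dh by (rule has_derivative_bounded_linear)
    have "((\<lambda>s. y + s *\<^sub>R Z) has_derivative (\<lambda>r. r *\<^sub>R Z)) (at s within V)"
      by (auto intro!: derivative_eq_intros)
    from has_derivative_compose[OF this dh] show ?thesis
      by (simp add: has_vector_derivative_def L.scaleR)
  qed
  have comm: "x + s *\<^sub>R X + t *\<^sub>R Y = (x + t *\<^sub>R Y) + s *\<^sub>R X" for s t by simp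
  have key: "?A (x + t *\<^sub>R Y) = ?A x + integral {0..t} (\<lambda>\<tau>. ?C (x + \<tau> *\<^sub>R Y))" if t: "t \<in> {0..e}" for t
  proof -
    let ?I = "\<lambda>s. integral (cbox 0 t) (\<lambda>\<tau>. ?B (x + s *\<^sub>R X + \<tau> *\<^sub>R Y))"
    have I: "?I s = f (x + s *\<^sub>R X + t *\<^sub>R Y) - f (x + s *\<^sub>R X)" if "s \<in> {-e<..<e}" for s
    proof -
      have "((\<lambda>\<tau>. ?B (x + s *\<^sub>R X + \<tau> *\<^sub>R Y)) has_integral
          f (x + s *\<^sub>R X + t *\<^sub>R Y) - f (x + s *\<^sub>R X + 0 *\<^sub>R Y)) {0..t}"
        by (rule fundamental_theorem_of_calculus) (use t that e in \<open>auto intro!: chain[OF f]\<close>)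
      then show ?thesis by (simp add: integral_unique)
    qed
    have "(?I has_vector_derivative integral (cbox 0 t) (\<lambda>\<tau>. ?C (x + 0 *\<^sub>R X + \<tau> *\<^sub>R Y))) (at 0 within {-e<..<e})"
    proof (rule leibniz_rule_vector_derivative)
      fix s \<tau> assume st: "s \<in> {-e<..<e}" "\<tau> \<in> cbox 0 t"
      then have "x + \<tau> *\<^sub>R Y + s *\<^sub>R X \<in> S" using t e(2)[of s \<tau>] by (auto simp: comm abs_le_iff)
      from chain[OF B this] show "((\<lambda>s. ?B (x + s *\<^sub>R X + \<tau> *\<^sub>R Y)) has_vector_derivative
          ?C (x + s *\<^sub>R X + \<tau> *\<^sub>R Y)) (at s within {-e<..<e})"
        by (simp add: comm)
    next
      fix s assume s: "s \<in> {-e<..<e}"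
      have "continuous_on (cbox 0 t) (\<lambda>\<tau>. ?B (x + s *\<^sub>R X + \<tau> *\<^sub>R Y))"
        by (rule continuous_on_compose2[OF smooth_on_continuous[OF B]])
           (use s t e in \<open>auto intro!: continuous_intros\<close>)
      then show "(\<lambda>\<tau>. ?B (x + s *\<^sub>R X + \<tau> *\<^sub>R Y)) integrable_on cbox 0 t"
        by (rule integrable_continuous)
    next
      show "continuous_on ({-e<..<e} \<times> cbox 0 t) (\<lambda>(s, \<tau>). ?C (x + s *\<^sub>R X + \<tau> *\<^sub>R Y))"
        unfolding split_beta
        by (rule continuous_on_compose2[OF smooth_on_continuous[OF C]])
           (use t e in \<open>auto intro!: continuous_intros\<close>)
    qed (use e in auto)
    then have 1: "(?I has_vector_derivative integral {0..t} (\<lambda>\<tau>. ?C (x + \<tau> *\<^sub>R Y))) (at 0)"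
      using e(1) by (simp add: at_within_open[of 0 "{-e<..<e}"])
    have d1: "((\<lambda>s. f (x + t *\<^sub>R Y + s *\<^sub>R X)) has_vector_derivative ?A (x + t *\<^sub>R Y + 0 *\<^sub>R X)) (at 0)"
      by (rule chain[OF f]) (use t e(2)[of 0 t] e(1) in auto)
    have d2: "((\<lambda>s. f (x + s *\<^sub>R X)) has_vector_derivative ?A (x + 0 *\<^sub>R X)) (at 0)"
      by (rule chain[OF f]) (use S in auto)
    have "((\<lambda>s. f (x + s *\<^sub>R X + t *\<^sub>R Y) - f (x + s *\<^sub>R X)) has_vector_derivative
        ?A (x + t *\<^sub>R Y) - ?A x) (at 0)"
      using has_vector_derivative_diff[OF d1 d2] by (simp add: comm)
    then have 2: "(?I has_vector_derivative ?A (x + t *\<^sub>R Y) - ?A x) (at 0)"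
      by (rule has_vector_derivative_transform_within_open[of _ _ _ "{-e<..<e}"])
         (use I e in auto)
    from vector_derivative_unique_at[OF 1 2] show ?thesis by simp
  qed
  have contC: "continuous_on {0..e} (\<lambda>\<tau>. ?C (x + \<tau> *\<^sub>R Y))"
    by (rule continuous_on_compose2[OF smooth_on_continuous[OF C]])
       (use e e(2)[of 0] in \<open>auto intro!: continuous_intros\<close>)
  have "((\<lambda>t. ?A x + integral {0..t} (\<lambda>\<tau>. ?C (x + \<tau> *\<^sub>R Y))) has_vector_derivative
      0 + ?C (x + 0 *\<^sub>R Y)) (at 0 within {0..e})"
    by (intro has_vector_derivative_add has_vector_derivative_const
        integral_has_vector_derivative[OF contC]) (use e in auto)
  then have "((\<lambda>t. ?A (x + t *\<^sub>R Y)) has_vector_derivative ?C x) (at 0 within {0..e})"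
    using has_vector_derivative_transform[of 0 "{0..e}" "\<lambda>t. ?A (x + t *\<^sub>R Y)"] key e(1) by simp
  moreover have "((\<lambda>t. ?A (x + t *\<^sub>R Y)) has_vector_derivative frechet_derivative ?A (at x) Y) (at 0 within {0..e})"
    using chain[OF A, of x 0 Y] S by simp
  ultimately show ?thesis
    using vector_derivative_unique_within_closed_interval[of 0 e 0] e(1) by fastforce
qed

lemma smooth_on_det: "smooth_on (\<lambda>M::real^'n^'n. det M) UNIV"
proof -
  have "smooth_on (\<lambda>M::real^'n^'n. M $ i $ j) UNIV" for i j
    by (intro smooth_on_bounded_linear bounded_linear_compose[OF bounded_linear_vec_nth bounded_linear_vec_nth]) auto
  then show ?thesis unfolding det_def
    by (intro smooth_on_sum smooth_on_mult smooth_on_prod smooth_on_const) auto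
qed

text \<open>The solution of a linear system depends smoothly on the matrix, being a quotient of determinants
  by Cramer's rule.\<close>

lemma smooth_on_cramer:
  fixes X :: "real^'n"
  shows "smooth_on (\<lambda>M::real^'n^'n. (\<chi> k. det (\<chi> i j. if j = k then X $ i else M $ i $ j) / det M) :: real^'n)
     {M. det M \<noteq> 0}"
proof -
  have op: "open {M::real^'n^'n. det M \<noteq> 0}"
    using smooth_on_continuous[OF smooth_on_det] by (intro open_Collect_neq) auto
  have ent: "smooth_on (\<lambda>M::real^'n^'n. M $ i $ j) UNIV" for i j
    by (intro smooth_on_bounded_linear bounded_linear_compose[OF bounded_linear_vec_nth bounded_linear_vec_nth]) auto
  have "smooth_on (\<lambda>M::real^'n^'n. (\<chi> i j. if j = k then X $ i else M $ i $ j) :: real^'n^'n) UNIV" for k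
  proof (rule smooth_on_vec)
    show "smooth_on (\<lambda>M::real^'n^'n. ((\<chi> i j. if j = k then X $ i else M $ i $ j) :: real^'n^'n) $ i) UNIV" for i
    proof (rule smooth_on_vec)
      show "smooth_on (\<lambda>M::real^'n^'n. ((\<chi> i j. if j = k then X $ i else M $ i $ j) :: real^'n^'n) $ i $ j) UNIV" for j
        using ent smooth_on_const by (cases "j = k") auto
    qed auto
  qed auto
  from smooth_on_compose[OF _ smooth_on_det this]
  have num: "smooth_on (\<lambda>M::real^'n^'n. det ((\<chi> i j. if j = k then X $ i else M $ i $ j) :: real^'n^'n)) UNIV" for k
    by auto
  show ?thesis
  proof (rule smooth_on_vec[OF op])
    fix k
    have "smooth_on (\<lambda>M::real^'n^'n. det ((\<chi> i j. if j = k then X $ i else M $ i $ j) :: real^'n^'n)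
        * inverse (det M)) {M. det M \<noteq> 0}"
      by (intro smooth_on_mult smooth_on_inverse op smooth_on_subset[OF num] smooth_on_subset[OF smooth_on_det]) auto
    then show "smooth_on (\<lambda>M::real^'n^'n. ((\<chi> k. det (\<chi> i j. if j = k then X $ i else M $ i $ j) / det M) :: real^'n) $ k)
       {M. det M \<noteq> 0}"
      by (simp add: divide_inverse)
  qed
qed

text \<open>The inverse \<open>g\<close> given by the inverse function theorem has derivative \<open>(DF \<circ> g)\<^sup>-\<^sup>1\<close>. So if \<open>g\<close>
  is of class \<open>C\<^sup>k\<close>, then its derivative is, and \<open>g\<close> is of class \<open>C\<^sup>k\<^sup>+\<^sup>1\<close>.\<close>

lemma diffeo_germ_if_invertible_derivative:
  fixes F :: "real^'n \<Rightarrow> real^'n"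
  assumes F: "smooth_germ F" "F 0 = 0" and inj: "\<And>X. frechet_derivative F (at 0) X = 0 \<Longrightarrow> X = 0"
  shows "diffeo_germ F"
proof -
  obtain U where U: "open U" "0 \<in> U" "smooth_on F U" using F by (auto simp: smooth_germ_def)
  have dF: "(F has_derivative frechet_derivative F (at x)) (at x)" if "x \<in> U" for x
    using smooth_on_has_derivative[OF U(3) that] .
  note bl = has_derivative_bounded_linear[OF dF]
  define D where "D x = Blinfun (frechet_derivative F (at x))" for x
  have D: "blinfun_apply (D x) = frechet_derivative F (at x)" if "x \<in> U" for x
    unfolding D_def using bl[OF that] by (simp add: bounded_linear_Blinfun_apply)
  have contD: "continuous_on U D"
  proof (rule continuous_on_blinfun_componentwise)
    fix i :: "real^'n"
    have "continuous_on U (\<lambda>x. frechet_derivative F (at x) i)"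
      using smooth_on_continuous[OF smooth_on_frechet[OF U(3)]] .
    then show "continuous_on U (\<lambda>x. blinfun_apply (D x) i)"
      by (rule continuous_on_eq) (simp add: D)
  qed
  have lin0: "linear (frechet_derivative F (at 0))" using bl[OF U(2)] bounded_linear.linear by blast
  have "inj (frechet_derivative F (at 0))"
    using inj linear_injective_0[OF lin0] by blast
  then obtain G where G: "linear G" "G \<circ> frechet_derivative F (at 0) = id"
    using linear_injective_left_inverse[OF lin0] by blast
  define J where "J = Blinfun G"
  have "blinfun_apply J = G"
    unfolding J_def using G(1) by (simp add: linear_conv_bounded_linear bounded_linear_Blinfun_apply)
  then have "J o\<^sub>L D 0 = id_blinfun"
    using G(2) D[OF U(2)] by (intro blinfun_eqI) (simp add: fun_eq_iff)
  then obtain U' V g g' where g: "open U'" "U' \<subseteq> U" "0 \<in> U'" "open V" "F 0 \<in> V" "homeomorphism U' V F g"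
    "\<And>y. y \<in> V \<Longrightarrow> (g has_derivative g' y) (at y)"
    "\<And>y. y \<in> V \<Longrightarrow> g' y = inv (blinfun_apply (D (g y)))"
    "\<And>y. y \<in> V \<Longrightarrow> bij (blinfun_apply (D (g y)))"
    using inverse_function_theorem[OF U(1) _ contD U(2)] dF D by (metis (no_types, lifting))
  have gV: "g y \<in> U'" if "y \<in> V" for y using g(6) that by (auto simp: homeomorphism_def)
  define M where "M x = matrix (frechet_derivative F (at x))" for x
  let ?sol = "\<lambda>X M. (\<chi> k. det (\<chi> i j. if j = k then X $ i else M $ i $ j) / det M) :: real^'n"
  have M: "smooth_on M U"
  proof (rule smooth_on_vec[OF U(1)])
    show "smooth_on (\<lambda>x. M x $ i) U" for i
    proof (rule smooth_on_vec[OF U(1)])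
      show "smooth_on (\<lambda>x. M x $ i $ j) U" for j
        unfolding M_def matrix_def
        using smooth_on_linear_compose[OF bounded_linear_vec_nth U(1) smooth_on_frechet[OF U(3)]] by auto
    qed
  qed
  have mult: "M (g y) *v X = frechet_derivative F (at (g y)) X" if "y \<in> V" for y X
  proof -
    have "linear (frechet_derivative F (at (g y)))"
      using bl gV[OF that] g(2) by (intro bounded_linear.linear) auto
    from fun_cong[OF matrix_vector_mul(2)[OF this], of X] show ?thesis by (simp add: M_def)
  qed
  have det: "det (M (g y)) \<noteq> 0" if y: "y \<in> V" for y
  proof -
    have "inj ((*v) (M (g y)))"
      using g(9)[OF y] mult[OF y] D gV[OF y] g(2) by (auto simp: inj_def bij_def)
    then show ?thesis
      using det_nz_iff_inj[of "(*v) (M (g y))"] by (simp add: matrix_of_matrix_vector_mul)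
  qed
  have g': "g' y X = ?sol X (M (g y))" if y: "y \<in> V" for y X
  proof -
    have "bij (frechet_derivative F (at (g y)))" using g(9)[OF y] D gV[OF y] g(2) by auto
    then have "frechet_derivative F (at (g y)) (g' y X) = X"
      using g(8)[OF y] D gV[OF y] g(2) by (metis bij_is_surj subsetD surj_f_inv_f)
    then have "M (g y) *v g' y X = X" using mult[OF y] by simp
    then show ?thesis using cramer[OF det[OF y]] by blast
  qed
  have "C_k_on k g V" for k
  proof (induction k)
    case 0
    then show ?case using g(6) by (simp add: homeomorphism_def)
  next
    case (Suc k)
    show ?case
    proof (rule C_k_on_SucI[OF g(4) g(7)])
      fix X
      have 1: "C_k_on k (\<lambda>y. M (g y)) V"
        by (rule C_k_on_compose[OF g(4) _ Suc, of _ U]) (use M gV g(2) in \<open>auto simp: smooth_on_def\<close>)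
      have "C_k_on k (\<lambda>y. ?sol X (M (g y))) V"
        by (rule C_k_on_compose[OF g(4) _ 1, of _ "{M. det M \<noteq> 0}"])
           (use smooth_on_cramer[of X] det in \<open>auto simp: smooth_on_def\<close>)
      then show "C_k_on k (\<lambda>y. g' y X) V"
        by (subst C_k_on_cong[OF g(4) g']) auto
    qed
  qed
  then have "smooth_germ g" using g(4,5) F(2) by (auto simp: smooth_germ_def smooth_on_def)
  moreover have "g 0 = 0" using g(3,6) F(2) by (auto simp: homeomorphism_def)
  moreover have "\<forall>\<^sub>F x in nhds 0. g (F x) = x"
    using g(1,3,6) unfolding eventually_nhds homeomorphism_def by blast
  moreover have "\<forall>\<^sub>F x in nhds 0. F (g x) = x"
    using g(4,5,6) F(2) unfolding eventually_nhds homeomorphism_def by metis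
  ultimately show ?thesis using F unfolding diffeo_germ_def by blast
qed

section \<open>Even smooth functions are smooth functions of the square\<close>

text \<open>The extension \<open>A(y) = (\<Sum>k. c k * A(- 4\<^sup>k y))\<close> of a function on \<open>y \<ge> 0\<close> to \<open>y < 0\<close> has
  \<open>(\<Sum>k. c k * (- 4\<^sup>k)\<^sup>j)\<close> times the right derivative as its \<open>j\<close>-th left derivative at \<open>0\<close>. The
  moment condition therefore says that derivatives of all orders match.\<close>

definition reflecting :: "(nat \<Rightarrow> real) \<Rightarrow> bool" where
  "reflecting c \<longleftrightarrow> (\<forall>j. summable (\<lambda>k. \<bar>c k\<bar> * (4 ^ k) ^ j)) \<and> (\<forall>j. (\<lambda>k. c k * (- (4 ^ k)) ^ j) sums 1)"

text \<open>Differentiating the reflected series multiplies the \<open>k\<close>-th coefficient by \<open>- 4\<^sup>k\<close>, which shifts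
  the moments by one.\<close>

lemma reflecting_shift:
  assumes c: "reflecting c" shows "reflecting (\<lambda>k. c k * - (4 ^ k))"
  unfolding reflecting_def
proof (intro conjI allI)
  fix j
  have "summable (\<lambda>k. \<bar>c k\<bar> * (4 ^ k) ^ Suc j)" using c by (auto simp only: reflecting_def)
  then show "summable (\<lambda>k. \<bar>c k * - (4 ^ k)\<bar> * (4 ^ k) ^ j)"
    by (simp add: abs_mult mult.assoc)
  have "(\<lambda>k. c k * (- (4 ^ k)) ^ Suc j) sums 1" using c by (auto simp only: reflecting_def)
  then show "(\<lambda>k. c k * - (4 ^ k) * (- (4 ^ k)) ^ j) sums 1"
    by (simp only: power_Suc mult.assoc)
qed

text \<open>The coefficients of Euler's product \<open>\<Theta>(X) = (\<Prod>i. 1 - X / 4\<^sup>i)\<close>, read off from its functional equation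
  \<open>\<Theta>(4 X) = (1 - 4 X) \<Theta>(X)\<close>.\<close>

fun theta_coeff :: "nat \<Rightarrow> real" where
  "theta_coeff 0 = 1"
| "theta_coeff (Suc k) = - 4 * theta_coeff k / (4 ^ Suc k - 1)"

lemma theta_summable: "summable (\<lambda>k. \<bar>theta_coeff k\<bar> * X ^ k)" if X: "X \<ge> 0"
proof -
  obtain N where N: "8 * X + 1 < 4 ^ N" using real_arch_pow[of 4 "8 * X + 1"] by auto
  show ?thesis
  proof (rule summable_ratio_test[of "1/2" N])
    fix n assume n: "N \<le> n"
    have "(4::real) ^ N \<le> 4 ^ Suc n" using n by (intro power_increasing) auto
    then have *: "8 * X < 4 ^ Suc n - 1" using N by linarith
    then have le: "4 * X / (4 ^ Suc n - 1) \<le> 1 / 2" using X by (simp add: field_simps)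
    have "norm (\<bar>theta_coeff (Suc n)\<bar> * X ^ Suc n)
        = (4 * X / (4 ^ Suc n - 1)) * norm (\<bar>theta_coeff n\<bar> * X ^ n)"
      using * X by (simp add: abs_mult field_simps)
    also have "\<dots> \<le> 1 / 2 * norm (\<bar>theta_coeff n\<bar> * X ^ n)"
      by (rule mult_right_mono[OF le]) simp
    finally show "norm (\<bar>theta_coeff (Suc n)\<bar> * X ^ Suc n) \<le> 1 / 2 * norm (\<bar>theta_coeff n\<bar> * X ^ n)" .
  qed simp
qed

text \<open>The functional equation gives \<open>\<Theta>(1) = 0\<close> at \<open>X = 1/4\<close> and then passes from \<open>4\<^sup>j\<close> to \<open>4\<^sup>j\<^sup>+\<^sup>1\<close>.\<close>

lemma theta_vanishes_at_powers_of_4: "(\<Sum>k. theta_coeff k * (4 ^ j) ^ k) = 0"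
proof -
  have sm: "summable (\<lambda>k. theta_coeff k * X ^ k)" if "X \<ge> 0" for X
    by (rule summable_rabs_cancel) (use theta_summable[OF that] that in \<open>simp add: abs_mult\<close>)
  have step: "(\<Sum>k. theta_coeff k * (4 * X) ^ k) = (1 - 4 * X) * (\<Sum>k. theta_coeff k * X ^ k)" if X: "X \<ge> 0" for X
  proof -
    have s1: "(\<lambda>k. theta_coeff k * X ^ k) sums (\<Sum>k. theta_coeff k * X ^ k)"
      using sm[OF X] by (rule summable_sums)
    have "(\<lambda>k. theta_coeff (Suc k) * X ^ Suc k) sums ((\<Sum>k. theta_coeff k * X ^ k) - theta_coeff 0)"
      using sums_Suc_imp[of "\<lambda>k. theta_coeff k * X ^ k"] s1 sums_Suc_iff[of "\<lambda>k. theta_coeff k * X ^ k"] by simp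
    from sums_add[OF this sums_mult[OF s1, of "- 4 * X"]]
    have "(\<lambda>k. theta_coeff (Suc k) * X ^ Suc k + - 4 * X * (theta_coeff k * X ^ k)) sums
        ((1 - 4 * X) * (\<Sum>k. theta_coeff k * X ^ k) - 1)"
      by (simp add: algebra_simps)
    moreover have "theta_coeff (Suc k) * X ^ Suc k + - 4 * X * (theta_coeff k * X ^ k)
        = theta_coeff (Suc k) * (4 * X) ^ Suc k" for k
    proof -
      have "(4::real) ^ Suc k - 1 \<noteq> 0" using one_less_power[of "4::real" "Suc k"] by simp
      then have "theta_coeff (Suc k) * (4 ^ Suc k - 1) = - 4 * theta_coeff k" by simp
      then have "theta_coeff (Suc k) * 4 ^ Suc k * X ^ Suc k
          = theta_coeff (Suc k) * X ^ Suc k - 4 * theta_coeff k * X ^ Suc k"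
        by (metis (no_types, opaque_lifting) add.commute add_diff_cancel_left' diff_minus_eq_add
            left_diff_distrib minus_mult_left mult.right_neutral right_diff_distrib)
      then show ?thesis by (simp add: power_mult_distrib algebra_simps)
    qed
    ultimately have "(\<lambda>k. theta_coeff (Suc k) * (4 * X) ^ Suc k) sums
        ((1 - 4 * X) * (\<Sum>k. theta_coeff k * X ^ k) - 1)" by simp
    then have "(\<lambda>k. theta_coeff k * (4 * X) ^ k) sums ((1 - 4 * X) * (\<Sum>k. theta_coeff k * X ^ k))"
      by (subst (asm) sums_Suc_iff) simp
    then show ?thesis by (simp add: sums_iff)
  qed
  show ?thesis
  proof (induction j)
    case 0
    then show ?case using step[of "1/4"] by simp
  next
    case (Suc j)
    then show ?case using step[of "4 ^ j"] by simp
  qed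
qed

text \<open>The power series \<open>W\<close> with coefficients \<open>theta_coeff k / (4\<^sup>k + 1)\<close> satisfies
  \<open>W(4 X) + W(X) = \<Theta>(X)\<close>. Because \<open>\<Theta>\<close> vanishes at all powers of \<open>4\<close>, this means
  \<open>W(4\<^sup>j) = (-1)\<^sup>j W(1)\<close>, and division by \<open>W(1)\<close> yields the moment condition. The base \<open>4\<close> is large
  enough for the constant term \<open>1/2\<close> to dominate \<open>W(1)\<close>, which is hence non-zero.\<close>

lemma reflecting_exists: "\<exists>c. reflecting c"
proof -
  define w where "w k = theta_coeff k / (4 ^ k + 1)" for k
  have wle: "\<bar>w k\<bar> \<le> \<bar>theta_coeff k\<bar>" for k
  proof -
    have "\<bar>theta_coeff k\<bar> / (4 ^ k + 1) \<le> \<bar>theta_coeff k\<bar> / 1"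
      by (intro divide_left_mono) (auto simp: add_pos_pos)
    then show ?thesis by (simp add: w_def abs_of_pos add_pos_pos)
  qed
  have sabs: "summable (\<lambda>k. \<bar>w k\<bar> * X ^ k)" if "X \<ge> 0" for X
    by (rule summable_comparison_test'[OF theta_summable[OF that]])
       (use wle that in \<open>auto simp: mult_right_mono\<close>)
  have sm: "summable (\<lambda>k. w k * X ^ k)" if "X \<ge> 0" for X
    by (rule summable_rabs_cancel) (use sabs[OF that] that in \<open>simp add: abs_mult\<close>)
  define W where "W X = (\<Sum>k. w k * X ^ k)" for X
  have Wstep: "W (4 ^ Suc j) = - W (4 ^ j)" for j
  proof -
    have "(\<lambda>k. w k * (4 ^ Suc j) ^ k + w k * (4 ^ j) ^ k) sums (W (4 ^ Suc j) + W (4 ^ j))"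
      unfolding W_def by (intro sums_add summable_sums sm) auto
    moreover have "w k * (4 ^ Suc j) ^ k + w k * (4 ^ j) ^ k = theta_coeff k * (4 ^ j) ^ k" for k
    proof -
      have "(4::real) ^ k + 1 > 0" by (simp add: add_pos_pos)
      then have th: "theta_coeff k = w k * (4 ^ k + 1)" by (simp add: w_def)
      have "((4::real) ^ Suc j) ^ k = 4 ^ k * (4 ^ j) ^ k" by (simp add: power_mult_distrib)
      then show ?thesis by (simp only: th distrib_left distrib_right mult_1_right mult.assoc)
    qed
    ultimately have "(\<lambda>k. theta_coeff k * (4 ^ j) ^ k) sums (W (4 ^ Suc j) + W (4 ^ j))" by simp
    then show ?thesis using theta_vanishes_at_powers_of_4[of j] by (simp add: sums_iff)
  qed
  have Wj: "W (4 ^ j) = (-1) ^ j * W 1" for j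
    by (induction j) (use Wstep in auto)
  have quot: "a / d \<le> a / b" if "a \<ge> 0" "0 < b" "b \<le> d" for a b d :: real
    by (rule divide_left_mono) (use that in auto)
  have tb: "\<bar>theta_coeff (Suc k)\<bar> \<le> 4 / 3 * (4 / 15) ^ k" for k
  proof (induction k)
    case (Suc k)
    have "(4::real) ^ 2 \<le> 4 ^ Suc (Suc k)" by (intro power_increasing) auto
    then have ge: "15 \<le> (4::real) ^ Suc (Suc k) - 1" by simp
    have "\<bar>theta_coeff (Suc (Suc k))\<bar> = 4 * \<bar>theta_coeff (Suc k)\<bar> / (4 ^ Suc (Suc k) - 1)"
    proof -
      have a: "\<bar>(4::real) ^ Suc (Suc k) - 1\<bar> = 4 ^ Suc (Suc k) - 1" using ge by linarith
      show ?thesis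
        by (simp only: theta_coeff.simps(2)[of "Suc k"] abs_divide abs_mult a abs_numeral abs_minus)
    qed
    also have "\<dots> \<le> 4 * \<bar>theta_coeff (Suc k)\<bar> / 15"
      by (rule quot[OF _ _ ge]) simp_all
    also have "\<dots> \<le> 4 * (4 / 3 * (4 / 15) ^ k) / 15"
      using Suc by simp
    finally show ?case by simp
  qed simp
  have wb: "\<bar>w (Suc k)\<bar> \<le> (4 / 15) * (4 / 15) ^ k" for k
  proof -
    have "(4::real) ^ 1 \<le> 4 ^ Suc k" by (intro power_increasing) auto
    then have ge: "5 \<le> (4::real) ^ Suc k + 1" by simp
    have "\<bar>w (Suc k)\<bar> = \<bar>theta_coeff (Suc k)\<bar> / (4 ^ Suc k + 1)"
      using ge by (simp add: w_def del: power_Suc theta_coeff.simps(2))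
    also have "\<dots> \<le> \<bar>theta_coeff (Suc k)\<bar> / 5"
      by (rule quot[OF _ _ ge]) simp_all
    also have "\<dots> \<le> (4 / 3 * (4 / 15) ^ k) / 5"
      using tb[of k] by simp
    finally show ?thesis by simp
  qed
  have "summable w" using sm[of 1] by simp
  then have s2: "summable (\<lambda>k. w (Suc k))" by (subst summable_Suc_iff)
  have s3: "summable (\<lambda>k. \<bar>w (Suc k)\<bar>)"
    using sabs[of 1] by (subst summable_Suc_iff) simp
  have geo: "(\<lambda>k. 4 / 15 * (4 / 15) ^ k) sums (4 / 15 * (1 / (1 - 4 / 15 :: real)))"
    by (intro sums_mult geometric_sums) simp
  have "W 1 = w 0 + (\<Sum>k. w (Suc k))"
    using suminf_split_head[OF \<open>summable w\<close>] by (simp add: W_def)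
  moreover have "w 0 = 1 / 2" by (simp add: w_def)
  moreover have "\<bar>\<Sum>k. w (Suc k)\<bar> \<le> (\<Sum>k. \<bar>w (Suc k)\<bar>)"
    using summable_rabs[OF s3] .
  moreover have "(\<Sum>k. \<bar>w (Suc k)\<bar>) \<le> 4 / 15 * (1 / (1 - 4 / 15 :: real))"
    using suminf_le[OF wb s3] geo by (simp add: sums_iff)
  ultimately have W1: "W 1 > 0" by (simp add: abs_le_iff)
  define c where "c k = w k / W 1" for k
  have "summable (\<lambda>k. \<bar>c k\<bar> * (4 ^ k) ^ j)" for j
  proof -
    have "summable (\<lambda>k. \<bar>w k\<bar> * (4 ^ j) ^ k / W 1)" by (intro summable_divide sabs) auto
    then show ?thesis using W1 by (simp add: c_def flip: power_mult) (simp add: mult.commute)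
  qed
  moreover have "(\<lambda>k. c k * (- (4 ^ k)) ^ j) sums 1" for j
  proof -
    have "(\<lambda>k. (-1) ^ j * (w k * (4 ^ j) ^ k / W 1)) sums ((-1) ^ j * (W (4 ^ j) / W 1))"
      unfolding W_def[of "4 ^ j"] by (intro sums_mult sums_divide summable_sums sm) auto
    moreover have "(-1) ^ j * (W (4 ^ j) / W 1) = 1"
      using W1 by (simp add: Wj flip: power_mult_distrib)
    moreover have "(-1) ^ j * (w k * (4 ^ j) ^ k / W 1) = c k * (- (4 ^ k)) ^ j" for k
      using power_minus[of "4 ^ k :: real" j]
      by (simp add: c_def flip: power_mult)
    ultimately show ?thesis by (simp only:)
  qed
  ultimately show ?thesis unfolding reflecting_def by blast
qed

text \<open>At \<open>0\<close> the derivative is found by integrating \<open>d\<close>: the fundamental theorem of calculus tolerates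
  a single exceptional point.\<close>

lemma has_real_derivative_across_0:
  fixes f d :: "real \<Rightarrow> real"
  assumes f: "continuous_on UNIV f" and d: "continuous_on UNIV d"
    and der: "\<And>y. y \<noteq> 0 \<Longrightarrow> (f has_real_derivative d y) (at y)"
  shows "(f has_real_derivative d y) (at y)"
proof (cases "y = 0")
  case True
  have eq: "f (-1) + integral {-1..y} d = f y" if "y \<in> {-1..1}" for y
  proof -
    have "(d has_integral f y - f (-1)) {-1..y}"
      by (rule fundamental_theorem_of_calculus_interior_strong[of "{0}"])
         (use that f in \<open>auto intro: continuous_on_subset der
            simp flip: has_real_derivative_iff_has_vector_derivative\<close>)
    then show ?thesis by (simp add: integral_unique)
  qed
  have "((\<lambda>y. f (-1) + integral {-1..y} d) has_real_derivative 0 + d 0) (at 0 within {-1..1})"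
    by (intro DERIV_add DERIV_const integral_has_real_derivative continuous_on_subset[OF d]) auto
  then have "(f has_real_derivative d 0) (at 0 within {-1..1})"
    using eq by (auto intro: has_field_derivative_transform_within[OF _ zero_less_one])
  moreover have "at (0::real) within {-1..1} = at 0"
    by (rule at_within_interior) auto
  ultimately show ?thesis using True by simp
qed (rule der)

text \<open>Continuous partial derivatives imply differentiability.\<close>

lemma C_k_on_SucI_partials:
  fixes f :: "real^2 \<Rightarrow> real"
  assumes S: "open S"
    and f1: "\<And>q. q \<in> S \<Longrightarrow> ((\<lambda>x. f (vector [x, q $ 2])) has_real_derivative f1 q) (at (q $ 1))"
    and f2: "\<And>q. q \<in> S \<Longrightarrow> ((\<lambda>y. f (vector [q $ 1, y])) has_real_derivative f2 q) (at (q $ 2))"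
    and C: "C_k_on k f1 S" "C_k_on k f2 S"
  shows "C_k_on (Suc k) f S"
proof (rule C_k_on_SucI[OF S])
  fix q assume q: "q \<in> S"
  have vc: "continuous_on A (\<lambda>z. vector [fst z, snd z] :: real^2)" for A
  proof -
    have "(\<lambda>z. vector [fst z, snd z] :: real^2) = (\<lambda>z. axis 1 (fst z) + axis 2 (snd z))"
      by (rule ext) (simp add: vec_eq_iff forall_2 axis_def)
    then show ?thesis
      by (simp only:) (intro continuous_on_add bounded_linear.continuous_on[OF bounded_linear_axis] continuous_intros)
  qed
  let ?g = "\<lambda>x y. f (vector [x, y])"
  have "open ((\<lambda>z. vector [fst z, snd z] :: real^2) -` S)" using vc[of UNIV] S by (simp add: open_vimage)
  moreover have "(q $ 1, q $ 2) \<in> (\<lambda>z. vector [fst z, snd z] :: real^2) -` S" using q by (simp add: vector_2_eta)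
  ultimately obtain T1 T2 where T: "open T1" "open T2" "(q $ 1, q $ 2) \<in> T1 \<times> T2"
    "T1 \<times> T2 \<subseteq> (\<lambda>z. vector [fst z, snd z] :: real^2) -` S"
    by (rule open_prod_elim)
  then obtain e1 e2 where e: "e1 > 0" "ball (q $ 1) e1 \<subseteq> T1" "e2 > 0" "ball (q $ 2) e2 \<subseteq> T2"
    by (metis mem_Sigma_iff open_contains_ball)
  let ?X = "ball (q $ 1) e1" and ?Y = "ball (q $ 2) e2"
  have inS: "vector [x, y] \<in> S" if "x \<in> ?X" "y \<in> ?Y" for x y
    using T(4) e that by (auto simp: subset_iff)
  have "((\<lambda>(x, y). ?g x y) has_derivative (\<lambda>(tx, ty). tx * f1 q + blinfun_apply (blinfun_mult_left (f2 (vector [q $ 1, q $ 2]))) ty))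
      (at (q $ 1, q $ 2) within ?X \<times> ?Y)"
  proof (rule has_derivative_partialsI[where fy = "\<lambda>x y. blinfun_mult_left (f2 (vector [x, y]))"])
    show "((\<lambda>x. ?g x (q $ 2)) has_derivative (\<lambda>tx. tx * f1 q)) (at (q $ 1) within ?X)"
      using f1[OF q] by (simp add: has_field_derivative_def mult_commute_abs has_derivative_at_withinI)
    show "((\<lambda>y. ?g x y) has_derivative blinfun_apply (blinfun_mult_left (f2 (vector [x, y])))) (at y within ?Y)"
      if "x \<in> ?X" "y \<in> ?Y" for x y
      using f2[OF inS[OF that]] by (simp add: has_field_derivative_def mult_commute_abs has_derivative_at_withinI)
    have "continuous_on (?X \<times> ?Y) (\<lambda>z. f2 (vector [fst z, snd z]))"
      by (rule continuous_on_compose2[OF C_k_on_continuous[OF C(2)] vc]) (use inS in auto)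
    then have "continuous_on (?X \<times> ?Y) (\<lambda>(x, y). blinfun_mult_left (f2 (vector [x, y])))"
      unfolding split_beta by (rule bounded_linear.continuous_on[OF bounded_linear_blinfun_mult_left])
    then show "continuous (at (q $ 1, q $ 2) within ?X \<times> ?Y) (\<lambda>(x, y). blinfun_mult_left (f2 (vector [x, y])))"
      using e by (simp add: continuous_on_eq_continuous_within)
  qed (use e in auto)
  moreover have "at (q $ 1, q $ 2) within ?X \<times> ?Y = at (q $ 1, q $ 2)"
    using e by (intro at_within_open) (auto intro: open_Times)
  ultimately have "((\<lambda>(x, y). ?g x y) has_derivative (\<lambda>(tx, ty). tx * f1 q + ty * f2 q)) (at (q $ 1, q $ 2))"
    by (simp add: vector_2_eta split_beta)
  moreover have "((\<lambda>p::real^2. (p $ 1, p $ 2)) has_derivative (\<lambda>X. (X $ 1, X $ 2))) (at q)"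
    by (intro bounded_linear_imp_has_derivative bounded_linear_Pair bounded_linear_vec_nth)
  ultimately have "((\<lambda>p. (\<lambda>(x, y). ?g x y) (p $ 1, p $ 2)) has_derivative
      (\<lambda>X. (\<lambda>(tx, ty). tx * f1 q + ty * f2 q) (X $ 1, X $ 2))) (at q)"
    by (rule has_derivative_compose[of "\<lambda>p::real^2. (p $ 1, p $ 2)" _ q UNIV "\<lambda>(x, y). ?g x y", rotated])
  then show "(f has_derivative (\<lambda>X. X $ 1 * f1 q + X $ 2 * f2 q)) (at q)"
    by (simp add: vector_2_eta)
next
  show "C_k_on k (\<lambda>q. X $ 1 * f1 q + X $ 2 * f2 q) S" for X :: "real^2"
    by (intro C_k_on_add C_k_on_bilinear[OF bounded_bilinear_mult] C_k_on_const C S)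
qed

definition box2 :: "real \<Rightarrow> (real^2) set" where
  "box2 r = {q. \<bar>q $ 1\<bar> < r \<and> \<bar>q $ 2\<bar> < r}"

lemma open_box2: "open (box2 r)"
  unfolding box2_def by (intro open_Collect_conj open_Collect_less continuous_intros)

lemma vector_in_box2 [simp]: "vector [x, y] \<in> box2 r \<longleftrightarrow> \<bar>x\<bar> < r \<and> \<bar>y\<bar> < r"
  by (simp add: box2_def)

lemma box2_small:
  assumes "open U" "0 \<in> U" obtains r where "r > 0" "box2 r \<subseteq> U"
proof -
  obtain e where e: "e > 0" "ball 0 e \<subseteq> U" using assms openE by blast
  have "box2 (e / 2) \<subseteq> ball 0 e"
  proof
    fix q assume "q \<in> box2 (e / 2)"
    then have "norm q < e"
      using norm_le_l1_cart[of q] by (simp add: sum_2 box2_def)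
    then show "q \<in> ball 0 e" by simp
  qed
  then show ?thesis using e that[of "e / 2"] by auto
qed

lemma star_box2: "q \<in> box2 r \<Longrightarrow> t \<in> {0..1} \<Longrightarrow> vector [q $ 1, t * q $ 2] \<in> box2 r"
  using mult_left_le_one_le[of "\<bar>q $ 2\<bar>" t] by (auto simp: box2_def abs_mult)

definition even_on_box :: "real \<Rightarrow> (real^2 \<Rightarrow> real) \<Rightarrow> bool" where
  "even_on_box r F \<longleftrightarrow> (\<forall>q\<in>box2 r. F (vector [q $ 1, - q $ 2]) = F q)"

text \<open>A chart whose square maps the half line \<open>y \<ge> 0\<close> onto \<open>0 \<le> v\<^sup>2 < (r/2)\<^sup>2\<close>. After this change of
  variable the dilations \<open>y \<mapsto> 4\<^sup>k y\<close> of the reflection stay inside the domain of the function to be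
  extended, and no cut-off function is needed.\<close>

definition root_chart :: "real \<Rightarrow> real \<Rightarrow> real" where
  "root_chart r y = (r / 2) * sqrt (y / (1 + y))"

lemma root_chart_bounds:
  assumes "r > 0" "y \<ge> 0"
  shows "0 \<le> root_chart r y" "root_chart r y \<le> r / 2" "\<bar>root_chart r y\<bar> < r"
proof -
  have "y / (1 + y) \<le> 1" using assms by simp
  then have "sqrt (y / (1 + y)) \<le> 1" using real_sqrt_le_1_iff by blast
  then show "root_chart r y \<le> r / 2" using assms by (simp add: root_chart_def mult_left_le)
  show "0 \<le> root_chart r y" using assms by (simp add: root_chart_def)
  with \<open>root_chart r y \<le> r / 2\<close> show "\<bar>root_chart r y\<bar> < r" using assms by simp
qed

lemma root_chart_0 [simp]: "root_chart r 0 = 0"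
  by (simp add: root_chart_def)

lemma continuous_on_root_chart: "continuous_on {0..} (root_chart r)"
  unfolding root_chart_def by (intro continuous_intros) auto

text \<open>The product of the chart and its derivative is a polynomial in the square of the chart.
  Consequently the \<open>y\<close>-derivative of \<open>F(x, root_chart r y)\<close> is again of this form, with another even
  smooth function in place of \<open>F\<close>.\<close>

lemma root_chart_has_derivative:
  assumes r: "r > 0" and y: "y > 0"
  obtains D where "(root_chart r has_real_derivative D) (at y)"
    "root_chart r y * D = r\<^sup>2 / 8 * (1 - 4 * (root_chart r y)\<^sup>2 / r\<^sup>2)\<^sup>2"
proof
  let ?D = "(r / 2) * (1 / (1 + y)\<^sup>2 * (inverse (sqrt (y / (1 + y))) / 2))"
  have pos: "y / (1 + y) > 0" using y by simp
  have "((\<lambda>y. y / (1 + y)) has_real_derivative 1 / (1 + y)\<^sup>2) (at y)"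
    using y by (auto intro!: derivative_eq_intros simp: power2_eq_square divide_simps)
  from DERIV_chain2[OF DERIV_real_sqrt[OF pos] this]
  have "((\<lambda>y. sqrt (y / (1 + y))) has_real_derivative inverse (sqrt (y / (1 + y))) / 2 * (1 / (1 + y)\<^sup>2)) (at y)" .
  from DERIV_cmult[OF this, of "r / 2"]
  show "(root_chart r has_real_derivative ?D) (at y)"
    unfolding root_chart_def by (simp add: mult.commute)
  have "sqrt (y / (1 + y)) \<noteq> 0" using real_sqrt_gt_zero[OF pos] by linarith
  moreover have "r / 2 * s * (r / 2 * (d * (inverse s / 2))) = r\<^sup>2 / 8 * d" if "s \<noteq> 0" for s d :: real
    using that by (simp add: field_simps power2_eq_square)
  ultimately have "root_chart r y * ?D = r\<^sup>2 / 8 * (1 / (1 + y))\<^sup>2"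
    unfolding root_chart_def power_one_over by blast
  moreover have "1 - 4 * (root_chart r y)\<^sup>2 / r\<^sup>2 = 1 / (1 + y)"
    using y r pos by (simp add: root_chart_def power_mult_distrib power_divide divide_simps)
  ultimately show "root_chart r y * ?D = r\<^sup>2 / 8 * (1 - 4 * (root_chart r y)\<^sup>2 / r\<^sup>2)\<^sup>2" by simp
qed

lemma has_real_derivative_pd:
  fixes F :: "real^2 \<Rightarrow> real"
  assumes "(F has_derivative frechet_derivative F (at q)) (at q)"
  shows "((\<lambda>x. F (vector [x, q $ 2])) has_real_derivative pd 1 F q) (at (q $ 1))"
    and "((\<lambda>y. F (vector [q $ 1, y])) has_real_derivative pd 2 F q) (at (q $ 2))"
proof -
  interpret L: bounded_linear "frechet_derivative F (at q)"
    using assms by (rule has_derivative_bounded_linear)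
  have eq1: "(\<lambda>x. vector [x, q $ 2] :: real^2) = (\<lambda>x. x *\<^sub>R axis 1 1 + axis 2 (q $ 2))"
    and eq2: "(\<lambda>y. vector [q $ 1, y] :: real^2) = (\<lambda>y. axis 1 (q $ 1) + y *\<^sub>R axis 2 1)"
    by (auto simp: fun_eq_iff vec_eq_iff forall_2 axis_def)
  have d1: "((\<lambda>x. vector [x, q $ 2] :: real^2) has_derivative (\<lambda>s. s *\<^sub>R axis 1 1)) (at (q $ 1))"
    and d2: "((\<lambda>y. vector [q $ 1, y] :: real^2) has_derivative (\<lambda>s. s *\<^sub>R axis 2 1)) (at (q $ 2))"
    unfolding eq1 eq2 by (auto intro!: derivative_eq_intros)
  have "((\<lambda>x. F (vector [x, q $ 2])) has_derivative (\<lambda>s. frechet_derivative F (at q) (s *\<^sub>R axis 1 1))) (at (q $ 1))"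
    by (rule has_derivative_compose[OF d1]) (simp add: vector_2_eta assms)
  then show "((\<lambda>x. F (vector [x, q $ 2])) has_real_derivative pd 1 F q) (at (q $ 1))"
    by (simp add: has_field_derivative_def pd_def L.scaleR mult_commute_abs)
  have "((\<lambda>y. F (vector [q $ 1, y])) has_derivative (\<lambda>s. frechet_derivative F (at q) (s *\<^sub>R axis 2 1))) (at (q $ 2))"
    by (rule has_derivative_compose[OF d2]) (simp add: vector_2_eta assms)
  then show "((\<lambda>y. F (vector [q $ 1, y])) has_real_derivative pd 2 F q) (at (q $ 2))"
    by (simp add: has_field_derivative_def pd_def L.scaleR mult_commute_abs)
qed

lemma pd_of_even:
  assumes F: "smooth_on F (box2 r)" "even_on_box r F" and q: "q \<in> box2 r"
  shows "pd 1 F (vector [q $ 1, - q $ 2]) = pd 1 F q" "pd 2 F (vector [q $ 1, - q $ 2]) = - pd 2 F q"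
proof -
  let ?R = "\<lambda>q::real^2. vector [q $ 1, - q $ 2] :: real^2"
  have Rq: "?R q \<in> box2 r" using q by (simp add: box2_def)
  have "bounded_linear ?R"
    by (rule linear_conv_bounded_linear[THEN iffD1])
       (auto intro!: linearI simp: vec_eq_iff forall_2)
  then have R: "(?R has_derivative ?R) (at q)" by (rule bounded_linear_imp_has_derivative)
  note dR = smooth_on_has_derivative[OF F(1) Rq]
  interpret L: bounded_linear "frechet_derivative F (at (?R q))"
    using dR by (rule has_derivative_bounded_linear)
  have "((\<lambda>q. F (?R q)) has_derivative (\<lambda>X. frechet_derivative F (at (?R q)) (?R X))) (at q)"
    by (rule has_derivative_compose[of ?R ?R q UNIV F, OF R dR])
  then have "(F has_derivative (\<lambda>X. frechet_derivative F (at (?R q)) (?R X))) (at q)"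
    by (rule has_derivative_transform_within_open[OF _ open_box2 q])
       (use F(2) in \<open>auto simp: even_on_box_def\<close>)
  from fun_cong[OF frechet_derivative_at[OF this], symmetric]
  have eq: "frechet_derivative F (at q) X = frechet_derivative F (at (?R q)) (?R X)" for X .
  have "?R (axis 1 1) = axis 1 1" by (simp add: vec_eq_iff forall_2 axis_def)
  then show "pd 1 F (?R q) = pd 1 F q" using eq[of "axis 1 1"] by (simp add: pd_def)
  have "?R (axis 2 1) = - axis 2 1" by (simp add: vec_eq_iff forall_2 axis_def)
  then show "pd 2 F (?R q) = - pd 2 F q"
    using eq[of "axis 2 1"] by (simp add: pd_def linear_neg[OF L.linear])
qed

text \<open>Seeley's extension of the function \<open>F(x, root_chart r y)\<close> to negative \<open>y\<close>.\<close>

definition reflection_extension :: "real \<Rightarrow> (nat \<Rightarrow> real) \<Rightarrow> (real^2 \<Rightarrow> real) \<Rightarrow> real^2 \<Rightarrow> real" where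
  "reflection_extension r c F q =
     (if q $ 2 \<le> 0 then \<Sum>k. c k * F (vector [q $ 1, root_chart r (4 ^ k * - q $ 2)])
      else F (vector [q $ 1, root_chart r (q $ 2)]))"

lemma bounded_on_half_box:
  fixes F :: "real^2 \<Rightarrow> real"
  assumes "continuous_on (box2 r) F" "0 < r" "r' < r"
  obtains M where "M \<ge> 0" "\<And>x v. \<bar>x\<bar> \<le> r' \<Longrightarrow> \<bar>v\<bar> \<le> r / 2 \<Longrightarrow> \<bar>F (vector [x, v])\<bar> \<le> M"
proof -
  let ?K = "cbox (vector [- r', - r / 2]) (vector [r', r / 2]) :: (real^2) set"
  have K: "vector [x, v] \<in> ?K \<longleftrightarrow> \<bar>x\<bar> \<le> r' \<and> \<bar>v\<bar> \<le> r / 2" for x v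
    by (auto simp: mem_box_cart forall_2)
  have "?K \<subseteq> box2 r" using assms(2,3) by (auto simp: mem_box_cart forall_2 box2_def)
  then have "compact (F ` ?K)"
    by (intro compact_continuous_image continuous_on_subset[OF assms(1)]) auto
  then obtain M where M: "\<And>q. q \<in> ?K \<Longrightarrow> \<bar>F q\<bar> \<le> M"
    using compact_imp_bounded bounded_real by (metis (no_types, lifting) imageI)
  show ?thesis
    by (rule that[of "max M 0"]) (use M K in \<open>auto simp: le_max_iff_disj\<close>)
qed

lemma reflecting_summable:
  assumes "reflecting c" shows "summable (\<lambda>k. \<bar>c k\<bar> * M)"
proof -
  have "summable (\<lambda>k. \<bar>c k\<bar> * (4 ^ k) ^ 0)" using assms by (simp only: reflecting_def)
  then show ?thesis by (intro summable_mult2) simp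
qed

lemma reflecting_sums:
  assumes "reflecting c" shows "c sums 1"
proof -
  have "(\<lambda>k. c k * (- (4 ^ k)) ^ 0) sums 1" using assms by (simp only: reflecting_def)
  then show ?thesis by simp
qed

text \<open>The series converges uniformly by the Weierstrass test, since \<open>F\<close> is bounded on the compact
  set where its arguments lie. The zeroth moment makes the two halves agree on \<open>y = 0\<close>.\<close>

lemma reflection_extension_continuous:
  fixes F :: "real^2 \<Rightarrow> real"
  assumes r: "r > 0" and c: "reflecting c" and F: "continuous_on (box2 r) F"
  shows "continuous_on {q. \<bar>q $ 1\<bar> < r} (reflection_extension r c F)"
proof -
  have vc: "continuous_on A (\<lambda>q. vector [q $ 1, root_chart r (h q)] :: real^2)"
    if "continuous_on A h" "\<And>q. q \<in> A \<Longrightarrow> h q \<ge> 0" for A and h :: "real^2 \<Rightarrow> real"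
  proof -
    have "continuous_on A (\<lambda>q. root_chart r (h q))"
      by (rule continuous_on_compose2[OF continuous_on_root_chart that(1)]) (use that(2) in auto)
    moreover have "(\<lambda>q. vector [q $ 1, root_chart r (h q)] :: real^2)
        = (\<lambda>q. axis 1 (q $ 1) + axis 2 (root_chart r (h q)))"
      by (rule ext) (simp add: vec_eq_iff forall_2 axis_def)
    ultimately show ?thesis
      by (simp only:) (intro continuous_on_add bounded_linear.continuous_on[OF bounded_linear_axis] continuous_intros)
  qed
  have part: "continuous_on {q. \<bar>q $ 1\<bar> < r'} (reflection_extension r c F)" if r': "r' < r" for r'
    unfolding reflection_extension_def
  proof (rule continuous_on_cases_le)
    let ?A = "{q \<in> {q::real^2. \<bar>q $ 1\<bar> < r'}. q $ 2 \<le> 0}"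
    obtain M where M: "M \<ge> 0" "\<And>x v. \<bar>x\<bar> \<le> r' \<Longrightarrow> \<bar>v\<bar> \<le> r / 2 \<Longrightarrow> \<bar>F (vector [x, v])\<bar> \<le> M"
      using bounded_on_half_box[OF F r r'] by metis
    have "uniform_limit ?A (\<lambda>n q. \<Sum>k<n. c k * F (vector [q $ 1, root_chart r (4 ^ k * - q $ 2)]))
        (\<lambda>q. \<Sum>k. c k * F (vector [q $ 1, root_chart r (4 ^ k * - q $ 2)])) sequentially"
    proof (rule Weierstrass_m_test[OF _ reflecting_summable[OF c, of M]])
      fix k q assume "q \<in> ?A"
      then show "norm (c k * F (vector [q $ 1, root_chart r (4 ^ k * - q $ 2)])) \<le> \<bar>c k\<bar> * M"
        using root_chart_bounds[OF r, of "4 ^ k * - q $ 2"]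
        by (auto simp: abs_mult zero_le_mult_iff mult_nonneg_nonpos intro!: mult_left_mono M(2))
    qed
    moreover have "continuous_on ?A (\<lambda>q. \<Sum>k<n. c k * F (vector [q $ 1, root_chart r (4 ^ k * - q $ 2)]))" for n
    proof (intro continuous_on_sum continuous_on_mult continuous_on_const)
      fix k
      show "continuous_on ?A (\<lambda>q. F (vector [q $ 1, root_chart r (4 ^ k * - q $ 2)]))"
        by (rule continuous_on_compose2[OF F vc])
           (use root_chart_bounds(3)[OF r] r' in \<open>auto intro!: continuous_intros mult_nonneg_nonneg simp: mult_nonneg_nonpos\<close>)
    qed
    ultimately show "continuous_on ?A (\<lambda>q. \<Sum>k. c k * F (vector [q $ 1, root_chart r (4 ^ k * - q $ 2)]))"
      by (intro uniform_limit_theorem[where F = sequentially]) auto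
    show "continuous_on {q \<in> {q::real^2. \<bar>q $ 1\<bar> < r'}. 0 \<le> q $ 2} (\<lambda>q. F (vector [q $ 1, root_chart r (q $ 2)]))"
      by (rule continuous_on_compose2[OF F vc])
         (use root_chart_bounds(3)[OF r] r' in \<open>auto intro!: continuous_intros\<close>)
    show "continuous_on {q::real^2. \<bar>q $ 1\<bar> < r'} (\<lambda>q. q $ 2)" by (intro continuous_intros)
    fix q :: "real^2" assume q: "q \<in> {q. \<bar>q $ 1\<bar> < r'}" "q $ 2 = 0"
    from sums_mult2[OF reflecting_sums[OF c], of "F (vector [q $ 1, 0])"]
    show "(\<Sum>k. c k * F (vector [q $ 1, root_chart r (4 ^ k * - q $ 2)])) = F (vector [q $ 1, root_chart r (q $ 2)])"
      using q by (simp add: sums_iff)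
  qed
  have "isCont (reflection_extension r c F) q" if q: "\<bar>q $ 1\<bar> < r" for q
  proof -
    obtain r' where r': "\<bar>q $ 1\<bar> < r'" "r' < r" using dense[OF q] by blast
    moreover have "open {q::real^2. \<bar>q $ 1\<bar> < r'}" by (intro open_Collect_less continuous_intros)
    ultimately show ?thesis using part[of r'] by (simp add: continuous_on_eq_continuous_at)
  qed
  then show ?thesis by (intro continuous_at_imp_continuous_on) auto
qed

text \<open>The partial derivatives are again reflection extensions: along \<open>x\<close> of \<open>F\<^sub>x\<close> with the same
  coefficients, along \<open>y\<close> of an even multiple of \<open>F\<^sub>v / v\<close> with the shifted coefficients. So the
  statement for all even \<open>F\<close> and all reflecting \<open>c\<close> follows by induction on the order.\<close>

lemma C_k_on_reflection_extension:
  fixes F :: "real^2 \<Rightarrow> real"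
  assumes r: "r > 0" and "reflecting c" "smooth_on F (box2 r)" "even_on_box r F"
  shows "C_k_on k (reflection_extension r c F) {q. \<bar>q $ 1\<bar> < r}"
  using assms(2-4)
proof (induction k arbitrary: c F)
  case 0
  then show ?case using reflection_extension_continuous[OF r] smooth_on_continuous by auto
next
  case (Suc k)
  note c = Suc.prems(1) and F = Suc.prems(2,3)
  have F1: "smooth_on (pd 1 F) (box2 r)" and F2: "smooth_on (pd 2 F) (box2 r)"
    unfolding pd_def[abs_def] using smooth_on_frechet[OF F(1)] by auto
  have F1e: "even_on_box r (pd 1 F)" using pd_of_even[OF F] by (simp add: even_on_box_def)
  have zero: "pd 2 F q = 0" if "q \<in> box2 r" "q $ 2 = 0" for q
    using pd_of_even(2)[OF F that(1)] that(2) vector_2_eta[of q] by simp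
  obtain G where G: "smooth_on G (box2 r)" "\<And>q. q \<in> box2 r \<Longrightarrow> pd 2 F q = q $ 2 * G q"
    using hadamard_division[OF open_box2 F2 _ zero]
    by (metis (mono_tags, lifting) real_scaleR_def star_box2)
  define DF where "DF q = G q * (r\<^sup>2 / 8 * (1 - 4 * (q $ 2)\<^sup>2 / r\<^sup>2)\<^sup>2)" for q
  have nth: "smooth_on (\<lambda>q::real^2. q $ 2) (box2 r)"
    by (intro smooth_on_bounded_linear bounded_linear_vec_nth open_box2)
  have DF: "smooth_on DF (box2 r)"
    unfolding DF_def[abs_def] divide_inverse
    by (intro smooth_on_mult smooth_on_power smooth_on_diff smooth_on_const open_box2 G(1) nth)
  have "G (vector [q $ 1, - q $ 2]) = G q" if q: "q \<in> box2 r" for q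
  proof (cases "q $ 2 = 0")
    case False
    have "vector [q $ 1, - q $ 2] \<in> box2 r" using q by (simp add: box2_def)
    from G(2)[OF this] G(2)[OF q] pd_of_even(2)[OF F q] False show ?thesis by simp
  qed (use vector_2_eta[of q] in simp)
  then have DFe: "even_on_box r DF" by (simp add: even_on_box_def DF_def)
  note c' = reflecting_shift[OF c]
  let ?c' = "\<lambda>k. c k * - (4 ^ k)"
  show ?case
  proof (rule C_k_on_SucI_partials)
    show "open {q::real^2. \<bar>q $ 1\<bar> < r}" by (intro open_Collect_less continuous_intros)
    show "C_k_on k (reflection_extension r c (pd 1 F)) {q. \<bar>q $ 1\<bar> < r}"
      by (rule Suc.IH[OF c F1 F1e])
    show "C_k_on k (reflection_extension r ?c' DF) {q. \<bar>q $ 1\<bar> < r}"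
      by (rule Suc.IH[OF c' DF DFe])
  next
    fix q :: "real^2" assume "q \<in> {q. \<bar>q $ 1\<bar> < r}"
    then have q: "\<bar>q $ 1\<bar> < r" by simp
    have d1: "((\<lambda>x. F (vector [x, v])) has_real_derivative pd 1 F (vector [x, v])) (at x within A)"
      and d2: "((\<lambda>v. F (vector [x, v])) has_real_derivative v * G (vector [x, v])) (at v)"
      if "\<bar>x\<bar> < r" "\<bar>v\<bar> < r" for x v A
      using has_real_derivative_pd[OF smooth_on_has_derivative[OF F(1), of "vector [x, v]"]] that
        G(2)[of "vector [x, v]"] by (auto intro: DERIV_subset)
    show "((\<lambda>x. reflection_extension r c F (vector [x, q $ 2])) has_real_derivative
        reflection_extension r c (pd 1 F) q) (at (q $ 1))"
    proof (cases "q $ 2 \<le> 0")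
      case True
      obtain r' where r': "\<bar>q $ 1\<bar> < r'" "r' < r" using dense[OF q] by blast
      obtain M where M: "\<And>x v. \<bar>x\<bar> \<le> r' \<Longrightarrow> \<bar>v\<bar> \<le> r / 2 \<Longrightarrow> \<bar>pd 1 F (vector [x, v])\<bar> \<le> M"
        using bounded_on_half_box[OF smooth_on_continuous[OF F1] r r'(2)] by metis
      obtain M0 where M0: "\<And>x v. \<bar>x\<bar> \<le> r' \<Longrightarrow> \<bar>v\<bar> \<le> r / 2 \<Longrightarrow> \<bar>F (vector [x, v])\<bar> \<le> M0"
        using bounded_on_half_box[OF smooth_on_continuous[OF F(1)] r r'(2)] by metis
      let ?v = "\<lambda>k. root_chart r (4 ^ k * - q $ 2)"
      have v: "\<bar>?v k\<bar> \<le> r / 2" "\<bar>?v k\<bar> < r" for k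
        using root_chart_bounds[OF r, of "4 ^ k * - q $ 2"] True by (auto simp: mult_nonneg_nonpos)
      have "((\<lambda>x. \<Sum>k. c k * F (vector [x, ?v k])) has_real_derivative
          (\<Sum>k. c k * pd 1 F (vector [q $ 1, ?v k]))) (at (q $ 1))"
      proof (rule has_field_derivative_series'(2))
        show "convex {-r'<..<r'}" by simp
        show "((\<lambda>x. c k * F (vector [x, ?v k])) has_real_derivative c k * pd 1 F (vector [x, ?v k])) (at x within {-r'<..<r'})"
          if "x \<in> {-r'<..<r'}" for k x
          using that r' v(2)[of k] by (intro DERIV_cmult d1) auto
        show "uniformly_convergent_on {-r'<..<r'} (\<lambda>n x. \<Sum>k<n. c k * pd 1 F (vector [x, ?v k]))"
          by (rule uniformly_convergentI[OF Weierstrass_m_test[OF _ reflecting_summable[OF c, of M]]])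
             (use v(1) in \<open>auto simp: abs_mult intro!: mult_left_mono M\<close>)
        show "q $ 1 \<in> {-r'<..<r'}" "q $ 1 \<in> interior {-r'<..<r'}" using r' by (auto simp: interior_open)
        show "summable (\<lambda>k. c k * F (vector [q $ 1, ?v k]))"
          by (rule summable_comparison_test'[OF reflecting_summable[OF c, of M0]])
             (use v(1) r' in \<open>auto simp: abs_mult intro!: mult_left_mono M0\<close>)
      qed
      then show ?thesis using True by (simp add: reflection_extension_def)
    next
      case False
      then show ?thesis
        using d1[OF q root_chart_bounds(3)[OF r], of "q $ 2" UNIV] by (simp add: reflection_extension_def)
    qed
    have along: "continuous_on UNIV (\<lambda>y. reflection_extension r e H (vector [q $ 1, y]))"
      if "reflecting e" "smooth_on H (box2 r)" for e H
    proof -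
      have "(\<lambda>y. vector [q $ 1, y] :: real^2) = (\<lambda>y. axis 1 (q $ 1) + axis 2 y)"
        by (rule ext) (simp add: vec_eq_iff forall_2 axis_def)
      then have "continuous_on UNIV (\<lambda>y. vector [q $ 1, y] :: real^2)"
        by (simp only:) (intro continuous_on_add bounded_linear.continuous_on[OF bounded_linear_axis] continuous_intros)
      moreover have "range (\<lambda>y. vector [q $ 1, y] :: real^2) \<subseteq> {q. \<bar>q $ 1\<bar> < r}" using q by auto
      ultimately show ?thesis
        by (rule continuous_on_compose2[OF reflection_extension_continuous[OF r that(1) smooth_on_continuous[OF that(2)]]])
    qed
    have dr: "((\<lambda>y. F (vector [q $ 1, root_chart r y])) has_real_derivative
        DF (vector [q $ 1, root_chart r y])) (at y)" if y: "y > 0" for y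
    proof -
      obtain D where D: "(root_chart r has_real_derivative D) (at y)"
        "root_chart r y * D = r\<^sup>2 / 8 * (1 - 4 * (root_chart r y)\<^sup>2 / r\<^sup>2)\<^sup>2"
        using root_chart_has_derivative[OF r y] by blast
      have "\<bar>root_chart r y\<bar> < r" using root_chart_bounds(3)[OF r] y by simp
      note chain = DERIV_chain2[OF d2[OF q this] D(1)]
      have "DF (vector [q $ 1, root_chart r y])
          = root_chart r y * G (vector [q $ 1, root_chart r y]) * D"
        by (simp only: DF_def vector_2 D(2)[symmetric]) (simp only: mult_ac)
      with chain show ?thesis by (simp only:)
    qed
    show "((\<lambda>y. reflection_extension r c F (vector [q $ 1, y])) has_real_derivative
        reflection_extension r ?c' DF q) (at (q $ 2))"
    proof -
      have "((\<lambda>y. reflection_extension r c F (vector [q $ 1, y])) has_real_derivative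
          reflection_extension r ?c' DF (vector [q $ 1, y])) (at y)" for y
      proof (rule has_real_derivative_across_0[OF along[OF c F(1)] along[OF c' DF]])
        fix y :: real assume "y \<noteq> 0"
        show "((\<lambda>y. reflection_extension r c F (vector [q $ 1, y])) has_real_derivative
          reflection_extension r ?c' DF (vector [q $ 1, y])) (at y)"
        proof (cases "y > 0")
          case True
          have "((\<lambda>y. reflection_extension r c F (vector [q $ 1, y])) has_real_derivative
              DF (vector [q $ 1, root_chart r y])) (at y)"
            by (rule has_field_derivative_transform_within_open[OF dr[OF True], of "{0<..}"])
               (use True in \<open>auto simp: reflection_extension_def\<close>)
          then show ?thesis using True by (simp add: reflection_extension_def)
        next
          case False
          then have y: "y < 0" using \<open>y \<noteq> 0\<close> by simp
          obtain M where M: "\<And>x v. \<bar>x\<bar> \<le> \<bar>q $ 1\<bar> \<Longrightarrow> \<bar>v\<bar> \<le> r / 2 \<Longrightarrow> \<bar>DF (vector [x, v])\<bar> \<le> M"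
            using bounded_on_half_box[OF smooth_on_continuous[OF DF] r q] by metis
          obtain M0 where M0: "\<And>x v. \<bar>x\<bar> \<le> \<bar>q $ 1\<bar> \<Longrightarrow> \<bar>v\<bar> \<le> r / 2 \<Longrightarrow> \<bar>F (vector [x, v])\<bar> \<le> M0"
            using bounded_on_half_box[OF smooth_on_continuous[OF F(1)] r q] by metis
          have v: "\<bar>root_chart r (4 ^ k * - y)\<bar> \<le> r / 2" if "y < 0" for k y
            using root_chart_bounds[OF r, of "4 ^ k * - y"] that by (auto simp: mult_nonneg_nonpos)
          have "((\<lambda>y. \<Sum>k. c k * F (vector [q $ 1, root_chart r (4 ^ k * - y)])) has_real_derivative
              (\<Sum>k. ?c' k * DF (vector [q $ 1, root_chart r (4 ^ k * - y)]))) (at y)"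
          proof (rule has_field_derivative_series'(2))
            show "convex {..<0::real}" by simp
            show "((\<lambda>y. c k * F (vector [q $ 1, root_chart r (4 ^ k * - y)])) has_real_derivative
                ?c' k * DF (vector [q $ 1, root_chart r (4 ^ k * - y)])) (at y within {..<0})"
              if "y \<in> {..<0}" for k y
            proof -
              have pos: "4 ^ k * - y > 0" using that by (simp add: mult_pos_neg)
              have "((\<lambda>y. 4 ^ k * - y) has_real_derivative - (4 ^ k)) (at y within {..<0})"
                by (auto intro!: derivative_eq_intros)
              from DERIV_cmult[OF DERIV_chain2[OF dr[OF pos] this], of "c k"]
              show ?thesis by (simp add: mult_ac)
            qed
            show "uniformly_convergent_on {..<0} (\<lambda>n y. \<Sum>k<n. ?c' k * DF (vector [q $ 1, root_chart r (4 ^ k * - y)]))"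
              by (rule uniformly_convergentI[OF Weierstrass_m_test[OF _ reflecting_summable[OF c', of M]]])
                 (use v in \<open>auto simp: abs_mult intro!: mult_left_mono M\<close>)
            show "y \<in> {..<0}" "y \<in> interior {..<0}" using y by (auto simp: interior_open)
            show "summable (\<lambda>k. c k * F (vector [q $ 1, root_chart r (4 ^ k * - y)]))"
              by (rule summable_comparison_test'[OF reflecting_summable[OF c, of M0]])
                 (use v[OF y] in \<open>auto simp: abs_mult intro!: mult_left_mono M0\<close>)
          qed
          from has_field_derivative_transform_within_open[OF this, of "{..<0}"] y
          show ?thesis by (simp add: reflection_extension_def)
        qed
      qed
      from this[of "q $ 2"] show ?thesis by (simp add: vector_2_eta)
    qed
  qed
qed

text \<open>The required function is the reflection extension, composed with the inverse
  \<open>z \<mapsto> z / (r\<^sup>2/4 - z)\<close> of the squared root chart.\<close>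

theorem whitney_even:
  fixes F :: "real^2 \<Rightarrow> real"
  assumes F: "smooth_germ F" and even: "\<forall>\<^sub>F q in nhds 0. F (vector [q $ 1, - q $ 2]) = F q"
  obtains a :: "real^2 \<Rightarrow> real"
  where "smooth_germ a" "\<forall>\<^sub>F q in nhds 0. F q = a (vector [q $ 1, (q $ 2)\<^sup>2])"
proof -
  obtain U V where U: "open U" "0 \<in> U" "smooth_on F U"
    and V: "open V" "0 \<in> V" "\<And>q. q \<in> V \<Longrightarrow> F (vector [q $ 1, - q $ 2]) = F q"
    using F even by (auto simp: smooth_germ_def eventually_nhds)
  obtain r where r: "r > 0" "box2 r \<subseteq> U \<inter> V"
    using box2_small[of "U \<inter> V"] U V by auto
  have Fr: "smooth_on F (box2 r)" "even_on_box r F"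
    using r U V by (auto intro: smooth_on_subset simp: even_on_box_def)
  obtain c where c: "reflecting c" using reflecting_exists by blast
  let ?A = "reflection_extension r c F"
  have A: "smooth_on ?A {q. \<bar>q $ 1\<bar> < r}"
    unfolding smooth_on_def using C_k_on_reflection_extension[OF r(1) c Fr] by blast
  define m where "m q = (vector [q $ 1, q $ 2 * inverse (r\<^sup>2 / 4 - q $ 2)] :: real^2)" for q :: "real^2"
  have m: "smooth_germ m"
    unfolding m_def[abs_def] using r(1)
    by (intro smooth_germ_intros smooth_germ_inverse)
       auto
  have "open {q::real^2. \<bar>q $ 1\<bar> < r}" by (intro open_Collect_less continuous_intros)
  from smooth_germ_compose_on[OF this A _ m] r(1)
  have 1: "smooth_germ (\<lambda>q. ?A (m q))" by (simp add: m_def)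
  have "F q = ?A (m (vector [q $ 1, (q $ 2)\<^sup>2]))" if q: "q \<in> box2 (r / 2)" for q
  proof -
    have qr: "q \<in> box2 r" using q r(1) unfolding box2_def by auto
    have sq: "(q $ 2)\<^sup>2 < r\<^sup>2 / 4"
      using q power_strict_mono[of "\<bar>q $ 2\<bar>" "r / 2" 2] unfolding box2_def by (simp add: power_divide)
    have absq: "F (vector [q $ 1, \<bar>q $ 2\<bar>]) = F q"
      using Fr(2) qr by (cases "q $ 2 \<ge> 0") (auto simp: even_on_box_def vector_2_eta)
    show ?thesis
    proof (cases "q $ 2 = 0")
      case True
      from sums_mult2[OF reflecting_sums[OF c], of "F q"] show ?thesis
        using True vector_2_eta[of q] by (simp add: m_def reflection_extension_def sums_iff)
    next
      case False
      define y where "y = (q $ 2)\<^sup>2 * inverse (r\<^sup>2 / 4 - (q $ 2)\<^sup>2)"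
      have y: "y > 0" using False sq by (simp add: y_def)
      have "y / (1 + y) = (q $ 2)\<^sup>2 / (r\<^sup>2 / 4)"
        using sq r(1) False unfolding y_def by (simp add: divide_simps)
      then have "root_chart r y = r / 2 * sqrt ((q $ 2)\<^sup>2 / (r / 2)\<^sup>2)"
        by (simp add: root_chart_def power_divide)
      also have "\<dots> = \<bar>q $ 2\<bar>" using r(1) by (simp add: real_sqrt_divide)
      finally have "root_chart r y = \<bar>q $ 2\<bar>" .
      then show ?thesis using y absq by (simp add: m_def reflection_extension_def flip: y_def)
    qed
  qed
  moreover have "\<forall>\<^sub>F q in nhds 0. q \<in> box2 (r / 2)"
    by (rule eventually_nhds_in_open[OF open_box2]) (use r(1) in \<open>simp add: box2_def\<close>)
  ultimately have E: "\<forall>\<^sub>F q in nhds 0. F q = ?A (m (vector [q $ 1, (q $ 2)\<^sup>2]))"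
    by (rule eventually_mono[rotated])
  show ?thesis by (rule that[OF 1 E])
qed

section \<open>Calculus of germs at the origin of the plane\<close>

lemma frechet_derivative_cong_nhds:
  assumes "\<forall>\<^sub>F y in nhds x. f y = g y"
  shows "frechet_derivative f (at x) = frechet_derivative g (at x)"
proof -
  obtain S where S: "open S" "x \<in> S" "\<And>y. y \<in> S \<Longrightarrow> f y = g y"
    using assms by (auto simp: eventually_nhds)
  have "(f has_derivative D) (at x) \<longleftrightarrow> (g has_derivative D) (at x)" for D
    using has_derivative_transform_within_open[OF _ S(1,2)] S(3) by metis
  then show ?thesis unfolding frechet_derivative_def by simp
qed

lemma pd_cong:
  assumes "\<forall>\<^sub>F q in nhds 0. f q = g q"
  shows "\<forall>\<^sub>F q in nhds 0. pd i f q = pd i g q"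
proof -
  have "\<forall>\<^sub>F q in nhds 0. \<forall>\<^sub>F p in nhds q. f p = g p"
    using assms by (simp add: eventually_eventually)
  then show ?thesis
    by (rule eventually_mono) (simp add: pd_def frechet_derivative_cong_nhds)
qed

lemma at_0: "\<forall>\<^sub>F q in nhds 0. P q \<Longrightarrow> P 0"
  by (rule eventually_nhds_x_imp_x)

lemma pd_bilinear:
  assumes B: "bounded_bilinear B" and f: "smooth_germ f" and g: "smooth_germ g"
  shows "\<forall>\<^sub>F q in nhds 0. pd i (\<lambda>q. B (f q) (g q)) q = B (pd i f q) (g q) + B (f q) (pd i g q)"
  using smooth_germ_has_derivative[OF f] smooth_germ_has_derivative[OF g]
proof eventually_elim
  case (elim q)
  from frechet_derivative_at[OF bounded_bilinear.FDERIV[OF B elim], symmetric]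
  show ?case by (simp add: pd_def add.commute)
qed

lemmas pd_mult = pd_bilinear[OF bounded_bilinear_mult]
lemmas pd_scaleR = pd_bilinear[OF bounded_bilinear_scaleR]
lemmas pd_inner = pd_bilinear[OF bounded_bilinear_inner]

lemma pd_add:
  assumes f: "smooth_germ f" and g: "smooth_germ g"
  shows "\<forall>\<^sub>F q in nhds 0. pd i (\<lambda>q. f q + g q) q = pd i f q + pd i g q"
  using smooth_germ_has_derivative[OF f] smooth_germ_has_derivative[OF g]
proof eventually_elim
  case (elim q)
  from frechet_derivative_at[OF has_derivative_add[OF elim], symmetric]
  show ?case by (simp add: pd_def)
qed

lemma pd_diff:
  assumes f: "smooth_germ f" and g: "smooth_germ g"
  shows "\<forall>\<^sub>F q in nhds 0. pd i (\<lambda>q. f q - g q) q = pd i f q - pd i g q"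
  using smooth_germ_has_derivative[OF f] smooth_germ_has_derivative[OF g]
proof eventually_elim
  case (elim q)
  from frechet_derivative_at[OF has_derivative_diff[OF elim], symmetric]
  show ?case by (simp add: pd_def)
qed

lemma pd_minus:
  assumes f: "smooth_germ f"
  shows "\<forall>\<^sub>F q in nhds 0. pd i (\<lambda>q. - f q) q = - pd i f q"
  using smooth_germ_has_derivative[OF f]
proof eventually_elim
  case (elim q)
  from frechet_derivative_at[OF has_derivative_minus[OF elim], symmetric]
  show ?case by (simp add: pd_def)
qed

lemma pd_const [simp]: "pd i (\<lambda>q. c) q = 0"
  by (simp add: pd_def frechet_derivative_const)

lemma pd_nth [simp]: "pd i (\<lambda>q. q $ j) q = (if i = j then 1 else 0)"
  using frechet_derivative_at[OF bounded_linear_imp_has_derivative[OF bounded_linear_vec_nth[of j]], of q, symmetric]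
  by (simp add: pd_def axis_def)

lemma eventually_compose_germ:
  assumes "smooth_germ g" "g 0 = 0" "\<forall>\<^sub>F y in nhds 0. P y"
  shows "\<forall>\<^sub>F q in nhds 0. P (g q)"
  using eventually_compose_filterlim[OF assms(3), of g "nhds 0"] smooth_germ_tendsto[OF assms(1)] assms(2)
  by simp

lemma pd_compose:
  assumes F: "smooth_germ F" and g: "smooth_germ g" "g 0 = 0"
  shows "\<forall>\<^sub>F q in nhds 0. pd i (\<lambda>q. F (g q)) q = frechet_derivative F (at (g q)) (pd i g q)"
proof -
  have "\<forall>\<^sub>F q in nhds 0. (F has_derivative frechet_derivative F (at (g q))) (at (g q))"
    by (rule eventually_compose_germ[OF g smooth_germ_has_derivative[OF F]])
  then show ?thesis using smooth_germ_has_derivative[OF g(1)]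
  proof eventually_elim
    case (elim q)
    from frechet_derivative_at[OF has_derivative_compose[OF elim(2,1)], symmetric]
    show ?case by (simp add: pd_def)
  qed
qed

lemma frechet_commute_germ:
  assumes f: "smooth_germ f"
  shows "\<forall>\<^sub>F q in nhds 0. frechet_derivative (\<lambda>p. frechet_derivative f (at p) X) (at q) Y
       = frechet_derivative (\<lambda>p. frechet_derivative f (at p) Y) (at q) X"
  using f unfolding smooth_germ_def eventually_nhds using symmetric_second_derivative by blast

lemma pd_commute:
  "smooth_germ f \<Longrightarrow> \<forall>\<^sub>F q in nhds 0. pd i (pd j f) q = pd j (pd i f) q"
  unfolding pd_def[abs_def] by (rule frechet_commute_germ)

lemma hadamard_germ:
  fixes F :: "real^2 \<Rightarrow> 'b::euclidean_space"
  assumes F: "smooth_germ F" and zero: "\<forall>\<^sub>F q in nhds 0. q $ 2 = 0 \<longrightarrow> F q = 0"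
  obtains G where "smooth_germ G" "\<forall>\<^sub>F q in nhds 0. F q = (q $ 2) *\<^sub>R G q"
proof -
  obtain U V where U: "open U" "0 \<in> U" "smooth_on F U"
    and V: "open V" "0 \<in> V" "\<And>q. q \<in> V \<Longrightarrow> q $ 2 = 0 \<longrightarrow> F q = 0"
    using F zero by (auto simp: smooth_germ_def eventually_nhds)
  obtain r where r: "r > 0" "box2 r \<subseteq> U \<inter> V"
    using box2_small[of "U \<inter> V"] U V by auto
  have z: "(0::real^2) \<in> box2 r" using r by (simp add: box2_def)
  have Fr: "smooth_on F (box2 r)" using U(3) r smooth_on_subset by blast
  obtain G where G: "smooth_on G (box2 r)" "\<And>q. q \<in> box2 r \<Longrightarrow> F q = (q $ 2) *\<^sub>R G q"
    by (rule hadamard_division[OF open_box2 Fr star_box2]) (use V r in auto)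
  show ?thesis
    by (rule that[OF smooth_germI[OF open_box2 z G(1)]])
       (use eventually_nhds_in_open[OF open_box2 z] G(2) in \<open>auto elim: eventually_mono\<close>)
qed

text \<open>Identities multiplied by a power of \<open>v\<close> can be divided by it off the axis; this extends the
  result to the axis.\<close>

lemma smooth_germ_zero_by_density:
  fixes F :: "real^2 \<Rightarrow> 'b::euclidean_space"
  assumes F: "smooth_germ F" and off: "\<forall>\<^sub>F q in nhds 0. q $ 2 \<noteq> 0 \<longrightarrow> F q = 0"
  shows "\<forall>\<^sub>F q in nhds 0. F q = 0"
proof -
  obtain U V where U: "open U" "0 \<in> U" "smooth_on F U"
    and V: "open V" "0 \<in> V" "\<And>q. q \<in> V \<Longrightarrow> q $ 2 \<noteq> 0 \<longrightarrow> F q = 0"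
    using F off by (auto simp: smooth_germ_def eventually_nhds)
  have "F q = 0" if q: "q \<in> U \<inter> V" for q
  proof (rule ccontr)
    assume ne: "F q \<noteq> 0"
    have ax: "q $ 2 = 0" using V q ne by auto
    have "open ((U \<inter> V) \<inter> F -` (- {0}))"
      using U V smooth_on_continuous[OF smooth_on_subset[OF U(3), of "U \<inter> V"]]
      by (intro continuous_open_preimage) auto
    then obtain e where e: "e > 0" "ball q e \<subseteq> (U \<inter> V) \<inter> F -` (- {0})"
      using q ne openE by (metis ComplI IntI singletonD vimageI)
    let ?p = "q + (e / 2) *\<^sub>R axis 2 1"
    have "?p \<in> ball q e" using e(1) by (simp add: dist_norm norm_axis_1)
    moreover have "?p $ 2 \<noteq> 0" using ax e(1) by (simp add: axis_def)
    ultimately show False using e(2) V(3) by blast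
  qed
  moreover have "\<forall>\<^sub>F q in nhds 0. q \<in> U \<inter> V" using U V by (intro eventually_nhds_in_open) auto
  ultimately show ?thesis by (auto elim: eventually_mono)
qed

lemma pd_2_v_scaleR:
  assumes "smooth_germ F"
  shows "\<forall>\<^sub>F q in nhds 0. pd 2 (\<lambda>q. (q $ 2) *\<^sub>R F q) q = F q + (q $ 2) *\<^sub>R pd 2 F q"
  using pd_scaleR[OF smooth_germ_nth[of 2] assms, of 2] by eventually_elim simp

lemma pd_1_v_scaleR:
  assumes "smooth_germ F"
  shows "\<forall>\<^sub>F q in nhds 0. pd 1 (\<lambda>q. (q $ 2) *\<^sub>R F q) q = (q $ 2) *\<^sub>R pd 1 F q"
  using pd_scaleR[OF smooth_germ_nth[of 2] assms, of 1] by eventually_elim simp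

lemma pd_2_v_power:
  assumes "smooth_germ F"
  shows "\<forall>\<^sub>F q in nhds 0. pd 2 (\<lambda>q. (q $ 2) ^ Suc k * F q) q
       = (q $ 2) ^ k * (of_nat (Suc k) * F q + q $ 2 * pd 2 F q)"
proof -
  have "\<forall>\<^sub>F q in nhds 0. pd 2 (\<lambda>q::real^2. (q $ 2) ^ Suc k) q = of_nat (Suc k) * (q $ 2) ^ k"
  proof (induction k)
    case (Suc k)
    have "smooth_germ (\<lambda>q::real^2. (q $ 2) ^ Suc k)" by (intro smooth_germ_intros)
    from Suc pd_mult[OF smooth_germ_nth[of 2] this, of 2] show ?case
      by eventually_elim (simp add: algebra_simps)
  qed simp
  moreover have "smooth_germ (\<lambda>q::real^2. (q $ 2) ^ Suc k)" by (intro smooth_germ_intros)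
  note pd_mult[OF this assms, of 2]
  ultimately show ?thesis by eventually_elim (simp add: algebra_simps)
qed

text \<open>Hadamard's quotient agrees with the one in the definition also on the axis: differentiating
  \<open>G\<^sub>v = v h\<close> gives \<open>G\<^sub>v\<^sub>v = h\<close> there.\<close>

lemma v_quotient_smooth:
  assumes G: "smooth_germ G" and ax: "\<forall>\<^sub>F q in nhds 0. q $ 2 = 0 \<longrightarrow> pd 2 G q = 0"
  shows "smooth_germ (v_quotient G)" "\<forall>\<^sub>F q in nhds 0. pd 2 G q = (q $ 2) *\<^sub>R v_quotient G q"
proof -
  obtain h where h: "smooth_germ h" "\<forall>\<^sub>F q in nhds 0. pd 2 G q = (q $ 2) *\<^sub>R h q"
    by (rule hadamard_germ[OF smooth_germ_pd[OF G] ax])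
  have "\<forall>\<^sub>F q in nhds 0. h q = v_quotient G q"
    using h(2) pd_cong[OF h(2), of 2] pd_2_v_scaleR[OF h(1)]
    by eventually_elim (auto simp: v_quotient_def)
  then show "smooth_germ (v_quotient G)" "\<forall>\<^sub>F q in nhds 0. pd 2 G q = (q $ 2) *\<^sub>R v_quotient G q"
    using smooth_germ_cong[OF h(1)] h(2) by (auto elim: eventually_elim2)
qed

lemma inner_expand_orthonormal:
  fixes e1 e2 e3 X Y :: "real^3"
  assumes "e1 \<bullet> e1 = 1" "e2 \<bullet> e2 = 1" "e3 \<bullet> e3 = 1" "e1 \<bullet> e2 = 0" "e1 \<bullet> e3 = 0" "e2 \<bullet> e3 = 0"
  shows "X = (X \<bullet> e1) *\<^sub>R e1 + (X \<bullet> e2) *\<^sub>R e2 + (X \<bullet> e3) *\<^sub>R e3"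
proof -
  have ne: "e1 \<noteq> e2" "e1 \<noteq> e3" "e2 \<noteq> e3" "0 \<notin> {e1, e2, e3}" using assms by auto
  have o: "pairwise orthogonal {e1, e2, e3}"
    using assms by (auto simp: pairwise_def orthogonal_def inner_commute)
  have "independent {e1, e2, e3}" by (rule pairwise_orthogonal_independent[OF o ne(4)])
  moreover have "card {e1, e2, e3} = 3" using ne by simp
  ultimately have "span {e1, e2, e3} = UNIV"
    using card_eq_dim[of "{e1, e2, e3}" UNIV] dim_UNIV[where 'a = "real^3"] by auto
  then have "(\<Sum>b\<in>{e1, e2, e3}. (X \<bullet> b) *\<^sub>R b) = X"
    using assms by (intro orthonormal_basis_expand[OF o]) (auto simp: norm_eq_1)
  then show ?thesis using ne by (simp add: add.assoc)
qed

lemma second_pd_inner: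
  fixes A B :: "real^2 \<Rightarrow> real^3"
  assumes A: "smooth_germ A" and B: "smooth_germ B"
  shows "\<forall>\<^sub>F q in nhds 0. pd 2 (pd 2 (\<lambda>q. A q \<bullet> B q)) q
       = pd 2 (pd 2 A) q \<bullet> B q + 2 * (pd 2 A q \<bullet> pd 2 B q) + A q \<bullet> pd 2 (pd 2 B) q"
proof -
  note A' = smooth_germ_pd[OF A, of 2] and B' = smooth_germ_pd[OF B, of 2]
  show ?thesis
    using pd_cong[OF pd_inner[OF A B, of 2], of 2]
      pd_add[OF smooth_germ_inner[OF A' B] smooth_germ_inner[OF A B'], of 2]
      pd_inner[OF A' B, of 2] pd_inner[OF A B', of 2]
    by eventually_elim simp
qed

lemma third_pd_inner_0:
  fixes A B :: "real^2 \<Rightarrow> real^3"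
  assumes A: "smooth_germ A" and B: "smooth_germ B"
  shows "pd 2 (pd 2 (pd 2 (\<lambda>q. A q \<bullet> B q))) 0
       = pd 2 (pd 2 (pd 2 A)) 0 \<bullet> B 0 + 3 * (pd 2 (pd 2 A) 0 \<bullet> pd 2 B 0)
         + 3 * (pd 2 A 0 \<bullet> pd 2 (pd 2 B) 0) + A 0 \<bullet> pd 2 (pd 2 (pd 2 B)) 0"
proof -
  note A' = smooth_germ_pd[OF A, of 2] and B' = smooth_germ_pd[OF B, of 2]
  note I = pd_cong[OF pd_cong[OF pd_inner[OF A B, of 2], of 2], of 2]
  note J = pd_cong[OF pd_add[OF smooth_germ_inner[OF A' B] smooth_germ_inner[OF A B'], of 2], of 2]
  note s1 = smooth_germ_pd[OF smooth_germ_inner[OF A' B], of 2]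
    and s2 = smooth_germ_pd[OF smooth_germ_inner[OF A B'], of 2]
  show ?thesis
    using at_0[OF I] at_0[OF J] at_0[OF pd_add[OF s1 s2, of 2]]
      at_0[OF second_pd_inner[OF A' B]] at_0[OF second_pd_inner[OF A B']]
    by simp
qed

section \<open>Pure-frontal charts\<close>

text \<open>A frontal and its unit normal in adapted coordinates. The vanishing
  of \<open>n\<^sub>v\<close> on the axis is the pure-frontal condition, and the frame is only prescribed at the origin.\<close>

locale pure_frontal_chart =
  fixes g n :: "real^2 \<Rightarrow> real^3"
  assumes g: "smooth_germ g" and n: "smooth_germ n"
    and normal: "\<forall>\<^sub>F q in nhds 0. pd 1 g q \<bullet> n q = 0 \<and> pd 2 g q \<bullet> n q = 0"
    and axis_g: "\<forall>\<^sub>F q in nhds 0. q $ 2 = 0 \<longrightarrow> pd 2 g q = 0"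
    and axis_n: "\<forall>\<^sub>F q in nhds 0. q $ 2 = 0 \<longrightarrow> pd 2 n q = 0"
    and frame: "pd 1 g 0 \<bullet> pd 1 g 0 = 1" "pd 2 (pd 2 g) 0 \<bullet> pd 2 (pd 2 g) 0 = 1" "n 0 \<bullet> n 0 = 1"
      "pd 1 g 0 \<bullet> pd 2 (pd 2 g) 0 = 0"
begin

abbreviation "h \<equiv> v_quotient g"
abbreviation "n1 \<equiv> v_quotient n"

text \<open>This number is twice the \<open>v\<close>-derivative of the mean curvature at the origin. Where
  it is non-zero, the frontal is a 5/2-cuspidal edge.\<close>

definition five_halves_invariant :: real where
  "five_halves_invariant = pd 2 h 0 \<bullet> n1 0 - h 0 \<bullet> pd 2 n1 0"

lemmas h = v_quotient_smooth[OF g axis_g]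
lemmas n1 = v_quotient_smooth[OF n axis_n]

lemma h_0: "h 0 = pd 2 (pd 2 g) 0"
  by (simp add: v_quotient_def)

lemma pd_2_g_0 [simp]: "pd 2 g 0 = 0"
  using at_0[OF h(2)] by simp

lemma pd_2_n_0 [simp]: "pd 2 n 0 = 0"
  using at_0[OF n1(2)] by simp

lemma h_normal: "\<forall>\<^sub>F q in nhds 0. h q \<bullet> n q = 0"
proof (rule smooth_germ_zero_by_density[OF smooth_germ_inner[OF h(1) n]])
  show "\<forall>\<^sub>F q in nhds 0. q $ 2 \<noteq> 0 \<longrightarrow> h q \<bullet> n q = 0"
    using normal h(2) by eventually_elim auto
qed

lemma orthonormal_0:
  "pd 1 g 0 \<bullet> pd 1 g 0 = 1" "h 0 \<bullet> h 0 = 1" "n 0 \<bullet> n 0 = 1"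
  "pd 1 g 0 \<bullet> h 0 = 0" "pd 1 g 0 \<bullet> n 0 = 0" "h 0 \<bullet> n 0 = 0"
  using frame at_0[OF normal] at_0[OF h_normal] by (simp_all add: h_0)

lemma mixed_g: "\<forall>\<^sub>F q in nhds 0. pd 2 (pd 1 g) q = (q $ 2) *\<^sub>R pd 1 h q"
  using pd_commute[OF g, of 2 1] pd_cong[OF h(2), of 1] pd_1_v_scaleR[OF h(1)]
  by eventually_elim simp

lemma mixed_n: "\<forall>\<^sub>F q in nhds 0. pd 2 (pd 1 n) q = (q $ 2) *\<^sub>R pd 1 n1 q"
  using pd_commute[OF n, of 2 1] pd_cong[OF n1(2), of 1] pd_1_v_scaleR[OF n1(1)]
  by eventually_elim simp

lemma mixed_0 [simp]: "pd 2 (pd 1 g) 0 = 0" "pd 2 (pd 1 n) 0 = 0"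
  using at_0[OF mixed_g] at_0[OF mixed_n] by simp_all

lemma pd_2_h_normal_0: "pd 2 h 0 \<bullet> n 0 = 0"
proof -
  have "pd 2 (\<lambda>q. h q \<bullet> n q) 0 = 0" using at_0[OF pd_cong[OF h_normal, of 2]] by simp
  then show ?thesis using at_0[OF pd_inner[OF h(1) n, of 2]] by simp
qed

text \<open>Symmetry of the second fundamental form: both sides are minus the mixed derivative of \<open>g\<close>
  against the normal, divided by \<open>v\<close>.\<close>

lemma second_form_symmetric: "pd 1 g 0 \<bullet> n1 0 = h 0 \<bullet> pd 1 n 0"
proof -
  note gu = smooth_germ_pd[OF g, of 1]
  have "\<forall>\<^sub>F q in nhds 0. pd 1 h q \<bullet> n q + pd 1 g q \<bullet> n1 q = 0"
  proof (rule smooth_germ_zero_by_density)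
    show "smooth_germ (\<lambda>q. pd 1 h q \<bullet> n q + pd 1 g q \<bullet> n1 q)"
      by (intro smooth_germ_intros g h(1) n n1(1))
    have "\<forall>\<^sub>F q in nhds 0. pd 1 g q \<bullet> n q = 0" using normal by eventually_elim simp
    from pd_cong[OF this, of 2] pd_inner[OF gu n, of 2] mixed_g n1(2)
    show "\<forall>\<^sub>F q in nhds 0. q $ 2 \<noteq> 0 \<longrightarrow> pd 1 h q \<bullet> n q + pd 1 g q \<bullet> n1 q = 0"
      by eventually_elim (auto simp flip: distrib_left)
  qed
  from at_0[OF this] have 1: "pd 1 h 0 \<bullet> n 0 + pd 1 g 0 \<bullet> n1 0 = 0" .
  have "pd 1 (\<lambda>q. h q \<bullet> n q) 0 = 0" using at_0[OF pd_cong[OF h_normal, of 1]] by simp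
  then have "pd 1 h 0 \<bullet> n 0 + h 0 \<bullet> pd 1 n 0 = 0" using at_0[OF pd_inner[OF h(1) n, of 1]] by simp
  with 1 show ?thesis by linarith
qed

text \<open>The component along the normal vanishes because \<open>h \<bullet> n = 0\<close> and \<open>n\<^sub>v = 0\<close> at the origin.\<close>

lemma pd_2_h_0_expand:
  "pd 2 h 0 = (pd 2 h 0 \<bullet> pd 1 g 0) *\<^sub>R pd 1 g 0 + (pd 2 h 0 \<bullet> h 0) *\<^sub>R h 0"
  using inner_expand_orthonormal[OF orthonormal_0, of "pd 2 h 0"] pd_2_h_normal_0 by simp

text \<open>Let \<open>N\<close> be the gradient of \<open>Z\<close> along \<open>g\<close>, and \<open>N\<^sub>v = v N\<^sub>1\<close>. Then \<open>N\<^sub>1\<close> is the Hessian of \<open>Z\<close>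
  applied to \<open>h\<close>, and the symmetry of the Hessian gives \<open>h\<^sub>v \<bullet> N\<^sub>1 - h \<bullet> (N\<^sub>1)\<^sub>v = 0\<close> at the origin. The
  difference \<open>D = n - N\<close> contributes nothing to the invariant either: on the line \<open>u = 0\<close> its inner
  products with \<open>g\<^sub>u\<close> and \<open>h\<close> are \<open>O(v\<^sup>5)\<close> and \<open>O(v\<^sup>4)\<close>, and differentiating them up to three times at
  the origin yields the two missing equations \<open>h\<^sub>v \<bullet> D\<^sub>1 = 0\<close> and \<open>h \<bullet> (D\<^sub>1)\<^sub>v = 0\<close>.\<close>

lemma invariant_zero_of_high_contact:
  fixes Z :: "real^3 \<Rightarrow> real"
  assumes Z: "smooth_germ Z" and C: "smooth_germ C" "C 0 = 0" and g0: "g 0 = 0"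
    and Zg: "\<forall>\<^sub>F q in nhds 0. Z (g q) = (q $ 2) ^ 5 * C q"
    and grad: "frechet_derivative Z (at 0) (n 0) = 1"
  shows "five_halves_invariant = 0"
proof -
  define W where "W p = (\<Sum>b\<in>Basis. frechet_derivative Z (at p) b *\<^sub>R b)" for p
  have W: "smooth_germ W"
    unfolding W_def[abs_def]
    by (intro smooth_germ_intros Z)
  have WX: "\<forall>\<^sub>F p in nhds 0. \<forall>X. W p \<bullet> X = frechet_derivative Z (at p) X"
    using smooth_germ_has_derivative[OF Z]
  proof eventually_elim
    case (elim p)
    interpret L: bounded_linear "frechet_derivative Z (at p)"
      using elim by (rule has_derivative_bounded_linear)
    have "W p \<bullet> X = frechet_derivative Z (at p) (\<Sum>b\<in>Basis. (X \<bullet> b) *\<^sub>R b)" for X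
      by (simp only: L.sum L.scaleR) (simp add: W_def inner_sum_left inner_commute[of X] mult.commute)
    then show ?case by (simp add: euclidean_representation)
  qed
  define N where "N q = W (g q)" for q
  have N: "smooth_germ N" unfolding N_def[abs_def] by (rule smooth_germ_compose[OF W g0 g])
  have Npd: "\<forall>\<^sub>F q in nhds 0. N q \<bullet> pd i g q = pd i (\<lambda>q. (q $ 2) ^ 5 * C q) q" for i
    using pd_compose[OF Z g g0, of i] pd_cong[OF Zg, of i] eventually_compose_germ[OF g g0 WX]
    by eventually_elim (simp add: N_def)
  have Nu: "\<forall>\<^sub>F q in nhds 0. N q \<bullet> pd 1 g q = (q $ 2) ^ 5 * pd 1 C q"
  proof -
    have "\<forall>\<^sub>F q in nhds 0. pd 1 (\<lambda>q::real^2. (q $ 2) ^ m) q = 0" for m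
    proof (induction m)
      case (Suc m)
      from Suc pd_mult[OF smooth_germ_nth[of 2] smooth_germ_power[OF smooth_germ_nth[of 2], of m], of 1]
      show ?case by eventually_elim simp
    qed simp
    from this[of 5] pd_mult[OF smooth_germ_power[OF smooth_germ_nth[of 2], of 5] C(1), of 1] Npd[of 1]
    show ?thesis by eventually_elim simp
  qed
  have Nh: "\<forall>\<^sub>F q in nhds 0. N q \<bullet> h q = (q $ 2) ^ 3 * (of_nat (Suc 4) * C q + q $ 2 * pd 2 C q)"
  proof -
    have "\<forall>\<^sub>F q in nhds 0. N q \<bullet> h q - (q $ 2) ^ 3 * (of_nat (Suc 4) * C q + q $ 2 * pd 2 C q) = 0"
    proof (rule smooth_germ_zero_by_density)
      show "smooth_germ (\<lambda>q. N q \<bullet> h q - (q $ 2) ^ 3 * (of_nat (Suc 4) * C q + q $ 2 * pd 2 C q))"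
        by (intro smooth_germ_intros h(1) N C)
      show "\<forall>\<^sub>F q in nhds 0. q $ 2 \<noteq> 0 \<longrightarrow>
          N q \<bullet> h q - (q $ 2) ^ 3 * (of_nat (Suc 4) * C q + q $ 2 * pd 2 C q) = 0"
        using Npd[of 2] pd_2_v_power[OF C(1), of 4] h(2)
        by eventually_elim (auto simp: power3_eq_cube power4_eq_xxxx mult.assoc)
    qed
    then show ?thesis by eventually_elim simp
  qed
  have N0: "N 0 = n 0"
    using inner_expand_orthonormal[OF orthonormal_0, of "N 0"] at_0[OF Nu] at_0[OF Nh] at_0[OF WX] grad
    by (simp add: N_def g0)
  \<comment> \<open>the Hessian of \<open>Z\<close> applied to \<open>h\<close>; as \<open>g\<^sub>v = v h\<close>, this is \<open>N\<^sub>v / v\<close>\<close>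
  define N1 where "N1 q = (\<Sum>b\<in>Basis. (h q \<bullet> b) *\<^sub>R frechet_derivative W (at (g q)) b)" for q
  have DWs: "smooth_germ (\<lambda>q. frechet_derivative W (at (g q)) b)" for b
    by (rule smooth_germ_compose[OF smooth_germ_frechet[OF W] g0 g])
  have N1: "smooth_germ N1"
    unfolding N1_def[abs_def]
    by (intro smooth_germ_intros DWs h(1))
  have WL: "\<forall>\<^sub>F p in nhds 0. \<forall>X. frechet_derivative W (at p) X = (\<Sum>b\<in>Basis. (X \<bullet> b) *\<^sub>R frechet_derivative W (at p) b)"
    using smooth_germ_has_derivative[OF W]
  proof eventually_elim
    case (elim p)
    interpret L: bounded_linear "frechet_derivative W (at p)"
      using elim by (rule has_derivative_bounded_linear)
    have "frechet_derivative W (at p) (\<Sum>b\<in>Basis. (X \<bullet> b) *\<^sub>R b) = (\<Sum>b\<in>Basis. (X \<bullet> b) *\<^sub>R frechet_derivative W (at p) b)" for X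
      by (simp only: L.sum L.scaleR)
    then show ?case unfolding euclidean_representation by blast
  qed
  have N2: "\<forall>\<^sub>F q in nhds 0. pd 2 N q = (q $ 2) *\<^sub>R N1 q"
    using pd_compose[OF W g g0, of 2] h(2) eventually_compose_germ[OF g g0 WL]
      eventually_compose_germ[OF g g0 smooth_germ_has_derivative[OF W]]
  proof eventually_elim
    case (elim q)
    interpret L: bounded_linear "frechet_derivative W (at (g q))"
      using elim(4) by (rule has_derivative_bounded_linear)
    have "frechet_derivative W (at (g q)) (h q) = N1 q" using elim(3) unfolding N1_def by blast
    then show ?case using elim(1,2) by (simp add: N_def[abs_def] L.scaleR)
  qed
  let ?H = "frechet_derivative W (at 0)"
  have HL: "(\<Sum>b\<in>Basis. (X \<bullet> b) *\<^sub>R ?H b) = ?H X" for X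
    by (rule at_0[OF WL, rule_format, symmetric])
  have N1_0: "N1 0 = ?H (h 0)" by (simp add: N1_def g0 HL)
  have pdN1: "pd 2 N1 0 = ?H (pd 2 h 0)"
  proof -
    have z: "pd 2 (\<lambda>q. frechet_derivative W (at (g q)) b) 0 = 0" for b
    proof -
      have fr: "smooth_germ (\<lambda>p. frechet_derivative W (at p) b)" by (rule smooth_germ_frechet[OF W])
      interpret L: bounded_linear "frechet_derivative (\<lambda>p. frechet_derivative W (at p) b) (at 0)"
        using at_0[OF smooth_germ_has_derivative[OF fr]] by (rule has_derivative_bounded_linear)
      show ?thesis using at_0[OF pd_compose[OF fr g g0, of 2]] g0 L.zero by simp
    qed
    have s: "(\<lambda>q. \<Sum>b\<in>B. (h q \<bullet> b) *\<^sub>R frechet_derivative W (at (g q)) b) differentiable at 0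
        \<and> pd 2 (\<lambda>q. \<Sum>b\<in>B. (h q \<bullet> b) *\<^sub>R frechet_derivative W (at (g q)) b) 0
        = (\<Sum>b\<in>B. (pd 2 h 0 \<bullet> b) *\<^sub>R ?H b)" if "finite B" for B
      using that
    proof (induction B rule: finite_induct)
      case (insert b B)
      let ?t = "\<lambda>b q. (h q \<bullet> b) *\<^sub>R frechet_derivative W (at (g q)) b"
      have hb: "smooth_germ (\<lambda>q. h q \<bullet> b)" by (rule smooth_germ_inner[OF h(1) smooth_germ_const])
      have t: "smooth_germ (?t b')" for b'
        by (intro smooth_germ_intros DWs h(1))
      have S: "smooth_germ (\<lambda>q. \<Sum>b\<in>B. ?t b q)" by (intro smooth_germ_sum t)
      have "pd 2 (?t b) 0 = (pd 2 h 0 \<bullet> b) *\<^sub>R ?H b"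
        using at_0[OF pd_scaleR[OF hb DWs[of b], of 2]] at_0[OF pd_inner[OF h(1) smooth_germ_const[of b], of 2]] z g0
        by simp
      then show ?case
        using insert at_0[OF pd_add[OF t[of b] S, of 2]]
          at_0[OF smooth_germ_has_derivative[OF smooth_germ_add[OF t[of b] S]]]
        by (auto simp: differentiable_def)
    qed simp
    show ?thesis using s[of Basis] by (simp add: N1_def[abs_def] HL)
  qed
  have sym: "X \<bullet> ?H Y = Y \<bullet> ?H X" for X Y
  proof -
    have "Y \<bullet> ?H X = frechet_derivative (\<lambda>p. frechet_derivative Z (at p) Y) (at 0) X" for X Y
    proof -
      have "((\<lambda>p. W p \<bullet> Y) has_derivative (\<lambda>X. ?H X \<bullet> Y)) (at 0)"
        by (intro bounded_linear.has_derivative[OF bounded_linear_inner_left]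
            at_0[OF smooth_germ_has_derivative[OF W]])
      from fun_cong[OF frechet_derivative_at[OF this], of X]
      have A: "frechet_derivative (\<lambda>p. W p \<bullet> Y) (at 0) X = ?H X \<bullet> Y" by (rule sym)
      have "\<forall>\<^sub>F p in nhds 0. W p \<bullet> Y = frechet_derivative Z (at p) Y"
        using WX by eventually_elim simp
      from A[unfolded frechet_derivative_cong_nhds[OF this]] show ?thesis
        by (simp add: inner_commute)
    qed
    then show ?thesis using at_0[OF frechet_commute_germ[OF Z]] by simp
  qed
  define D where "D q = n q - N q" for q
  define D1 where "D1 q = n1 q - N1 q" for q
  have D: "smooth_germ D" unfolding D_def[abs_def] by (rule smooth_germ_diff[OF n N])
  have D1: "smooth_germ D1" unfolding D1_def[abs_def] by (rule smooth_germ_diff[OF n1(1) N1])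
  have pdD: "\<forall>\<^sub>F q in nhds 0. pd 2 D q = (q $ 2) *\<^sub>R D1 q"
    using pd_diff[OF n N, of 2] n1(2) N2
    by eventually_elim (simp add: D_def[abs_def] D1_def scaleR_diff_right)
  have ppD: "\<forall>\<^sub>F q in nhds 0. pd 2 (pd 2 D) q = D1 q + (q $ 2) *\<^sub>R pd 2 D1 q"
    using pd_cong[OF pdD, of 2] pd_2_v_scaleR[OF D1] by eventually_elim simp
  have pppD: "pd 2 (pd 2 (pd 2 D)) 0 = 2 *\<^sub>R pd 2 D1 0"
  proof -
    have s: "smooth_germ (\<lambda>q. (q $ 2) *\<^sub>R pd 2 D1 q)"
      by (intro smooth_germ_intros D1)
    show ?thesis
      using at_0[OF pd_cong[OF ppD, of 2]] at_0[OF pd_add[OF D1 s, of 2]]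
        at_0[OF pd_2_v_scaleR[OF smooth_germ_pd[OF D1, of 2]]]
      by (simp add: scaleR_2)
  qed
  have D0: "D 0 = 0" "pd 2 D 0 = 0" "pd 2 (pd 2 D) 0 = D1 0"
    using at_0[OF pdD] at_0[OF ppD] by (simp_all add: D_def N0)
  \<comment> \<open>\<open>g\<^sub>u \<bullet> D\<close> is divisible by \<open>v\<^sup>5\<close>, and its second derivative at the origin is \<open>g\<^sub>u \<bullet> D\<^sub>1\<close>\<close>
  have "pd 1 g 0 \<bullet> D1 0 = 0"
  proof -
    define X where "X q = - pd 1 C q" for q
    have X: "smooth_germ X" unfolding X_def[abs_def] by (intro smooth_germ_intros C)
    from Nu normal
    have "\<forall>\<^sub>F q in nhds 0. pd 1 g q \<bullet> D q = (q $ 2) ^ Suc 4 * X q"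
      by eventually_elim (simp add: D_def X_def inner_diff_right inner_commute)
    from pd_cong[OF this, of 2] pd_2_v_power[OF X, of 4]
    have "\<forall>\<^sub>F q in nhds 0. pd 2 (\<lambda>q. pd 1 g q \<bullet> D q) q = (q $ 2) ^ Suc 3 * (of_nat (Suc 4) * X q + q $ 2 * pd 2 X q)"
      by eventually_elim simp
    from at_0[OF pd_cong[OF this, of 2]]
      at_0[OF pd_2_v_power[of "\<lambda>q. of_nat (Suc 4) * X q + q $ 2 * pd 2 X q" 3]]
    have "pd 2 (pd 2 (\<lambda>q. pd 1 g q \<bullet> D q)) 0 = 0"
      using smooth_germ_add[OF smooth_germ_mult[OF smooth_germ_const X] smooth_germ_mult[OF smooth_germ_nth smooth_germ_pd[OF X]]]
      by simp
    then show ?thesis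
      using at_0[OF second_pd_inner[OF smooth_germ_pd[OF g, of 1] D]] D0 by simp
  qed
  define m where "m q = - (of_nat (Suc 4) * C q + q $ 2 * pd 2 C q)" for q
  have m: "smooth_germ m"
    unfolding m_def[abs_def]
    by (intro smooth_germ_intros C)
  have hD: "\<forall>\<^sub>F q in nhds 0. h q \<bullet> D q = (q $ 2) ^ Suc 2 * m q"
    using Nh h_normal
    by eventually_elim (simp add: m_def D_def inner_diff_right inner_commute algebra_simps eval_nat_numeral)
  \<comment> \<open>the \<open>v\<close>-derivatives of \<open>v\<^sup>3 m\<close> are \<open>v\<^sup>2 m1\<close> and \<open>v m2\<close>, and \<open>m2 = 6 m = - 30 C = 0\<close> at the origin\<close>
  define m1 where "m1 q = of_nat (Suc 2) * m q + q $ 2 * pd 2 m q" for q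
  define m2 where "m2 q = of_nat (Suc 1) * m1 q + q $ 2 * pd 2 m1 q" for q
  have m1: "smooth_germ m1"
    unfolding m1_def[abs_def]
    by (intro smooth_germ_intros m)
  have m2: "smooth_germ m2"
    unfolding m2_def[abs_def]
    by (intro smooth_germ_intros m1)
  have e1: "\<forall>\<^sub>F q in nhds 0. pd 2 (\<lambda>q. h q \<bullet> D q) q = (q $ 2) ^ Suc 1 * m1 q"
    using pd_cong[OF hD, of 2] pd_2_v_power[OF m, of 2] by eventually_elim (simp add: m1_def power2_eq_square)
  have e2: "\<forall>\<^sub>F q in nhds 0. pd 2 (pd 2 (\<lambda>q. h q \<bullet> D q)) q = (q $ 2) ^ Suc 0 * m2 q"
    using pd_cong[OF e1, of 2] pd_2_v_power[OF m1, of 1] by eventually_elim (simp add: m2_def)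
  have e3: "pd 2 (pd 2 (pd 2 (\<lambda>q. h q \<bullet> D q))) 0 = 0"
    using at_0[OF pd_cong[OF e2, of 2]] at_0[OF pd_2_v_power[OF m2, of 0]]
    by (simp add: m2_def m1_def m_def C)
  have "h 0 \<bullet> D1 0 = 0"
    using at_0[OF e2] at_0[OF second_pd_inner[OF h(1) D]] D0 by simp
  with \<open>pd 1 g 0 \<bullet> D1 0 = 0\<close> have hD1: "pd 2 h 0 \<bullet> D1 0 = 0"
    using pd_2_h_0_expand by (metis (no_types, lifting) add.right_neutral inner_add_left inner_scaleR_left mult_zero_right)
  have "h 0 \<bullet> pd 2 D1 0 = 0"
    using e3 third_pd_inner_0[OF h(1) D] D0 pppD hD1 by simp
  moreover have "pd 2 D1 0 = pd 2 n1 0 - pd 2 N1 0"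
    using at_0[OF pd_diff[OF n1(1) N1, of 2]] by (simp add: D1_def[abs_def])
  ultimately show ?thesis
    using hD1 sym[of "pd 2 h 0" "h 0"]
    by (simp add: five_halves_invariant_def D1_def N1_0 pdN1 inner_diff_right)
qed

end

section \<open>Curvatures and focal surfaces\<close>

context pure_frontal_chart
begin

lemma smooth_coefficients:
  "smooth_germ (E_t g)" "smooth_germ (F_t g)" "smooth_germ (G_t g)"
  "smooth_germ (L_t g n)" "smooth_germ (M_t g n)" "smooth_germ (N1_t g n)"
  unfolding E_t_def[abs_def] F_t_def[abs_def] G_t_def[abs_def] L_t_def[abs_def] M_t_def[abs_def] N1_t_def[abs_def]
  by (intro smooth_germ_intros g n h(1) n1(1))+

lemma coefficients_0: "E_t g 0 = 1" "F_t g 0 = 0" "G_t g 0 = 1"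
  using orthonormal_0 by (simp_all add: E_t_def F_t_def G_t_def)

lemma pd_2_coefficients_0:
  "pd 2 (E_t g) 0 = 0" "pd 2 (F_t g) 0 = pd 2 h 0 \<bullet> pd 1 g 0" "pd 2 (G_t g) 0 = 2 * (pd 2 h 0 \<bullet> h 0)"
  "pd 2 (L_t g n) 0 = 0" "pd 2 (M_t g n) 0 = - (pd 2 h 0 \<bullet> pd 1 n 0)"
  "pd 2 (N1_t g n) 0 = five_halves_invariant - 2 * (pd 2 h 0 \<bullet> n1 0)"
proof -
  note gu = smooth_germ_pd[OF g, of 1] and nu = smooth_germ_pd[OF n, of 1]
  show "pd 2 (E_t g) 0 = 0"
    using at_0[OF pd_inner[OF gu gu, of 2]] by (simp add: E_t_def[abs_def])
  show "pd 2 (F_t g) 0 = pd 2 h 0 \<bullet> pd 1 g 0"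
    using at_0[OF pd_inner[OF gu h(1), of 2]] by (simp add: F_t_def[abs_def] inner_commute)
  show "pd 2 (G_t g) 0 = 2 * (pd 2 h 0 \<bullet> h 0)"
    using at_0[OF pd_inner[OF h(1) h(1), of 2]] by (simp add: G_t_def[abs_def] inner_commute)
  show "pd 2 (L_t g n) 0 = 0"
    using at_0[OF pd_inner[OF gu nu, of 2]] at_0[OF pd_minus[OF smooth_germ_inner[OF gu nu], of 2]]
    by (simp add: L_t_def[abs_def])
  show "pd 2 (M_t g n) 0 = - (pd 2 h 0 \<bullet> pd 1 n 0)"
    using at_0[OF pd_inner[OF h(1) nu, of 2]] at_0[OF pd_minus[OF smooth_germ_inner[OF h(1) nu], of 2]]
    by (simp add: M_t_def[abs_def])
  show "pd 2 (N1_t g n) 0 = five_halves_invariant - 2 * (pd 2 h 0 \<bullet> n1 0)"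
    using at_0[OF pd_inner[OF h(1) n1(1), of 2]] at_0[OF pd_minus[OF smooth_germ_inner[OF h(1) n1(1)], of 2]]
    by (simp add: N1_t_def[abs_def] five_halves_invariant_def)
qed

text \<open>The Weingarten relations needed for \<open>M\<^sub>v\<close> and \<open>(N\<^sub>1)\<^sub>v\<close>, from the expansion of \<open>h\<^sub>v\<close> in the
  orthonormal frame.\<close>

lemma pd_2_h_second_form_0:
  "pd 2 h 0 \<bullet> pd 1 n 0 = - (pd 2 h 0 \<bullet> pd 1 g 0) * L_t g n 0 - (pd 2 h 0 \<bullet> h 0) * M_t g n 0"
  "pd 2 h 0 \<bullet> n1 0 = - (pd 2 h 0 \<bullet> pd 1 g 0) * M_t g n 0 - (pd 2 h 0 \<bullet> h 0) * N1_t g n 0"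
proof -
  have e: "pd 2 h 0 \<bullet> X = (pd 2 h 0 \<bullet> pd 1 g 0) * (pd 1 g 0 \<bullet> X) + (pd 2 h 0 \<bullet> h 0) * (h 0 \<bullet> X)" for X
    by (subst pd_2_h_0_expand) (simp only: inner_add_left inner_scaleR_left)
  show "pd 2 h 0 \<bullet> pd 1 n 0 = - (pd 2 h 0 \<bullet> pd 1 g 0) * L_t g n 0 - (pd 2 h 0 \<bullet> h 0) * M_t g n 0"
    by (subst e) (simp add: L_t_def M_t_def)
  show "pd 2 h 0 \<bullet> n1 0 = - (pd 2 h 0 \<bullet> pd 1 g 0) * M_t g n 0 - (pd 2 h 0 \<bullet> h 0) * N1_t g n 0"
    by (subst e) (simp add: M_t_def N1_t_def second_form_symmetric)
qed

lemma smooth_curvatures: "smooth_germ (gauss_curvature g n)" "smooth_germ (mean_curvature g n)"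
proof -
  let ?W = "\<lambda>q. E_t g q * G_t g q - (F_t g q)\<^sup>2"
  have W: "smooth_germ ?W"
    by (intro smooth_germ_intros smooth_coefficients)
  have W0: "?W 0 = 1" by (simp add: coefficients_0)
  show "smooth_germ (gauss_curvature g n)"
    unfolding gauss_curvature_def[abs_def] divide_inverse
    by (intro smooth_germ_intros smooth_germ_inverse[OF W] smooth_coefficients)
       (simp add: W0)
  have W2: "smooth_germ (\<lambda>q. 2 * ?W q)" by (intro smooth_germ_intros W)
  show "smooth_germ (mean_curvature g n)"
    unfolding mean_curvature_def[abs_def] divide_inverse
    by (intro smooth_germ_intros smooth_germ_inverse[OF W2] smooth_coefficients)
       (simp add: W0)
qed

text \<open>At the origin \<open>E = G = 1\<close> and \<open>F = E\<^sub>v = L\<^sub>v = 0\<close>. With \<open>a = h\<^sub>v \<bullet> g\<^sub>u\<close>, \<open>b = h\<^sub>v \<bullet> h\<close> and a vanishing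
  invariant one has \<open>F\<^sub>v = a\<close>, \<open>G\<^sub>v = 2 b\<close>, \<open>M\<^sub>v = a L + b M\<close> and \<open>(N\<^sub>1)\<^sub>v = 2 (a M + b N\<^sub>1)\<close>, and all
  terms of \<open>K\<^sub>v\<close> and \<open>H\<^sub>v\<close> cancel.\<close>

lemma pd_2_curvatures_0:
  assumes "five_halves_invariant = 0"
  shows "pd 2 (gauss_curvature g n) 0 = 0" "pd 2 (mean_curvature g n) 0 = 0"
proof -
  have line: "((\<lambda>y. F (vector [0, y])) has_real_derivative pd 2 F 0) (at 0)"
    if "smooth_germ F" for F :: "real^2 \<Rightarrow> real"
    using has_real_derivative_pd(2)[OF at_0[OF smooth_germ_has_derivative[OF that]]] by simp
  let ?l = "\<lambda>F y. F (vector [0, y] :: real^2) :: real"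
  let ?a = "pd 2 h 0 \<bullet> pd 1 g 0" and ?b = "pd 2 h 0 \<bullet> h 0"
  let ?L = "L_t g n 0" and ?M = "M_t g n 0" and ?N = "N1_t g n 0"
  note dE = line[OF smooth_coefficients(1)] and dF = line[OF smooth_coefficients(2)]
    and dG = line[OF smooth_coefficients(3)] and dL = line[OF smooth_coefficients(4)]
    and dM = line[OF smooth_coefficients(5)] and dN = line[OF smooth_coefficients(6)]
  note vals = pd_2_coefficients_0 coefficients_0 assms pd_2_h_second_form_0
  have "((\<lambda>y. ?l (gauss_curvature g n) y) has_real_derivative 0) (at 0)"
    unfolding gauss_curvature_def
    by (rule derivative_eq_intros dE dF dG dL dM dN refl)+
       (simp_all add: vals power2_eq_square algebra_simps)
  with line[OF smooth_curvatures(1)] show "pd 2 (gauss_curvature g n) 0 = 0" by (rule DERIV_unique)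
  have "((\<lambda>y. ?l (mean_curvature g n) y) has_real_derivative 0) (at 0)"
    unfolding mean_curvature_def
    by (rule derivative_eq_intros dE dF dG dL dM dN refl)+
       (simp_all add: vals power2_eq_square algebra_simps)
  with line[OF smooth_curvatures(2)] show "pd 2 (mean_curvature g n) 0 = 0" by (rule DERIV_unique)
qed

lemma discriminant_pos:
  assumes "M_t g n 0 \<noteq> 0"
  shows "(mean_curvature g n 0)\<^sup>2 - gauss_curvature g n 0 > 0"
proof -
  have "(mean_curvature g n 0)\<^sup>2 - gauss_curvature g n 0
      = ((N1_t g n 0 - L_t g n 0) / 2)\<^sup>2 + (M_t g n 0)\<^sup>2"
    by (simp add: mean_curvature_def gauss_curvature_def coefficients_0 power2_eq_square field_simps)
  also have "\<dots> > 0" using assms by (simp add: add_nonneg_pos)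
  finally show ?thesis .
qed

text \<open>Since \<open>g\<^sub>v\<close>, \<open>n\<^sub>v\<close> and \<open>\<kappa>\<^sub>v\<close> vanish at the origin, \<open>\<partial>\<^sub>v\<close> is a null direction of the focal
  surface.\<close>

lemma focal_surface_singular:
  assumes \<kappa>: "(\<kappa> has_derivative \<kappa>') (at 0)" "\<kappa>' (axis 2 1) = 0" "\<kappa> 0 \<noteq> 0"
  shows "singular_point (focal_surface \<kappa> g n) 0"
proof -
  let ?C = "focal_surface \<kappa> g n"
  let ?D = "\<lambda>X. frechet_derivative g (at 0) X + ((1 / \<kappa> 0) *\<^sub>R frechet_derivative n (at 0) X
      + (- (inverse (\<kappa> 0) * \<kappa>' X * inverse (\<kappa> 0))) *\<^sub>R n 0)"
  note dg = at_0[OF smooth_germ_has_derivative[OF g]] and dn = at_0[OF smooth_germ_has_derivative[OF n]]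
  have "((\<lambda>q. 1 / \<kappa> q) has_derivative (\<lambda>X. - (inverse (\<kappa> 0) * \<kappa>' X * inverse (\<kappa> 0)))) (at 0)"
    using Deriv.has_derivative_inverse[OF \<kappa>(3) \<kappa>(1)] by (simp add: divide_inverse)
  then have C: "(?C has_derivative ?D) (at 0)"
    unfolding focal_surface_def[abs_def] by (intro has_derivative_add dg has_derivative_scaleR dn)
  have "?D (axis 2 1) = 0"
    using pd_2_g_0 pd_2_n_0 \<kappa>(2) by (simp add: pd_def)
  then have "frechet_derivative ?C (at 0) (axis 2 1) = 0"
    using fun_cong[OF frechet_derivative_at[OF C], of "axis 2 1"] by simp
  moreover have "bounded_linear (frechet_derivative ?C (at 0))"
    using C frechet_derivative_at[OF C] has_derivative_bounded_linear by metis
  ultimately have "jacobian ?C (at 0) *v axis 2 1 = 0"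
    using fun_cong[OF matrix_vector_mul(3)[of "frechet_derivative ?C (at 0)"], of "axis 2 1"]
    by (simp add: jacobian_def)
  moreover have "axis 2 1 \<noteq> (0 :: real^2)" by (simp add: axis_eq_0_iff)
  ultimately have "rank (jacobian ?C (at 0)) < CARD(2)"
    unfolding less_rank_noninjective inj_def by (metis matrix_vector_mult_0_right)
  moreover have "?C differentiable (at 0)" using C by (auto simp: differentiable_def)
  ultimately show ?thesis by (simp add: singular_point_def)
qed

lemma focal_surfaces_singular:
  assumes T: "five_halves_invariant = 0" and M: "M_t g n 0 \<noteq> 0"
    and \<kappa>: "principal_curvature_1 g n 0 \<noteq> 0" "principal_curvature_2 g n 0 \<noteq> 0"
  shows "singular_point (focal_surface (principal_curvature_1 g n) g n) 0"
    and "singular_point (focal_surface (principal_curvature_2 g n) g n) 0"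
proof -
  let ?H = "mean_curvature g n" and ?K = "gauss_curvature g n"
  note dH = at_0[OF smooth_germ_has_derivative[OF smooth_curvatures(2)]]
    and dK = at_0[OF smooth_germ_has_derivative[OF smooth_curvatures(1)]]
  have z: "frechet_derivative ?H (at 0) (axis 2 1) = 0" "frechet_derivative ?K (at 0) (axis 2 1) = 0"
    using pd_2_curvatures_0[OF T] by (simp_all add: pd_def)
  have "((\<lambda>q. (?H q)\<^sup>2 - ?K q) has_derivative
      (\<lambda>X. 2 * ?H 0 * frechet_derivative ?H (at 0) X - frechet_derivative ?K (at 0) X)) (at 0)"
    by (rule derivative_eq_intros dH dK refl)+ (simp add: algebra_simps)
  from has_derivative_real_sqrt[OF discriminant_pos[OF M] this]
  obtain S' where S: "((\<lambda>q. sqrt ((?H q)\<^sup>2 - ?K q)) has_derivative S') (at 0)" "S' (axis 2 1) = 0"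
    using z by fastforce
  have "(principal_curvature_1 g n has_derivative (\<lambda>X. frechet_derivative ?H (at 0) X + S' X)) (at 0)"
    unfolding principal_curvature_1_def[abs_def] by (rule has_derivative_add[OF dH S(1)])
  from focal_surface_singular[OF this _ \<kappa>(1)]
  show "singular_point (focal_surface (principal_curvature_1 g n) g n) 0" by (simp add: z S)
  have "(principal_curvature_2 g n has_derivative (\<lambda>X. frechet_derivative ?H (at 0) X - S' X)) (at 0)"
    unfolding principal_curvature_2_def[abs_def] by (rule has_derivative_diff[OF dH S(1)])
  from focal_surface_singular[OF this _ \<kappa>(2)]
  show "singular_point (focal_surface (principal_curvature_2 g n) g n) 0" by (simp add: z S)
qed

end

section \<open>The normal form of 5/2-cuspidal edges\<close>

lemma diffeo_germ_inverse:
  assumes "diffeo_germ \<xi>"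
  obtains \<theta> where "diffeo_germ \<theta>" "smooth_germ \<theta>" "\<theta> 0 = 0"
    "\<forall>\<^sub>F p in nhds 0. \<xi> (\<theta> p) = p" "\<forall>\<^sub>F q in nhds 0. \<theta> (\<xi> q) = q"
  using assms unfolding diffeo_germ_def by metis

lemma diffeo_germ_compose:
  assumes a: "diffeo_germ \<alpha>" and b: "diffeo_germ \<beta>"
  shows "diffeo_germ (\<lambda>x. \<alpha> (\<beta> x))"
proof -
  obtain \<alpha>' where a': "smooth_germ \<alpha>'" "\<alpha>' 0 = 0"
    "\<forall>\<^sub>F p in nhds 0. \<alpha> (\<alpha>' p) = p" "\<forall>\<^sub>F q in nhds 0. \<alpha>' (\<alpha> q) = q"
    by (rule diffeo_germ_inverse[OF a])
  obtain \<beta>' where b': "smooth_germ \<beta>'" "\<beta>' 0 = 0"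
    "\<forall>\<^sub>F p in nhds 0. \<beta> (\<beta>' p) = p" "\<forall>\<^sub>F q in nhds 0. \<beta>' (\<beta> q) = q"
    by (rule diffeo_germ_inverse[OF b])
  have s: "smooth_germ \<alpha>" "\<alpha> 0 = 0" "smooth_germ \<beta>" "\<beta> 0 = 0"
    using a b by (auto simp: diffeo_germ_def)
  show ?thesis unfolding diffeo_germ_def
  proof (intro conjI exI)
    show "smooth_germ (\<lambda>x. \<alpha> (\<beta> x))" by (rule smooth_germ_compose[OF s(1,4,3)])
    show "smooth_germ (\<lambda>x. \<beta>' (\<alpha>' x))" by (rule smooth_germ_compose[OF b'(1) a'(2,1)])
    show "\<forall>\<^sub>F x in nhds 0. \<beta>' (\<alpha>' (\<alpha> (\<beta> x))) = x"
      using eventually_compose_germ[OF s(3,4) a'(4)] b'(4) by eventually_elim simp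
    show "\<forall>\<^sub>F x in nhds 0. \<alpha> (\<beta> (\<beta>' (\<alpha>' x))) = x"
      using eventually_compose_germ[OF a'(1,2) b'(3)] a'(3) by eventually_elim simp
  qed (simp_all add: s a' b')
qed

lemma frechet_eq_pd:
  fixes F :: "real^2 \<Rightarrow> 'b::real_normed_vector"
  assumes "(F has_derivative frechet_derivative F (at q)) (at q)"
  shows "frechet_derivative F (at q) X = X $ 1 *\<^sub>R pd 1 F q + X $ 2 *\<^sub>R pd 2 F q"
proof -
  interpret L: bounded_linear "frechet_derivative F (at q)"
    using assms by (rule has_derivative_bounded_linear)
  have "X = X $ 1 *\<^sub>R axis 1 1 + X $ 2 *\<^sub>R axis 2 1"
    by (simp add: vec_eq_iff forall_2 axis_def)
  then have "frechet_derivative F (at q) X = frechet_derivative F (at q) (X $ 1 *\<^sub>R axis 1 1 + X $ 2 *\<^sub>R axis 2 1)"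
    by simp
  then show ?thesis by (simp only: L.add L.scaleR pd_def)
qed

lemma pd_compose_plane:
  fixes F :: "real^2 \<Rightarrow> 'b::euclidean_space" and \<theta> :: "real^2 \<Rightarrow> real^2"
  assumes F: "smooth_germ F" and \<theta>: "smooth_germ \<theta>" "\<theta> 0 = 0"
  shows "\<forall>\<^sub>F p in nhds 0. pd i (\<lambda>p. F (\<theta> p)) p
    = (pd i \<theta> p $ 1) *\<^sub>R pd 1 F (\<theta> p) + (pd i \<theta> p $ 2) *\<^sub>R pd 2 F (\<theta> p)"
  using pd_compose[OF F \<theta>, of i] eventually_compose_germ[OF \<theta> smooth_germ_has_derivative[OF F]]
  by eventually_elim (simp add: frechet_eq_pd)

lemma pd_nth_compose:
  fixes \<theta> :: "real^2 \<Rightarrow> real^2"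
  assumes \<theta>: "smooth_germ \<theta>"
  shows "\<forall>\<^sub>F p in nhds 0. pd i (\<lambda>p. \<theta> p $ j) p = pd i \<theta> p $ j"
  using smooth_germ_has_derivative[OF \<theta>]
proof eventually_elim
  case (elim p)
  from frechet_derivative_at[OF bounded_linear.has_derivative[OF bounded_linear_vec_nth[of j] elim], symmetric]
  show ?case by (simp add: pd_def)
qed

lemma diffeo_germ_vector2:
  fixes a b :: "real^2 \<Rightarrow> real"
  assumes ab: "smooth_germ a" "smooth_germ b" "a 0 = 0" "b 0 = 0"
    and det: "pd 1 a 0 * pd 2 b 0 - pd 2 a 0 * pd 1 b 0 \<noteq> 0"
  shows "diffeo_germ (\<lambda>q. vector [a q, b q] :: real^2)"
proof (rule diffeo_germ_if_invertible_derivative)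
  let ?F = "\<lambda>q. vector [a q, b q] :: real^2"
  show F: "smooth_germ ?F" by (rule smooth_germ_vector2[OF ab(1,2)])
  show "?F 0 = 0" using ab vector_2_eta[of "0 :: real^2"] by simp
  fix X assume X: "frechet_derivative ?F (at 0) X = 0"
  have c: "pd i ?F 0 $ 1 = pd i a 0" "pd i ?F 0 $ 2 = pd i b 0" for i
    using at_0[OF pd_nth_compose[OF F, of i 1]] at_0[OF pd_nth_compose[OF F, of i 2]] by simp_all
  have "X $ 1 *\<^sub>R pd 1 ?F 0 + X $ 2 *\<^sub>R pd 2 ?F 0 = 0"
    using frechet_eq_pd[OF at_0[OF smooth_germ_has_derivative[OF F]]] X by simp
  then have "(X $ 1 *\<^sub>R pd 1 ?F 0 + X $ 2 *\<^sub>R pd 2 ?F 0) $ 1 = 0"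
    "(X $ 1 *\<^sub>R pd 1 ?F 0 + X $ 2 *\<^sub>R pd 2 ?F 0) $ 2 = 0" by simp_all
  then have e: "X $ 1 * pd 1 a 0 + X $ 2 * pd 2 a 0 = 0" "X $ 1 * pd 1 b 0 + X $ 2 * pd 2 b 0 = 0"
    by (simp_all add: c)
  have "X $ 1 * (pd 1 a 0 * pd 2 b 0 - pd 2 a 0 * pd 1 b 0) = 0"
    "X $ 2 * (pd 1 a 0 * pd 2 b 0 - pd 2 a 0 * pd 1 b 0) = 0"
    using e by algebra+
  then show "X = 0" using det by (simp add: vec_eq_iff forall_2)
qed

definition flip2 :: "real^2 \<Rightarrow> real^2" where "flip2 p = vector [p $ 1, - p $ 2]"

lemma flip2_simps [simp]: "flip2 p $ 1 = p $ 1" "flip2 p $ 2 = - p $ 2" "flip2 (flip2 p) = p" "flip2 0 = 0"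
  by (simp_all add: flip2_def vec_eq_iff forall_2)

lemma flip2_axis: "p $ 2 = 0 \<Longrightarrow> flip2 p = p"
  by (simp add: flip2_def vec_eq_iff forall_2)

lemma smooth_germ_flip2: "smooth_germ flip2"
  unfolding flip2_def[abs_def] by (intro smooth_germ_intros)

lemma pd_2_flip2:
  fixes F :: "real^2 \<Rightarrow> real"
  assumes F: "smooth_germ F"
  shows "\<forall>\<^sub>F p in nhds 0. pd 2 (\<lambda>p. F (flip2 p)) p = - pd 2 F (flip2 p)"
proof -
  have n: "\<forall>\<^sub>F p in nhds 0. pd 2 flip2 p $ 1 = 0" "\<forall>\<^sub>F p in nhds 0. pd 2 flip2 p $ 2 = -1"
    using pd_nth_compose[OF smooth_germ_flip2, of 2 1] pd_nth_compose[OF smooth_germ_flip2, of 2 2]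
      pd_minus[OF smooth_germ_nth[of 2], of 2]
    by (simp, eventually_elim) simp
  show ?thesis
    using pd_compose_plane[OF F smooth_germ_flip2 flip2_simps(4), of 2] n
    by eventually_elim simp
qed

definition square2 :: "real^2 \<Rightarrow> real^2" where "square2 p = vector [p $ 1, (p $ 2)\<^sup>2]"

lemma square2_simps [simp]: "square2 p $ 1 = p $ 1" "square2 p $ 2 = (p $ 2)\<^sup>2" "square2 0 = 0"
  by (simp_all add: square2_def vec_eq_iff forall_2)

lemma square2_axis: "p $ 2 = 0 \<Longrightarrow> square2 p = p"
  by (simp add: square2_def vec_eq_iff forall_2)

lemma smooth_germ_square2: "smooth_germ square2"
  unfolding square2_def[abs_def] by (intro smooth_germ_intros)

lemma hadamard_germ_real:
  fixes F :: "real^2 \<Rightarrow> real"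
  assumes F: "smooth_germ F" and zero: "\<forall>\<^sub>F q in nhds 0. q $ 2 = 0 \<longrightarrow> F q = 0"
  obtains G where "smooth_germ G" "\<forall>\<^sub>F q in nhds 0. F q = q $ 2 * G q"
  using hadamard_germ[OF assms] by auto

lemma pd_2_v_mult:
  fixes F :: "real^2 \<Rightarrow> real"
  assumes "smooth_germ F"
  shows "\<forall>\<^sub>F q in nhds 0. pd 2 (\<lambda>q. q $ 2 * F q) q = F q + q $ 2 * pd 2 F q"
  using pd_mult[OF smooth_germ_nth[of 2] assms, of 2] by eventually_elim simp

text \<open>The even part of \<open>k\<close> is handled by Whitney's theorem. The odd part is \<open>v\<close> times an even function,
  again a smooth function of \<open>v\<^sup>2\<close>. Its \<open>v\<close>-derivative is \<open>v\<close> times the odd function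
  \<open>m(u, v) - m(u, - v)\<close>, whose linear term vanishes by assumption, so the derivative is divisible by \<open>v\<^sup>3\<close>.
  This excludes the terms \<open>v\<close> and \<open>v\<^sup>3\<close> from the odd part.\<close>

lemma fifth_order_decomposition:
  fixes k m :: "real^2 \<Rightarrow> real"
  assumes k: "smooth_germ k" and m: "smooth_germ m"
    and km: "\<forall>\<^sub>F p in nhds 0. pd 2 k p = 2 * p $ 2 * m p"
    and max: "\<forall>\<^sub>F p in nhds 0. p $ 2 = 0 \<longrightarrow> pd 2 m p = 0"
  obtains a c where "smooth_germ a" "smooth_germ c"
    "\<forall>\<^sub>F p in nhds 0. k p = a (square2 p) + (p $ 2) ^ 5 * c (square2 p)"
proof -
  note fl = smooth_germ_flip2 flip2_simps(4)
  note sq = smooth_germ_square2 square2_simps(3)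
  have kf: "smooth_germ (\<lambda>p. k (flip2 p))" by (rule smooth_germ_compose[OF k fl(2,1)])
  have mf: "smooth_germ (\<lambda>p. m (flip2 p))" by (rule smooth_germ_compose[OF m fl(2,1)])
  define ke where "ke p = (1 / 2) * (k p + k (flip2 p))" for p
  define ko where "ko p = (1 / 2) * (k p - k (flip2 p))" for p
  have ke: "smooth_germ ke" unfolding ke_def[abs_def] by (intro smooth_germ_intros k kf)
  have ko: "smooth_germ ko" unfolding ko_def[abs_def] by (intro smooth_germ_intros k kf)
  obtain a where a: "smooth_germ a" "\<forall>\<^sub>F p in nhds 0. ke p = a (square2 p)"
    unfolding square2_def
    by (rule whitney_even[OF ke]) (auto simp: ke_def simp flip: flip2_def)
  obtain b0 where b0: "smooth_germ b0" "\<forall>\<^sub>F p in nhds 0. ko p = p $ 2 * b0 p"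
    by (rule hadamard_germ_real[OF ko]) (simp add: ko_def flip2_axis)
  have "\<forall>\<^sub>F p in nhds 0. b0 (flip2 p) = b0 p"
    using b0(2) eventually_compose_germ[OF fl b0(2)]
  proof eventually_elim
    case (elim p)
    have "ko (flip2 p) = - ko p" by (simp add: ko_def algebra_simps)
    then show ?case using elim by (cases "p $ 2 = 0") (auto simp: flip2_axis)
  qed
  then have "\<forall>\<^sub>F p in nhds 0. b0 (vector [p $ 1, - p $ 2]) = b0 p" by (simp add: flip2_def)
  then obtain b where b: "smooth_germ b" "\<forall>\<^sub>F p in nhds 0. b0 p = b (square2 p)"
    unfolding square2_def by (rule whitney_even[OF b0(1)])
  \<comment> \<open>\<open>d = v\<^sup>2 d2\<close>, hence the derivative \<open>v d\<close> of the odd part has a zero of order three\<close>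
  define d where "d p = m p - m (flip2 p)" for p
  have d: "smooth_germ d" unfolding d_def[abs_def] by (rule smooth_germ_diff[OF m mf])
  have kod: "\<forall>\<^sub>F p in nhds 0. pd 2 ko p = p $ 2 * d p"
    using pd_mult[OF smooth_germ_const[of "1/2"] smooth_germ_diff[OF k kf], of 2] pd_diff[OF k kf, of 2]
      pd_2_flip2[OF k] km eventually_compose_germ[OF fl km]
    by eventually_elim (simp add: ko_def[abs_def] d_def algebra_simps)
  obtain d1 where d1: "smooth_germ d1" "\<forall>\<^sub>F p in nhds 0. d p = p $ 2 * d1 p"
    by (rule hadamard_germ_real[OF d]) (simp add: d_def flip2_axis)
  have "\<forall>\<^sub>F p in nhds 0. p $ 2 = 0 \<longrightarrow> d1 p = 0"
    using pd_cong[OF d1(2), of 2] pd_2_v_mult[OF d1(1)] pd_diff[OF m mf, of 2] pd_2_flip2[OF m] max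
      eventually_compose_germ[OF fl max]
    by eventually_elim (auto simp: d_def[abs_def] flip2_axis)
  then obtain d2 where d2: "smooth_germ d2" "\<forall>\<^sub>F p in nhds 0. d1 p = p $ 2 * d2 p"
    by (rule hadamard_germ_real[OF d1(1)])
  have "\<forall>\<^sub>F p in nhds 0. p $ 2 = 0 \<longrightarrow> b p = 0"
    using pd_cong[OF b0(2), of 2] pd_2_v_mult[OF b0(1)] kod b(2)
    by eventually_elim (auto simp: square2_axis)
  then obtain b1 where b1: "smooth_germ b1" "\<forall>\<^sub>F p in nhds 0. b p = p $ 2 * b1 p"
    by (rule hadamard_germ_real[OF b(1)])
  define B1 where "B1 p = b1 (square2 p)" for p
  have B1: "smooth_germ B1" unfolding B1_def[abs_def] by (rule smooth_germ_compose[OF b1(1) sq(2,1)])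
  have koB: "\<forall>\<^sub>F p in nhds 0. ko p = (p $ 2) ^ Suc 2 * B1 p"
    using b0(2) b(2) eventually_compose_germ[OF sq b1(2)]
    by eventually_elim (simp add: B1_def eval_nat_numeral)
  have "\<forall>\<^sub>F p in nhds 0. 3 * B1 p + p $ 2 * pd 2 B1 p - p $ 2 * d2 p = 0"
  proof (rule smooth_germ_zero_by_density)
    show "smooth_germ (\<lambda>p. 3 * B1 p + p $ 2 * pd 2 B1 p - p $ 2 * d2 p)"
      by (intro smooth_germ_intros B1 d2(1))
    show "\<forall>\<^sub>F p in nhds 0. p $ 2 \<noteq> 0 \<longrightarrow> 3 * B1 p + p $ 2 * pd 2 B1 p - p $ 2 * d2 p = 0"
      using pd_cong[OF koB, of 2] pd_2_v_power[OF B1, of 2] kod d1(2) d2(2)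
    proof eventually_elim
      case (elim p)
      have "(p $ 2)\<^sup>2 * (3 * B1 p + p $ 2 * pd 2 B1 p - p $ 2 * d2 p) = 0"
        using elim by (simp add: power2_eq_square algebra_simps)
      then show ?case by auto
    qed
  qed
  then have "\<forall>\<^sub>F p in nhds 0. p $ 2 = 0 \<longrightarrow> b1 p = 0"
    by eventually_elim (auto simp: B1_def square2_axis)
  then obtain c where c: "smooth_germ c" "\<forall>\<^sub>F p in nhds 0. b1 p = p $ 2 * c p"
    by (rule hadamard_germ_real[OF b1(1)])
  have "\<forall>\<^sub>F p in nhds 0. k p = a (square2 p) + (p $ 2) ^ 5 * c (square2 p)"
    using a(2) koB eventually_compose_germ[OF sq c(2)]
  proof eventually_elim
    case (elim p)
    have "k p = ke p + ko p" by (simp add: ke_def ko_def field_simps)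
    then show ?case using elim by (simp add: B1_def eval_nat_numeral)
  qed
  with a(1) c(1) show ?thesis by (rule that)
qed

lemma smooth_germ_vector3:
  assumes "smooth_germ a" "smooth_germ b" "smooth_germ c"
  shows "smooth_germ (\<lambda>x. vector [a x, b x, c x] :: real^3)"
proof (rule smooth_germ_vec)
  show "smooth_germ (\<lambda>x. (vector [a x, b x, c x] :: real^3) $ i)" for i
    using assms exhaust_3[of i] by auto
qed

text \<open>Triangular maps have an explicit inverse, where the last coordinate is divided by \<open>c\<close>.\<close>

lemma diffeo_germ_triangular:
  fixes e1 e2 e3 :: "real^3" and \<beta> :: "real \<Rightarrow> real" and a c :: "real^2 \<Rightarrow> real"
  assumes on: "e1 \<bullet> e1 = 1" "e2 \<bullet> e2 = 1" "e3 \<bullet> e3 = 1" "e1 \<bullet> e2 = 0" "e1 \<bullet> e3 = 0" "e2 \<bullet> e3 = 0"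
    and \<beta>: "smooth_germ \<beta>" "\<beta> 0 = 0" and a: "smooth_germ a" "a 0 = 0" and c: "smooth_germ c" "c 0 \<noteq> 0"
  shows "diffeo_germ (\<lambda>p::real^3. p $ 1 *\<^sub>R e1 + (\<beta> (p $ 1) + p $ 2) *\<^sub>R e2
    + (a (vector [p $ 1, p $ 2]) + p $ 3 * c (vector [p $ 1, p $ 2])) *\<^sub>R e3)"
    (is "diffeo_germ ?\<Phi>")
proof -
  let ?l = "\<lambda>p::real^3. vector [p $ 1, p $ 2] :: real^2"
  let ?m = "\<lambda>x::real^3. vector [x \<bullet> e1, x \<bullet> e2 - \<beta> (x \<bullet> e1)] :: real^2"
  let ?\<Psi> = "\<lambda>x::real^3. vector [x \<bullet> e1, x \<bullet> e2 - \<beta> (x \<bullet> e1), (x \<bullet> e3 - a (?m x)) * inverse (c (?m x))] :: real^3"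
  have in1: "smooth_germ (\<lambda>x::real^3. x \<bullet> e)" for e
    by (intro smooth_germ_bounded_linear bounded_linear_inner_left)
  have l: "smooth_germ ?l" "?l 0 = 0" by (auto intro: smooth_germ_vector2 smooth_germ_nth)
  have \<beta>1: "smooth_germ (\<lambda>x::real^3. \<beta> (x \<bullet> e1))" by (rule smooth_germ_compose[OF \<beta>(1) _ in1]) simp
  have \<beta>2: "smooth_germ (\<lambda>p::real^3. \<beta> (p $ 1))" by (rule smooth_germ_compose[OF \<beta>(1) _ smooth_germ_nth]) simp
  have m: "smooth_germ ?m" "?m 0 = 0"
    by (auto intro!: smooth_germ_vector2 smooth_germ_diff in1 \<beta>1 simp: \<beta>(2))
  have al: "smooth_germ (\<lambda>p. a (?l p))" and cl: "smooth_germ (\<lambda>p. c (?l p))"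
    using smooth_germ_compose[OF a(1) l(2,1)] smooth_germ_compose[OF c(1) l(2,1)] .
  have am: "smooth_germ (\<lambda>p. a (?m p))" and cm: "smooth_germ (\<lambda>p. c (?m p))"
    using smooth_germ_compose[OF a(1) m(2,1)] smooth_germ_compose[OF c(1) m(2,1)] .
  have \<Phi>: "smooth_germ ?\<Phi>" by (intro smooth_germ_intros al cl \<beta>2)
  have \<Psi>: "smooth_germ ?\<Psi>"
    by (intro smooth_germ_intros smooth_germ_vector3 in1 \<beta>1 am smooth_germ_inverse[OF cm])
       (simp add: \<beta>(2) c(2))
  have on': "e2 \<bullet> e1 = 0" "e3 \<bullet> e1 = 0" "e3 \<bullet> e2 = 0" using on by (simp_all add: inner_commute)
  have comp: "?\<Phi> p \<bullet> e1 = p $ 1" "?\<Phi> p \<bullet> e2 = \<beta> (p $ 1) + p $ 2" "?\<Phi> p \<bullet> e3 = a (?l p) + p $ 3 * c (?l p)" for p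
    using on on' by (simp_all add: inner_add_left)
  have cne: "\<forall>\<^sub>F q in nhds 0. c q \<noteq> 0"
    using smooth_germ_tendsto[OF c(1)] c(2) by (rule tendsto_imp_eventually_ne)
  show ?thesis unfolding diffeo_germ_def
  proof (intro conjI exI)
    show "?\<Phi> 0 = 0" by (simp add: \<beta> a)
    show "?\<Psi> 0 = 0" by (simp add: vec_eq_iff forall_3 m(2) \<beta> a)
    show "smooth_germ ?\<Phi>" "smooth_germ ?\<Psi>" by fact+
    show "\<forall>\<^sub>F p in nhds 0. ?\<Psi> (?\<Phi> p) = p"
      using eventually_compose_germ[OF l cne]
      by eventually_elim (simp only: comp, simp add: vec_eq_iff forall_3)
    show "\<forall>\<^sub>F x in nhds 0. ?\<Phi> (?\<Psi> x) = x"
      using eventually_compose_germ[OF m cne]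
    proof eventually_elim
      case (elim x)
      have "?\<Phi> (?\<Psi> x) = (x \<bullet> e1) *\<^sub>R e1 + (x \<bullet> e2) *\<^sub>R e2 + (x \<bullet> e3) *\<^sub>R e3"
        using elim by (simp add: mult.assoc)
      then show ?case using inner_expand_orthonormal[OF on, of x] by simp
    qed
  qed
qed

context pure_frontal_chart
begin

text \<open>In the frame \<open>e1, e2, e3\<close> of the origin, \<open>\<beta>\<close> describes the projection of the singular image to the
  plane of \<open>e1, e2\<close> as a graph over \<open>e1\<close>. Subtracting it from the second coordinate leaves a function
  \<open>y = v\<^sup>2 B\<close> with \<open>B = 1/2\<close> at the origin. With \<open>x\<close> and \<open>w = v \<surd>B\<close> as new source coordinates the
  frontal becomes \<open>(x, \<beta>(x) + w\<^sup>2, k(x, w))\<close>, and \<open>k = a(x, w\<^sup>2) + w\<^sup>5 c(x, w\<^sup>2)\<close>. The last two terms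
  are turned into \<open>w\<^sup>5\<close> by a triangular map of the target if \<open>c \<noteq> 0\<close> at the origin, and otherwise
  \<open>Z = z - a(x, y - \<beta>(x))\<close> would be a function of high contact, so that the invariant would vanish.\<close>

lemma A_equivalent_cuspidal_edge_5_2:
  assumes g0: "g 0 = 0" and T: "five_halves_invariant \<noteq> 0"
  shows "A_equivalent g (\<lambda>q. vector [q $ 1, (q $ 2)\<^sup>2, (q $ 2) ^ 5])"
proof -
  define e1 where "e1 = pd 1 g 0"
  define e2 where "e2 = h 0"
  define e3 where "e3 = n 0"
  note on = orthonormal_0[folded e1_def e2_def e3_def]
  note expand = inner_expand_orthonormal[OF on]
  have comp: "smooth_germ (\<lambda>q. g q \<bullet> e)" for e
    by (intro smooth_germ_intros g)
  have pdc: "\<forall>\<^sub>F q in nhds 0. pd i (\<lambda>q. g q \<bullet> e) q = pd i g q \<bullet> e" for i e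
    using pd_inner[OF g smooth_germ_const[of e], of i] by eventually_elim simp
  define x where "x q = g q \<bullet> e1" for q
  define y0 where "y0 q = g q \<bullet> e2" for q
  define z where "z q = g q \<bullet> e3" for q
  note xyz = x_def[abs_def] y0_def[abs_def] z_def[abs_def]
  have x: "smooth_germ x" "x 0 = 0" and y0: "smooth_germ y0" "y0 0 = 0" and z: "smooth_germ z" "z 0 = 0"
    unfolding xyz using comp g0 by auto
  have pdx: "\<forall>\<^sub>F q in nhds 0. pd i x q = pd i g q \<bullet> e1" for i
    unfolding x_def[abs_def] by (rule pdc)
  have pdy0: "\<forall>\<^sub>F q in nhds 0. pd i y0 q = pd i g q \<bullet> e2" for i
    unfolding y0_def[abs_def] by (rule pdc)
  have x_pd0: "pd 1 x 0 = 1" "pd 2 x 0 = 0"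
    using at_0[OF pdx[of 1]] at_0[OF pdx[of 2]] on by (simp_all add: e1_def)
  \<comment> \<open>\<open>x\<close> restricted to the axis is invertible; the axis coordinate is recovered from \<open>(x, v)\<close>\<close>
  have "diffeo_germ (\<lambda>q. vector [x q, q $ 2] :: real^2)"
    by (rule diffeo_germ_vector2[OF x(1) smooth_germ_nth x(2)]) (simp_all add: x_pd0)
  then obtain \<theta>0 where \<theta>0: "diffeo_germ \<theta>0" "smooth_germ \<theta>0" "\<theta>0 0 = 0"
    "\<forall>\<^sub>F p in nhds 0. vector [x (\<theta>0 p), \<theta>0 p $ 2] = p" "\<forall>\<^sub>F q in nhds 0. \<theta>0 (vector [x q, q $ 2]) = q"
    by (rule diffeo_germ_inverse)
  define \<beta> where "\<beta> s = y0 (\<theta>0 (vector [s, 0]))" for s :: real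
  have "smooth_germ (\<lambda>s::real. vector [s, 0] :: real^2)"
    by (intro smooth_germ_intros smooth_germ_bounded_linear bounded_linear_ident)
  from smooth_germ_compose[OF smooth_germ_compose[OF y0(1) \<theta>0(3,2)] _ this]
  have \<beta>: "smooth_germ \<beta>" "\<beta> 0 = 0" by (simp_all add: \<beta>_def[abs_def] \<theta>0 y0)
  have \<beta>x: "\<forall>\<^sub>F q in nhds 0. q $ 2 = 0 \<longrightarrow> \<beta> (x q) = y0 q"
    using \<theta>0(5) by eventually_elim (auto simp: \<beta>_def)
  have bx: "smooth_germ (\<lambda>q. \<beta> (x q))" by (rule smooth_germ_compose[OF \<beta>(1) x(2,1)])
  define y where "y q = y0 q - \<beta> (x q)" for q
  have y: "smooth_germ y" unfolding y_def[abs_def] by (rule smooth_germ_diff[OF y0(1) bx])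
  define P where "P q = h q \<bullet> e2 - (h q \<bullet> e1) * frechet_derivative \<beta> (at (x q)) 1" for q
  have dbx: "smooth_germ (\<lambda>q. frechet_derivative \<beta> (at (x q)) 1)"
    by (rule smooth_germ_compose[OF smooth_germ_frechet[OF \<beta>(1)] x(2,1)])
  have P: "smooth_germ P"
    unfolding P_def[abs_def]
    by (intro smooth_germ_intros h(1) dbx)
  have yP: "\<forall>\<^sub>F q in nhds 0. pd 2 y q = q $ 2 * P q"
    using pd_diff[OF y0(1) bx, of 2] pdy0[of 2] pdx[of 2] h(2) pd_compose[OF \<beta>(1) x, of 2]
      eventually_compose_germ[OF x smooth_germ_has_derivative[OF \<beta>(1)]]
  proof eventually_elim
    case (elim q)
    interpret L: bounded_linear "frechet_derivative \<beta> (at (x q))"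
      using elim(6) by (rule has_derivative_bounded_linear)
    have "frechet_derivative \<beta> (at (x q)) t = t * frechet_derivative \<beta> (at (x q)) 1" for t
      using L.scaleR[of t 1] by simp
    from this[of "pd 2 x q"] show ?case
      using elim by (simp add: y_def[abs_def] P_def algebra_simps)
  qed
  obtain Y1 where Y1: "smooth_germ Y1" "\<forall>\<^sub>F q in nhds 0. y q = q $ 2 * Y1 q"
  proof (rule hadamard_germ_real[OF y])
    show "\<forall>\<^sub>F q in nhds 0. q $ 2 = 0 \<longrightarrow> y q = 0"
      using \<beta>x by eventually_elim (simp add: y_def)
  qed
  obtain B where B: "smooth_germ B" "\<forall>\<^sub>F q in nhds 0. Y1 q = q $ 2 * B q"
  proof (rule hadamard_germ_real[OF Y1(1)])
    show "\<forall>\<^sub>F q in nhds 0. q $ 2 = 0 \<longrightarrow> Y1 q = 0"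
      using pd_cong[OF Y1(2), of 2] pd_2_v_mult[OF Y1(1)] yP by eventually_elim auto
  qed
  have yB: "\<forall>\<^sub>F q in nhds 0. y q = (q $ 2) ^ Suc 1 * B q"
    using Y1(2) B(2) by eventually_elim (simp add: power2_eq_square)
  have "\<forall>\<^sub>F q in nhds 0. 2 * B q + q $ 2 * pd 2 B q - P q = 0"
  proof (rule smooth_germ_zero_by_density)
    show "smooth_germ (\<lambda>q. 2 * B q + q $ 2 * pd 2 B q - P q)"
      by (intro smooth_germ_intros B P)
    show "\<forall>\<^sub>F q in nhds 0. q $ 2 \<noteq> 0 \<longrightarrow> 2 * B q + q $ 2 * pd 2 B q - P q = 0"
      using pd_cong[OF yB, of 2] pd_2_v_power[OF B(1), of 1] yP by eventually_elim auto
  qed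
  from at_0[OF this] have B0: "B 0 = 1 / 2"
    using on by (simp add: P_def e2_def inner_commute flip: e1_def)
  define w where "w q = q $ 2 * B q powr (1 / 2)" for q
  have Bp: "smooth_germ (\<lambda>q. B q powr (1 / 2))" by (rule smooth_germ_powr[OF B(1)]) (simp add: B0)
  have w: "smooth_germ w" "w 0 = 0"
    unfolding w_def[abs_def] by (auto intro: smooth_germ_mult smooth_germ_nth Bp)
  have Bpos: "\<forall>\<^sub>F q in nhds 0. B q > 0"
    using order_tendstoD(1)[OF smooth_germ_tendsto[OF B(1)], of 0] B0 by simp
  have wy: "\<forall>\<^sub>F q in nhds 0. (w q)\<^sup>2 = y q"
    using Bpos yB by eventually_elim (simp add: w_def power_mult_distrib power2_eq_square flip: powr_add)
  have w_pd0: "pd 1 w 0 = 0" "pd 2 w 0 = B 0 powr (1 / 2)"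
    using at_0[OF pd_mult[OF smooth_germ_nth[of 2] Bp, of 1]] at_0[OF pd_mult[OF smooth_germ_nth[of 2] Bp, of 2]]
    by (simp_all add: w_def[abs_def])
  have "diffeo_germ (\<lambda>q. vector [x q, w q] :: real^2)"
    by (rule diffeo_germ_vector2[OF x(1) w(1) x(2) w(2)]) (simp add: x_pd0 w_pd0 B0)
  then obtain \<theta> where \<theta>: "diffeo_germ \<theta>" "smooth_germ \<theta>" "\<theta> 0 = 0"
    "\<forall>\<^sub>F p in nhds 0. vector [x (\<theta> p), w (\<theta> p)] = p" "\<forall>\<^sub>F q in nhds 0. \<theta> (vector [x q, w q]) = q"
    by (rule diffeo_germ_inverse)
  note th = \<theta>(2,3)
  have x\<theta>: "\<forall>\<^sub>F p in nhds 0. x (\<theta> p) = p $ 1" and w\<theta>: "\<forall>\<^sub>F p in nhds 0. w (\<theta> p) = p $ 2"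
    using \<theta>(4) by (auto simp: vec_eq_iff forall_2 elim!: eventually_mono)
  define k where "k p = z (\<theta> p)" for p
  have k: "smooth_germ k" unfolding k_def[abs_def] by (rule smooth_germ_compose[OF z(1) th(2,1)])
  have y\<theta>: "\<forall>\<^sub>F p in nhds 0. y (\<theta> p) = (p $ 2)\<^sup>2"
    using eventually_compose_germ[OF th wy] w\<theta> by eventually_elim simp
  have y0\<theta>: "\<forall>\<^sub>F p in nhds 0. y0 (\<theta> p) = \<beta> (p $ 1) + (p $ 2)\<^sup>2"
    using y\<theta> x\<theta> by eventually_elim (simp add: y_def)
  have g\<theta>: "\<forall>\<^sub>F p in nhds 0. g (\<theta> p) = p $ 1 *\<^sub>R e1 + (\<beta> (p $ 1) + (p $ 2)\<^sup>2) *\<^sub>R e2 + k p *\<^sub>R e3"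
    using x\<theta> y0\<theta>
  proof eventually_elim
    case (elim p)
    then show ?case using expand[of "g (\<theta> p)"] by (simp add: x_def y0_def z_def k_def)
  qed
  \<comment> \<open>tangency of \<open>g \<circ> \<theta>\<close> to the normal \<open>nt\<close> reads \<open>2 w (nt \<bullet> e2) + k\<^sub>w (nt \<bullet> e3) = 0\<close>\<close>
  define nt where "nt p = n (\<theta> p)" for p
  have nt: "smooth_germ nt" unfolding nt_def[abs_def] by (rule smooth_germ_compose[OF n th(2,1)])
  have axis\<theta>: "\<forall>\<^sub>F p in nhds 0. p $ 2 = 0 \<longrightarrow> \<theta> p $ 2 = 0"
    using w\<theta> eventually_compose_germ[OF th Bpos] by eventually_elim (auto simp: w_def)
  have \<theta>1: "\<forall>\<^sub>F p in nhds 0. p $ 2 = 0 \<longrightarrow> pd 2 \<theta> p $ 1 = 0"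
  proof -
    have "\<forall>\<^sub>F q in nhds 0. pd 1 x q \<noteq> 0"
      using smooth_germ_tendsto[OF smooth_germ_pd[OF x(1), of 1]] by (rule tendsto_imp_eventually_ne) (simp add: x_pd0)
    from eventually_compose_germ[OF th this] pd_cong[OF x\<theta>, of 2] pd_compose_plane[OF x(1) th, of 2] axis\<theta>
      eventually_compose_germ[OF th pdx[of 2]] eventually_compose_germ[OF th axis_g]
    show ?thesis by eventually_elim auto
  qed
  have nt2: "\<forall>\<^sub>F p in nhds 0. p $ 2 = 0 \<longrightarrow> pd 2 nt p = 0"
    using \<theta>1 axis\<theta> eventually_compose_germ[OF th axis_n] pd_compose_plane[OF n th, of 2]
    by eventually_elim (auto simp: nt_def[abs_def])
  define r where "r p = nt p \<bullet> e2" for p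
  define s where "s p = nt p \<bullet> e3" for p
  have rs: "smooth_germ r" "smooth_germ s"
    unfolding r_def[abs_def] s_def[abs_def] by (intro smooth_germ_intros nt)+
  have s0: "s 0 = 1" "r 0 = 0" using on by (simp_all add: s_def r_def nt_def th e3_def inner_commute)
  have sne: "\<forall>\<^sub>F p in nhds 0. s p \<noteq> 0"
    using smooth_germ_tendsto[OF rs(2)] by (rule tendsto_imp_eventually_ne) (simp add: s0)
  have rs2: "\<forall>\<^sub>F p in nhds 0. p $ 2 = 0 \<longrightarrow> pd 2 r p = 0 \<and> pd 2 s p = 0"
    using pd_inner[OF nt smooth_germ_const[of e2], of 2] pd_inner[OF nt smooth_germ_const[of e3], of 2] nt2
    by eventually_elim (auto simp: r_def[abs_def] s_def[abs_def])
  define m where "m p = - r p * inverse (s p)" for p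
  have m: "smooth_germ m"
    unfolding m_def[abs_def]
    by (intro smooth_germ_intros smooth_germ_inverse rs) (simp add: s0)
  have ms: "\<forall>\<^sub>F p in nhds 0. m p * s p = - r p"
    using sne by eventually_elim (simp add: m_def)
  have max: "\<forall>\<^sub>F p in nhds 0. p $ 2 = 0 \<longrightarrow> pd 2 m p = 0"
    using pd_cong[OF ms, of 2] pd_mult[OF m rs(2), of 2] pd_minus[OF rs(1), of 2] rs2 sne
    by eventually_elim auto
  have km: "\<forall>\<^sub>F p in nhds 0. pd 2 k p = 2 * p $ 2 * m p"
  proof -
    have "\<forall>\<^sub>F p in nhds 0. pd 2 (\<lambda>p. g (\<theta> p)) p \<bullet> nt p = 0"
      using pd_compose_plane[OF g th, of 2] eventually_compose_germ[OF th normal]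
      by eventually_elim (simp add: nt_def inner_add_left)
    moreover have "\<forall>\<^sub>F p in nhds 0. pd 2 (\<lambda>p. g (\<theta> p)) p = (2 * p $ 2) *\<^sub>R e2 + pd 2 k p *\<^sub>R e3"
    proof -
      have b1: "smooth_germ (\<lambda>p::real^2. p $ 1 *\<^sub>R e1)" by (intro smooth_germ_intros)
      have \<beta>1: "smooth_germ (\<lambda>p::real^2. \<beta> (p $ 1))" by (rule smooth_germ_compose[OF \<beta>(1) _ smooth_germ_nth]) simp
      have sq: "smooth_germ (\<lambda>p::real^2. (p $ 2)\<^sup>2)" by (intro smooth_germ_intros)
      have b2: "smooth_germ (\<lambda>p::real^2. (\<beta> (p $ 1) + (p $ 2)\<^sup>2) *\<^sub>R e2)"
        by (intro smooth_germ_intros \<beta>1 sq)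
      have b3: "smooth_germ (\<lambda>p. k p *\<^sub>R e3)" by (intro smooth_germ_intros k)
      have d\<beta>: "\<forall>\<^sub>F p in nhds 0. pd 2 (\<lambda>p::real^2. \<beta> (p $ 1)) p = 0"
        using pd_compose[OF \<beta>(1) smooth_germ_nth[of 1] zero_index, of 2]
          eventually_compose_germ[OF smooth_germ_nth[of 1] zero_index smooth_germ_has_derivative[OF \<beta>(1)]]
      proof eventually_elim
        case (elim p)
        then show ?case using linear_0[OF bounded_linear.linear[OF has_derivative_bounded_linear[OF elim(2)]]] by simp
      qed
      have dsq: "\<forall>\<^sub>F p in nhds 0. pd 2 (\<lambda>p::real^2. (p $ 2)\<^sup>2) p = 2 * p $ 2"
        using pd_mult[OF smooth_germ_nth[of 2] smooth_germ_nth[of 2], of 2]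
        by eventually_elim (simp add: power2_eq_square)
      show ?thesis
        using pd_cong[OF g\<theta>, of 2] pd_add[OF smooth_germ_add[OF b1 b2] b3, of 2] pd_add[OF b1 b2, of 2]
          pd_scaleR[OF smooth_germ_nth[of 1] smooth_germ_const[of e1], of 2]
          pd_scaleR[OF smooth_germ_add[OF \<beta>1 sq] smooth_germ_const[of e2], of 2] pd_add[OF \<beta>1 sq, of 2]
          pd_scaleR[OF k smooth_germ_const[of e3], of 2] d\<beta> dsq
        by eventually_elim simp
    qed
    ultimately show ?thesis using sne
    proof eventually_elim
      case (elim p)
      then have "2 * p $ 2 * r p + pd 2 k p * s p = 0"
        by (simp add: inner_add_right r_def s_def inner_commute)
      then show ?case using elim(3) by (simp add: m_def field_simps)
    qed
  qed
  obtain a c where ac: "smooth_germ a" "smooth_germ c"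
    "\<forall>\<^sub>F p in nhds 0. k p = a (square2 p) + (p $ 2) ^ 5 * c (square2 p)"
    by (rule fifth_order_decomposition[OF k m km max])
  have a0: "a 0 = 0" using at_0[OF ac(3)] by (simp add: k_def th z)
  \<comment> \<open>\<open>l\<close> recovers \<open>(x, y)\<close> from the target, so that \<open>Z \<circ> g = w\<^sup>5 c(x, y) = v\<^sup>5 C\<close>\<close>
  define l where "l p = (vector [p \<bullet> e1, p \<bullet> e2 - \<beta> (p \<bullet> e1)] :: real^2)" for p :: "real^3"
  have in1: "smooth_germ (\<lambda>x::real^3. x \<bullet> e)" for e
    by (intro smooth_germ_bounded_linear bounded_linear_inner_left)
  have l: "smooth_germ l" "l 0 = 0"
    unfolding l_def[abs_def]
    by (intro smooth_germ_intros in1 smooth_germ_compose[OF \<beta>(1) _ in1]) (simp_all add: \<beta>(2))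
  define Z where "Z p = p \<bullet> e3 - a (l p)" for p
  have Z: "smooth_germ Z"
    unfolding Z_def[abs_def] by (rule smooth_germ_diff[OF in1 smooth_germ_compose[OF ac(1) l(2,1)]])
  have lg: "l (g q) = vector [x q, y q]" for q by (simp add: l_def x_def y_def y0_def)
  define C where "C q = (B q powr (1 / 2)) ^ 5 * c (l (g q))" for q
  have C: "smooth_germ C"
    unfolding C_def[abs_def]
    by (intro smooth_germ_mult smooth_germ_power Bp smooth_germ_compose[OF ac(2) _ smooth_germ_compose[OF l(1) g0 g]])
       (simp add: g0 l)
  have xw: "smooth_germ (\<lambda>q. vector [x q, w q] :: real^2)" "(vector [x 0, w 0] :: real^2) = 0"
    by (auto intro: smooth_germ_vector2 x w simp: x(2) w(2))
  have Zg: "\<forall>\<^sub>F q in nhds 0. Z (g q) = (q $ 2) ^ 5 * C q"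
    using \<theta>(5) eventually_compose_germ[OF xw ac(3)] wy
  proof eventually_elim
    case (elim q)
    have "square2 (vector [x q, w q]) = l (g q)" using elim(3) by (simp add: lg square2_def)
    then show ?case using elim(1,2)
      by (simp add: Z_def C_def k_def z_def w_def power_mult_distrib)
  qed
  have grad: "frechet_derivative Z (at 0) (n 0) = 1"
  proof -
    have "((\<lambda>t. Z (t *\<^sub>R e3)) has_derivative (\<lambda>t. frechet_derivative Z (at 0) (t *\<^sub>R e3))) (at 0)"
      by (rule has_derivative_compose[of "\<lambda>t. t *\<^sub>R e3" "\<lambda>t. t *\<^sub>R e3" 0 UNIV Z])
         (auto intro!: derivative_eq_intros at_0[OF smooth_germ_has_derivative[OF Z]])
    moreover have "(\<lambda>t. Z (t *\<^sub>R e3)) = (\<lambda>t. t)"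
      using on by (simp add: Z_def l_def inner_commute \<beta> a0 fun_eq_iff)
    ultimately have "((\<lambda>t. t) has_derivative (\<lambda>t. frechet_derivative Z (at 0) (t *\<^sub>R e3))) (at 0)" by simp
    from fun_cong[OF has_derivative_unique[OF this has_derivative_ident], of 1]
    show ?thesis by (simp add: e3_def)
  qed
  have "C 0 \<noteq> 0"
    using invariant_zero_of_high_contact[OF Z C _ g0 Zg grad] T by blast
  then have c0: "c 0 \<noteq> 0" by (auto simp: C_def g0 l)
  let ?\<Phi> = "\<lambda>p::real^3. p $ 1 *\<^sub>R e1 + (\<beta> (p $ 1) + p $ 2) *\<^sub>R e2
    + (a (vector [p $ 1, p $ 2]) + p $ 3 * c (vector [p $ 1, p $ 2])) *\<^sub>R e3"
  have "diffeo_germ ?\<Phi>" by (rule diffeo_germ_triangular[OF on \<beta> ac(1) a0 ac(2) c0])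
  moreover have "\<forall>\<^sub>F p in nhds 0. g (\<theta> p) = ?\<Phi> (vector [p $ 1, (p $ 2)\<^sup>2, (p $ 2) ^ 5])"
    using g\<theta> ac(3) by eventually_elim (simp add: square2_def)
  ultimately show ?thesis unfolding A_equivalent_def using \<theta>(1) by blast
qed

end

section \<open>The unit normal along the singular curve\<close>

lemma frechet_compose_germ:
  assumes F: "smooth_germ F" and g: "smooth_germ g" "g 0 = 0"
  shows "\<forall>\<^sub>F q in nhds 0. \<forall>X. frechet_derivative (\<lambda>q. F (g q)) (at q) X
    = frechet_derivative F (at (g q)) (frechet_derivative g (at q) X)"
  using eventually_compose_germ[OF g smooth_germ_has_derivative[OF F]] smooth_germ_has_derivative[OF g(1)]
proof eventually_elim
  case (elim q)
  from fun_cong[OF frechet_derivative_at[OF has_derivative_compose[OF elim(2,1)], symmetric]]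
  show ?case by blast
qed

lemma frechet_inverse_germ:
  assumes \<phi>: "smooth_germ \<phi>" and \<psi>: "smooth_germ \<psi>" "\<psi> 0 = 0" and inv: "\<forall>\<^sub>F p in nhds 0. \<phi> (\<psi> p) = p"
  shows "\<forall>\<^sub>F p in nhds 0. \<forall>X. frechet_derivative \<phi> (at (\<psi> p)) (frechet_derivative \<psi> (at p) X) = X"
proof -
  have "\<forall>\<^sub>F p in nhds 0. \<forall>\<^sub>F p' in nhds p. \<phi> (\<psi> p') = p'"
    using inv by (simp add: eventually_eventually)
  then show ?thesis using frechet_compose_germ[OF \<phi> \<psi>]
  proof eventually_elim
    case (elim p)
    have "frechet_derivative (\<lambda>p. \<phi> (\<psi> p)) (at p) = frechet_derivative (\<lambda>p. p) (at p)"
      by (rule frechet_derivative_cong_nhds[OF elim(1)])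
    also have "\<dots> = (\<lambda>X. X)" by (rule frechet_derivative_at[OF has_derivative_ident, symmetric])
    finally show ?case using elim(2) by simp
  qed
qed

lemma singular_point_iff:
  "singular_point f q \<longleftrightarrow> f differentiable (at q) \<and> (\<exists>X. X \<noteq> 0 \<and> frechet_derivative f (at q) X = 0)"
proof -
  have "rank (jacobian f (at q)) < 2 \<longleftrightarrow> (\<exists>X. X \<noteq> 0 \<and> frechet_derivative f (at q) X = 0)"
    if d: "f differentiable (at q)"
  proof -
    have "bounded_linear (frechet_derivative f (at q))"
      using d has_derivative_bounded_linear frechet_derivative_works by blast
    from fun_cong[OF matrix_vector_mul(3)[OF this]]
    have J: "jacobian f (at q) *v X = frechet_derivative f (at q) X" for X by (simp add: jacobian_def)
    have "rank (jacobian f (at q)) < 2 \<longleftrightarrow> rank (jacobian f (at q)) \<noteq> 2"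
      using rank_bound[of "jacobian f (at q)"] by auto
    then show ?thesis
      using matrix_nonfull_linear_equations_eq[of "jacobian f (at q)"] by (simp add: J)
  qed
  then show ?thesis unfolding singular_point_def by blast
qed

lemma singular_point_compose_diffeo:
  fixes f :: "real^2 \<Rightarrow> real^3"
  assumes f: "smooth_germ f" and \<phi>: "diffeo_germ \<phi>"
  shows "\<forall>\<^sub>F q in nhds 0. singular_point f (\<phi> q) \<longrightarrow> singular_point (f \<circ> \<phi>) q"
proof -
  obtain \<psi> where \<psi>: "diffeo_germ \<psi>" "smooth_germ \<psi>" "\<psi> 0 = 0"
    "\<forall>\<^sub>F p in nhds 0. \<phi> (\<psi> p) = p" "\<forall>\<^sub>F q in nhds 0. \<psi> (\<phi> q) = q"
    by (rule diffeo_germ_inverse[OF \<phi>])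
  have s: "smooth_germ \<phi>" "\<phi> 0 = 0" using \<phi> by (auto simp: diffeo_germ_def)
  have "smooth_germ (f \<circ> \<phi>)" unfolding o_def by (rule smooth_germ_compose[OF f s(2,1)])
  from smooth_germ_has_derivative[OF this] frechet_compose_germ[OF f s]
    eventually_compose_germ[OF s frechet_inverse_germ[OF s(1) \<psi>(2,3,4)]] \<psi>(5)
    smooth_germ_has_derivative[OF s(1)]
  show ?thesis
  proof eventually_elim
    case (elim q)
    show ?case
    proof
      assume "singular_point f (\<phi> q)"
      then obtain X where X: "X \<noteq> 0" "frechet_derivative f (at (\<phi> q)) X = 0" by (auto simp: singular_point_iff)
      define Y where "Y = frechet_derivative \<psi> (at (\<phi> q)) X"
      have Y: "frechet_derivative \<phi> (at q) Y = X" using elim(3,4) by (simp add: Y_def)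
      have "frechet_derivative (f \<circ> \<phi>) (at q) Y = 0" using elim(2) X Y by (simp add: o_def)
      moreover have "Y \<noteq> 0"
      proof
        assume "Y = 0"
        then have "frechet_derivative \<phi> (at q) Y = 0"
          using linear_0[OF bounded_linear.linear[OF has_derivative_bounded_linear[OF elim(5)]]] by simp
        then show False using X(1) Y by simp
      qed
      ultimately show "singular_point (f \<circ> \<phi>) q"
        using elim(1) by (auto simp: singular_point_iff differentiable_def)
    qed
  qed
qed

text \<open>The function changes sign at \<open>0\<close>, and the intermediate value theorem applies.\<close>

lemma onto_neighbourhood_of_0:
  fixes \<sigma> :: "real \<Rightarrow> real"
  assumes \<delta>: "\<delta> > 0" and cont: "continuous_on {-\<delta><..<\<delta>} \<sigma>" and z: "\<sigma> 0 = 0"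
    and D: "(\<sigma> has_real_derivative D) (at 0)" "D \<noteq> 0"
  obtains r where "r > 0" "\<And>u. \<bar>u\<bar> < r \<Longrightarrow> \<exists>t\<in>{-\<delta><..<\<delta>}. \<sigma> t = u"
proof -
  have pos: "\<exists>r>0. \<forall>u. \<bar>u\<bar> < r \<longrightarrow> (\<exists>t\<in>{-\<delta><..<\<delta>}. \<sigma> t = u)"
    if cont: "continuous_on {-\<delta><..<\<delta>} \<sigma>" and z: "\<sigma> 0 = 0"
      and D: "(\<sigma> has_real_derivative D) (at 0)" "D > 0" for \<sigma> :: "real \<Rightarrow> real" and D
  proof -
    obtain d1 where d1: "d1 > 0" "\<And>h. 0 < h \<Longrightarrow> h < d1 \<Longrightarrow> \<sigma> 0 < \<sigma> (0 + h)"
      using DERIV_pos_inc_right[OF D] by blast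
    obtain d2 where d2: "d2 > 0" "\<And>h. 0 < h \<Longrightarrow> h < d2 \<Longrightarrow> \<sigma> (0 - h) < \<sigma> 0"
      using DERIV_pos_inc_left[OF D] by blast
    define h where "h = min (min d1 d2) \<delta> / 2"
    have h: "0 < h" "h < d1" "h < d2" "h < \<delta>" using d1(1) d2(1) \<delta> by (auto simp: h_def min_def)
    have s: "\<sigma> (- h) < 0" "0 < \<sigma> h" using d1(2)[of h] d2(2)[of h] h z by auto
    have c: "continuous_on {- h..h} \<sigma>" by (rule continuous_on_subset[OF cont]) (use h in auto)
    have "\<exists>t\<in>{-\<delta><..<\<delta>}. \<sigma> t = u" if u: "\<bar>u\<bar> < min (\<sigma> h) (- \<sigma> (- h))" for u
    proof -
      have "\<exists>t. - h \<le> t \<and> t \<le> h \<and> \<sigma> t = u"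
        by (rule IVT'[OF _ _ _ c]) (use u h in auto)
      then show ?thesis using h by force
    qed
    then show ?thesis using s by (intro exI[of _ "min (\<sigma> h) (- \<sigma> (- h))"]) auto
  qed
  show ?thesis
  proof (cases "D > 0")
    case True
    then show ?thesis using pos[OF cont z D(1)] that by metis
  next
    case False
    have "\<exists>r>0. \<forall>u. \<bar>u\<bar> < r \<longrightarrow> (\<exists>t\<in>{-\<delta><..<\<delta>}. - \<sigma> t = u)"
      by (rule pos[of "\<lambda>t. - \<sigma> t" "- D"])
         (use cont z D False in \<open>auto intro!: continuous_intros DERIV_minus\<close>)
    then obtain r where r: "r > 0" "\<And>u. \<bar>u\<bar> < r \<Longrightarrow> \<exists>t\<in>{-\<delta><..<\<delta>}. - \<sigma> t = u" by blast
    have "\<exists>t\<in>{-\<delta><..<\<delta>}. \<sigma> t = u" if "\<bar>u\<bar> < r" for u using r(2)[of "- u"] that by auto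
    then show ?thesis using that r(1) by blast
  qed
qed

text \<open>The Gram determinant of an orthogonal triple.\<close>

lemma det_square_orthogonal:
  fixes a b c :: "real^3"
  assumes "a \<bullet> b = 0" "a \<bullet> c = 0" "b \<bullet> c = 0"
  shows "(det (vector [a, b, c] :: real^3^3))\<^sup>2 = (a \<bullet> a) * (b \<bullet> b) * (c \<bullet> c)"
proof -
  have "(det (vector [a, b, c] :: real^3^3))\<^sup>2
      = (a \<bullet> a) * ((b \<bullet> b) * (c \<bullet> c) - (b \<bullet> c)\<^sup>2) - (a \<bullet> b) * ((a \<bullet> b) * (c \<bullet> c) - (b \<bullet> c) * (a \<bullet> c))
        + (a \<bullet> c) * ((a \<bullet> b) * (b \<bullet> c) - (b \<bullet> b) * (a \<bullet> c))"
    by (simp add: det_3 inner_vec_def sum_3) algebra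
  then show ?thesis using assms by simp
qed

text \<open>Read in adapted coordinates, the singular curve runs on the axis with non-zero speed, hence covers
  a neighbourhood of the origin in the axis; there \<open>\<eta>\<close> is a non-zero multiple of \<open>\<partial>\<^sub>v\<close>. So \<open>\<psi> = 0\<close> says
  that \<open>g\<^sub>u\<close>, \<open>n\<close> and \<open>n\<^sub>v\<close> are linearly dependent on the axis. As these vectors are mutually
  orthogonal and the first two are units, \<open>n\<^sub>v\<close> vanishes.\<close>

lemma pd_2_normal_zero_on_axis:
  assumes f: "smooth_germ f" and \<nu>: "unit_normal_field f \<nu>"
    and \<phi>: "adapted_coordinates f \<nu> \<phi>" and pure: "pure_frontal_singular f \<nu>"
  shows "\<forall>\<^sub>F q in nhds 0. q $ 2 = 0 \<longrightarrow> pd 2 (\<nu> \<circ> \<phi>) q = 0"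
proof -
  define g where "g = (\<lambda>q. f (\<phi> q))"
  define n where "n = (\<lambda>q. \<nu> (\<phi> q))"
  have \<phi>d: "diffeo_germ \<phi>" using \<phi> by (simp add: adapted_coordinates_def)
  then have \<phi>s: "smooth_germ \<phi>" "\<phi> 0 = 0" by (auto simp: diffeo_germ_def)
  obtain \<psi> where \<psi>: "diffeo_germ \<psi>" "smooth_germ \<psi>" "\<psi> 0 = 0"
    "\<forall>\<^sub>F p in nhds 0. \<phi> (\<psi> p) = p" "\<forall>\<^sub>F q in nhds 0. \<psi> (\<phi> q) = q"
    by (rule diffeo_germ_inverse[OF \<phi>d])
  have ad: "\<forall>\<^sub>F q in nhds 0. (singular_point g q \<longleftrightarrow> q $ 2 = 0)
      \<and> (q $ 2 = 0 \<longrightarrow> pd 2 g q = 0 \<and> norm (pd 1 g q) = 1)"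
    using \<phi> unfolding adapted_coordinates_def Let_def o_def g_def
    by (elim conjE, elim eventually_mono) blast
  have \<nu>s: "smooth_germ \<nu>" and unit: "\<forall>\<^sub>F q in nhds 0. norm (\<nu> q) = 1 \<and> (\<forall>X. frechet_derivative f (at q) X \<bullet> \<nu> q = 0)"
    using \<nu> by (auto simp: unit_normal_field_def)
  have g: "smooth_germ g" unfolding g_def by (rule smooth_germ_compose[OF f \<phi>s(2,1)])
  have n: "smooth_germ n" unfolding n_def by (rule smooth_germ_compose[OF \<nu>s \<phi>s(2,1)])
  have Dg: "\<forall>\<^sub>F q in nhds 0. \<forall>X. frechet_derivative g (at q) X = frechet_derivative f (at (\<phi> q)) (frechet_derivative \<phi> (at q) X)"
    unfolding g_def by (rule frechet_compose_germ[OF f \<phi>s])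
  have Dn: "\<forall>\<^sub>F q in nhds 0. \<forall>X. frechet_derivative n (at q) X = frechet_derivative \<nu> (at (\<phi> q)) (frechet_derivative \<phi> (at q) X)"
    unfolding n_def by (rule frechet_compose_germ[OF \<nu>s \<phi>s])
  have gn: "\<forall>\<^sub>F q in nhds 0. norm (n q) = 1 \<and> pd 1 g q \<bullet> n q = 0 \<and> pd 2 g q \<bullet> n q = 0"
    using eventually_compose_germ[OF \<phi>s unit] Dg
    by eventually_elim (simp add: n_def pd_def)
  have orth: "\<forall>\<^sub>F q in nhds 0. q $ 2 = 0 \<longrightarrow> n q \<bullet> pd 2 n q = 0 \<and> pd 1 g q \<bullet> pd 2 n q = 0"
  proof -
    have "\<forall>\<^sub>F q in nhds 0. n q \<bullet> n q = 1" using gn by eventually_elim (simp add: norm_eq_1)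
    note nn = pd_cong[OF this, of 2]
    have "\<forall>\<^sub>F q in nhds 0. pd 1 g q \<bullet> n q = 0" using gn by eventually_elim simp
    note un = pd_cong[OF this, of 2]
    have "\<forall>\<^sub>F q in nhds 0. pd 2 g q \<bullet> n q = 0" using gn by eventually_elim simp
    note vn = pd_cong[OF this, of 1]
    show ?thesis
      using nn un vn pd_inner[OF n n, of 2] pd_inner[OF smooth_germ_pd[OF g, of 1] n, of 2]
        pd_inner[OF smooth_germ_pd[OF g, of 2] n, of 1] pd_commute[OF g, of 2 1] ad
      by eventually_elim (auto simp: inner_commute)
  qed
  obtain \<gamma> \<eta> where \<gamma>: "singular_curve f \<gamma>" and \<eta>: "null_vector_field f \<gamma> \<eta>"
    and psi: "\<forall>\<^sub>F t in nhds 0. psi_function f \<nu> \<gamma> \<eta> t = 0"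
    using pure by (auto simp: pure_frontal_singular_def)
  obtain \<epsilon> W where \<epsilon>: "\<epsilon> > 0" "smooth_on \<gamma> {-\<epsilon><..<\<epsilon>}" "\<And>t. t \<in> {-\<epsilon><..<\<epsilon>} \<Longrightarrow> vector_derivative \<gamma> (at t) \<noteq> 0"
    "{q \<in> W. singular_point f q} = \<gamma> ` {-\<epsilon><..<\<epsilon>}" and \<gamma>0: "\<gamma> 0 = 0"
    using \<gamma> unfolding singular_curve_def by blast
  have \<gamma>s: "smooth_germ \<gamma>" by (rule smooth_germI[OF _ _ \<epsilon>(2)]) (use \<epsilon>(1) in auto)
  have near: "\<forall>\<^sub>F t in nhds 0. t \<in> {-\<epsilon><..<\<epsilon>}"
    by (rule eventually_nhds_in_open) (use \<epsilon>(1) in auto)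
  \<comment> \<open>the curve \<open>\<gamma>\<close> in adapted coordinates; it consists of singular points, so it runs in the axis\<close>
  define s where "s t = \<psi> (\<gamma> t)" for t
  have s: "smooth_germ s" "s 0 = 0"
    unfolding s_def[abs_def] by (rule smooth_germ_compose[OF \<psi>(2) \<gamma>0 \<gamma>s]) (simp add: \<gamma>0 \<psi>(3))
  have \<phi>s\<gamma>: "\<forall>\<^sub>F t in nhds 0. \<phi> (s t) = \<gamma> t"
    using eventually_compose_germ[OF \<gamma>s \<gamma>0 \<psi>(4)] by (simp add: s_def)
  have s2: "\<forall>\<^sub>F t in nhds 0. s t $ 2 = 0"
    using near \<phi>s\<gamma> eventually_compose_germ[OF s singular_point_compose_diffeo[OF f \<phi>d]]
      eventually_compose_germ[OF s ad]
  proof eventually_elim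
    case (elim t)
    have "singular_point f (\<gamma> t)" using \<epsilon>(4) elim(1) by blast
    then have "singular_point g (s t)" using elim(2,3) by (simp add: g_def o_def)
    then show ?case using elim(4) by blast
  qed
  define ds where "ds t = frechet_derivative s (at t) 1" for t
  have ds2: "\<forall>\<^sub>F t in nhds 0. ds t $ 2 = 0"
  proof -
    have "\<forall>\<^sub>F t in nhds 0. \<forall>\<^sub>F t' in nhds t. s t' $ 2 = 0" using s2 by (simp add: eventually_eventually)
    then show ?thesis using smooth_germ_has_derivative[OF s(1)]
    proof eventually_elim
      case (elim t)
      have "frechet_derivative (\<lambda>t. s t $ 2) (at t) = frechet_derivative (\<lambda>t. 0) (at t)"
        by (rule frechet_derivative_cong_nhds[OF elim(1)])
      moreover have "((\<lambda>t. s t $ 2) has_derivative (\<lambda>r. frechet_derivative s (at t) r $ 2)) (at t)"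
        by (rule bounded_linear.has_derivative[OF bounded_linear_vec_nth elim(2)])
      ultimately show ?case
        using frechet_derivative_at[of "\<lambda>t. s t $ 2"] by (metis ds_def frechet_derivative_const)
    qed
  qed
  have d\<gamma>: "\<forall>\<^sub>F t in nhds 0. frechet_derivative \<phi> (at (s t)) (ds t) = frechet_derivative \<gamma> (at t) 1"
  proof -
    have "\<forall>\<^sub>F t in nhds 0. \<forall>\<^sub>F t' in nhds t. \<phi> (s t') = \<gamma> t'" using \<phi>s\<gamma> by (simp add: eventually_eventually)
    then show ?thesis using frechet_compose_germ[OF \<phi>s(1) s]
    proof eventually_elim
      case (elim t)
      then show ?case using frechet_derivative_cong_nhds[OF elim(1)] by (simp add: ds_def)
    qed
  qed
  have ds1: "\<forall>\<^sub>F t in nhds 0. ds t $ 1 \<noteq> 0"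
    using d\<gamma> ds2 near smooth_germ_has_derivative[OF \<gamma>s]
      eventually_compose_germ[OF s smooth_germ_has_derivative[OF \<phi>s(1)]]
  proof eventually_elim
    case (elim t)
    have "(\<gamma> has_vector_derivative frechet_derivative \<gamma> (at t) 1) (at t)"
      using elim(4) by (simp add: has_vector_derivative_def
          linear_cmul[OF bounded_linear.linear[OF has_derivative_bounded_linear[OF elim(4)]], of _ 1, symmetric])
    then have "frechet_derivative \<gamma> (at t) 1 \<noteq> 0"
      using \<epsilon>(3)[OF elim(3)] by (simp add: vector_derivative_at)
    then have "ds t \<noteq> 0"
      using elim(1) linear_0[OF bounded_linear.linear[OF has_derivative_bounded_linear[OF elim(5)]]] by metis
    then show ?case using elim(2) by (auto simp: vec_eq_iff forall_2)
  qed
  have main: "\<forall>\<^sub>F t in nhds 0. pd 2 n (s t) = 0"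
  proof -
    have \<eta>e: "\<forall>\<^sub>F q in nhds 0. \<eta> q \<noteq> 0" "\<forall>\<^sub>F t in nhds 0. frechet_derivative f (at (\<gamma> t)) (\<eta> (\<gamma> t)) = 0"
      using \<eta> by (auto simp: null_vector_field_def)
    have inv: "\<forall>\<^sub>F t in nhds 0. \<forall>X. frechet_derivative \<phi> (at (s t)) (frechet_derivative \<psi> (at (\<gamma> t)) X) = X"
      using eventually_compose_germ[OF \<gamma>s \<gamma>0 frechet_inverse_germ[OF \<phi>s(1) \<psi>(2,3,4)]] by (simp add: s_def)
    have f\<gamma>: "\<forall>\<^sub>F t in nhds 0. vector_derivative (f \<circ> \<gamma>) (at t) = frechet_derivative f (at (\<gamma> t)) (frechet_derivative \<gamma> (at t) 1)"
      using smooth_germ_has_derivative[OF \<gamma>s] eventually_compose_germ[OF \<gamma>s \<gamma>0 smooth_germ_has_derivative[OF f]]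
    proof eventually_elim
      case (elim t)
      note c = has_derivative_compose[OF elim]
      have "((f \<circ> \<gamma>) has_vector_derivative frechet_derivative f (at (\<gamma> t)) (frechet_derivative \<gamma> (at t) 1)) (at t)"
        using c by (simp add: has_vector_derivative_def o_def
            linear_cmul[OF bounded_linear.linear[OF has_derivative_bounded_linear[OF c]], of _ 1, symmetric])
      then show ?case by (rule vector_derivative_at)
    qed
    have scal: "\<forall>\<^sub>F t in nhds 0. vector_derivative (f \<circ> \<gamma>) (at t) = ds t $ 1 *\<^sub>R pd 1 g (s t)"
      using f\<gamma> d\<gamma> \<phi>s\<gamma> eventually_compose_germ[OF s Dg] ds2
        eventually_compose_germ[OF s smooth_germ_has_derivative[OF g]]
    proof eventually_elim
      case (elim t)
      have "vector_derivative (f \<circ> \<gamma>) (at t) = frechet_derivative g (at (s t)) (ds t)"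
        using elim(1-4) by simp
      also have "\<dots> = ds t $ 1 *\<^sub>R pd 1 g (s t)"
        using frechet_eq_pd[OF elim(6)] elim(5) by simp
      finally show ?case .
    qed
    have null: "\<forall>\<^sub>F t in nhds 0. \<exists>b. b \<noteq> 0 \<and> frechet_derivative \<nu> (at (\<gamma> t)) (\<eta> (\<gamma> t)) = b *\<^sub>R pd 2 n (s t)"
      using inv \<phi>s\<gamma> eventually_compose_germ[OF s Dg] eventually_compose_germ[OF s Dn]
        eventually_compose_germ[OF s smooth_germ_has_derivative[OF g]]
        eventually_compose_germ[OF s smooth_germ_has_derivative[OF n]]
        eventually_compose_germ[OF s smooth_germ_has_derivative[OF \<phi>s(1)]]
        eventually_compose_germ[OF \<gamma>s \<gamma>0 \<eta>e(1)] \<eta>e(2) eventually_compose_germ[OF s ad] s2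
    proof eventually_elim
      case (elim t)
      define Y where "Y = frechet_derivative \<psi> (at (\<gamma> t)) (\<eta> (\<gamma> t))"
      have Y: "frechet_derivative \<phi> (at (s t)) Y = \<eta> (\<gamma> t)" using elim(1) by (simp add: Y_def)
      have "frechet_derivative g (at (s t)) Y = 0" using elim(2,3,9) Y by simp
      then have "Y $ 1 *\<^sub>R pd 1 g (s t) = 0"
        using frechet_eq_pd[OF elim(5), of Y] elim(10,11) by simp
      then have Y1: "Y $ 1 = 0" using elim(10,11) by force
      have "Y \<noteq> 0"
        using Y elim(8) linear_0[OF bounded_linear.linear[OF has_derivative_bounded_linear[OF elim(7)]]] by metis
      then have "Y $ 2 \<noteq> 0" using Y1 by (auto simp: vec_eq_iff forall_2)
      moreover have "frechet_derivative \<nu> (at (\<gamma> t)) (\<eta> (\<gamma> t)) = Y $ 2 *\<^sub>R pd 2 n (s t)"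
        using elim(2,4) Y frechet_eq_pd[OF elim(6), of Y] Y1 by simp
      ultimately show ?case by blast
    qed
    show ?thesis
      using psi scal null ds1 \<phi>s\<gamma> eventually_compose_germ[OF s gn] eventually_compose_germ[OF s orth]
        eventually_compose_germ[OF s ad] s2
    proof eventually_elim
      case (elim t)
      obtain b where b: "b \<noteq> 0" "frechet_derivative \<nu> (at (\<gamma> t)) (\<eta> (\<gamma> t)) = b *\<^sub>R pd 2 n (s t)"
        using elim(3) by blast
      have "\<nu> (\<gamma> t) = n (s t)" using elim(5) by (simp add: n_def)
      then have "det (vector [ds t $ 1 *\<^sub>R pd 1 g (s t), n (s t), b *\<^sub>R pd 2 n (s t)] :: real^3^3) = 0"
        using elim(1) by (simp add: psi_function_def elim(2) b(2))
      then have "ds t $ 1 * b * det (vector [pd 1 g (s t), n (s t), pd 2 n (s t)] :: real^3^3) = 0"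
        by (simp add: det_3 algebra_simps)
      then have "det (vector [pd 1 g (s t), n (s t), pd 2 n (s t)] :: real^3^3) = 0"
        using elim(4) b(1) by simp
      moreover have "(det (vector [pd 1 g (s t), n (s t), pd 2 n (s t)] :: real^3^3))\<^sup>2
          = (pd 1 g (s t) \<bullet> pd 1 g (s t)) * (n (s t) \<bullet> n (s t)) * (pd 2 n (s t) \<bullet> pd 2 n (s t))"
        by (rule det_square_orthogonal) (use elim(6,7,9) in auto)
      moreover have "pd 1 g (s t) \<bullet> pd 1 g (s t) = 1" "n (s t) \<bullet> n (s t) = 1"
        using elim(6,8,9) by (simp_all add: norm_eq_1)
      ultimately show ?case by simp
    qed
  qed
  obtain U where U: "open U" "0 \<in> U" "smooth_on s U" using s(1) by (auto simp: smooth_germ_def)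
  obtain V where V: "open V" "0 \<in> V" "\<And>t. t \<in> V \<Longrightarrow> pd 2 n (s t) = 0 \<and> s t $ 2 = 0"
    using eventually_conj[OF main s2] by (auto simp: eventually_nhds)
  obtain \<delta> where \<delta>: "\<delta> > 0" "ball 0 \<delta> \<subseteq> U \<inter> V"
    using openE[of "U \<inter> V" 0] U V by auto
  then have \<delta>': "{-\<delta><..<\<delta>} \<subseteq> U \<inter> V" by (simp add: ball_eq_greaterThanLessThan)
  have cont: "continuous_on {-\<delta><..<\<delta>} (\<lambda>t. s t $ 1)"
    by (intro continuous_intros continuous_on_subset[OF smooth_on_continuous[OF U(3)]]) (use \<delta>' in auto)
  have der: "((\<lambda>t. s t $ 1) has_real_derivative ds 0 $ 1) (at 0)"
  proof -
    note d0 = at_0[OF smooth_germ_has_derivative[OF s(1)]]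
    note d = bounded_linear.has_derivative[OF bounded_linear_vec_nth[of 1] d0]
    show ?thesis unfolding has_field_derivative_def
    proof (rule has_derivative_eq_rhs[OF d], rule ext)
      fix x :: real
      have "frechet_derivative s (at 0) (x *\<^sub>R 1) = x *\<^sub>R frechet_derivative s (at 0) 1"
        by (intro linear_cmul bounded_linear.linear has_derivative_bounded_linear[OF d0])
      then show "frechet_derivative s (at 0) x $ 1 = ds 0 $ 1 * x" by (simp add: ds_def)
    qed
  qed
  have s01: "s 0 $ 1 = 0" by (simp add: s)
  obtain r where r: "r > 0" "\<And>u. \<bar>u\<bar> < r \<Longrightarrow> \<exists>t\<in>{-\<delta><..<\<delta>}. s t $ 1 = u"
    using onto_neighbourhood_of_0[OF \<delta>(1) cont s01 der at_0[OF ds1]] by metis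
  have "pd 2 n q = 0" if "q \<in> box2 r" "q $ 2 = 0" for q
  proof -
    obtain t where t: "t \<in> {-\<delta><..<\<delta>}" "s t $ 1 = q $ 1" using r(2)[of "q $ 1"] \<open>q \<in> box2 r\<close> by (auto simp: box2_def)
    then have "t \<in> V" using \<delta>' by blast
    from V(3)[OF this] t that have "s t = q" by (simp add: vec_eq_iff forall_2)
    with V(3)[OF \<open>t \<in> V\<close>] show ?thesis by simp
  qed
  moreover have "\<forall>\<^sub>F q in nhds 0. q \<in> box2 r"
    by (rule eventually_nhds_in_open[OF open_box2]) (use r(1) in \<open>simp add: box2_def\<close>)
  ultimately show ?thesis unfolding n_def o_def by (auto elim: eventually_mono)
qed

theorem corollary4p4:
  fixes f \<nu> :: "real^2 \<Rightarrow> real^3" and \<phi> :: "real^2 \<Rightarrow> real^2"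
  defines "g \<equiv> f \<circ> \<phi>" and "n \<equiv> \<nu> \<circ> \<phi>"
  assumes "frontal f"
    and "unit_normal_field f \<nu>"
    and "pure_frontal_singular f \<nu>"
    and "\<not> cuspidal_edge_5_2 f"
    and "adapted_coordinates f \<nu> \<phi>"
    and "\<forall>\<^sub>F q in nhds 0. principal_curvature_1 g n q \<noteq> 0 \<and> principal_curvature_2 g n q \<noteq> 0"
    and "cuspidal_torsion g n 0 \<noteq> 0"
  shows "singular_point (focal_surface (principal_curvature_1 g n) g n) 0 \<and>
         singular_point (focal_surface (principal_curvature_2 g n) g n) 0"
proof -
  have f: "smooth_germ f" "f 0 = 0" using assms(3) by (auto simp: frontal_def)
  have \<phi>: "diffeo_germ \<phi>" using assms(7) by (simp add: adapted_coordinates_def)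
  then have \<phi>s: "smooth_germ \<phi>" "\<phi> 0 = 0" by (auto simp: diffeo_germ_def)
  have \<nu>: "smooth_germ \<nu>"
    "\<forall>\<^sub>F q in nhds 0. norm (\<nu> q) = 1 \<and> (\<forall>X. frechet_derivative f (at q) X \<bullet> \<nu> q = 0)"
    using assms(4) by (auto simp: unit_normal_field_def)
  have ad: "\<forall>\<^sub>F q in nhds 0. q $ 2 = 0 \<longrightarrow>
           pd 2 g q = 0 \<and>
           norm (pd 1 g q) = 1 \<and> norm (pd 2 (pd 2 g) q) = 1 \<and> norm (n q) = 1 \<and>
           pd 1 g q \<bullet> pd 2 (pd 2 g) q = 0 \<and> pd 1 g q \<bullet> n q = 0 \<and> pd 2 (pd 2 g) q \<bullet> n q = 0"
    using assms(7) unfolding adapted_coordinates_def Let_def g_def n_def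
    by (elim conjE, elim eventually_mono) blast
  interpret pure_frontal_chart g n
  proof
    show "smooth_germ g" unfolding g_def o_def by (rule smooth_germ_compose[OF f(1) \<phi>s(2,1)])
    show "smooth_germ n" unfolding n_def o_def by (rule smooth_germ_compose[OF \<nu>(1) \<phi>s(2,1)])
    show "\<forall>\<^sub>F q in nhds 0. pd 1 g q \<bullet> n q = 0 \<and> pd 2 g q \<bullet> n q = 0"
      using eventually_compose_germ[OF \<phi>s \<nu>(2)] frechet_compose_germ[OF f(1) \<phi>s]
      by eventually_elim (simp add: g_def n_def o_def pd_def)
    show "\<forall>\<^sub>F q in nhds 0. q $ 2 = 0 \<longrightarrow> pd 2 g q = 0" using ad by eventually_elim blast
    show "\<forall>\<^sub>F q in nhds 0. q $ 2 = 0 \<longrightarrow> pd 2 n q = 0"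
      unfolding n_def by (rule pd_2_normal_zero_on_axis[OF f(1) assms(4,7,5)])
    show "pd 1 g 0 \<bullet> pd 1 g 0 = 1" "pd 2 (pd 2 g) 0 \<bullet> pd 2 (pd 2 g) 0 = 1" "n 0 \<bullet> n 0 = 1"
      "pd 1 g 0 \<bullet> pd 2 (pd 2 g) 0 = 0"
      using at_0[OF ad] by (simp_all add: norm_eq_1)
  qed
  have g0: "g 0 = 0" by (simp add: g_def f \<phi>s)
  have "five_halves_invariant = 0"
  proof (rule ccontr)
    assume "five_halves_invariant \<noteq> 0"
    from A_equivalent_cuspidal_edge_5_2[OF g0 this]
    obtain \<theta> \<Phi> where \<theta>: "diffeo_germ \<theta>" "diffeo_germ \<Phi>"
      "\<forall>\<^sub>F x in nhds 0. g (\<theta> x) = \<Phi> (vector [x $ 1, (x $ 2)\<^sup>2, (x $ 2) ^ 5])"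
      unfolding A_equivalent_def by blast
    then have "cuspidal_edge_5_2 f"
      using diffeo_germ_compose[OF \<phi> \<theta>(1)]
      unfolding cuspidal_edge_5_2_def A_equivalent_def g_def o_def by blast
    then show False using assms(6) by blast
  qed
  moreover have "M_t g n 0 \<noteq> 0" using assms(9) by (simp add: cuspidal_torsion_def)
  ultimately show ?thesis using focal_surfaces_singular at_0[OF assms(8)] by blast
qed

end
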